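(* Let $Q$ be a smooth manifold and $H:T^*Q\to\mathbb{R}$ a smooth function, with hamiltonian flow $\Psi_t$. Let $\mathcal{E}=\mathbb{R}$ and $$W_H:=\Big\{\big((t,H(\Psi_t(z))),\,z,\,\Psi_t(z)\big): t\in I_z,\ z\in T^*Q\Big\}\subset\overline{T^*\mathcal{E}}\times\overline{T^*Q}\times T^*Q,$$ where $I_z$ is the maximal interval on which $\Psi_t(z)$ is defined, and let $J:Q\to\mathcal{E}\times Q$, $J(q)=(H(0,q),q)$. Then the germ of $W_H$ around $\operatorname{gr}J$ is a symplectic micromorphism $([W_H],J):T^*\mathcal{E}\otimes T^*Q\to T^*Q$.
   Context: A microfold $[G,A]$ is a germ of a manifold $G$ around a closed submanifold $A$ (the core). A vector bundle $E\to A$ is regarded as the microfold $[E,Z_A]$, $Z_A$ the zero section, identified with $A$. A submicrofold $[H,B]\subset[G,A]$ is a microfold with representatives such that $B\subset A$, $H\subset G$ are submanifolds and $H\cap A=B$; it is lagrangian if $H$ is lagrangian in the symplectic manifold $G$. $\overline{M}$ is $M$ with the opposite symplectic form; $[M,A]\otimes[N,B]:=[M\times N,A\times B]$, so $T^*\mathcal{E}\otimes T^*Q=T^*(\mathcal{E}\times Q)$; $\operatorname{gr}\phi=\{(\phi(x),x)\}$. A symplectic micromorphism $([V],\phi):T^*A\to T^*B$ is a lagrangian submicrofold $[V,\operatorname{gr}\phi]\subset[\overline{T^*A}\times T^*B,A\times B]$, with $\phi:B\to A$ smooth (the core map), such that $TV$ is transverse along $\operatorname{gr}\phi$ to the lagrangian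 subbundle $TZ_A\times V(T^*B)$, with $V(T^*B)$ the vertical subbundle. Points of $T^*Q$ are written $(p,q)$ with $p$ the covector, and points of $T^*\mathcal{E}$ are written $(t,E)$ with $E\in\mathcal{E}$ the base point (energy) and $t$ the fiber coordinate (time). Sign convention: with $\omega=dp\wedge dq$ on $T^*Q$ (and $dt\wedge dE$ on $T^*\mathcal{E}$), the hamiltonian vector field is defined by $\iota_{X_H}\omega=dH$, i.e. $\dot p=\partial_qH$, $\dot q=-\partial_pH$, and $\Psi_t$ is the flow of $X_H$. *)

theory Defs
  imports "HOL-Analysis.Analysis"
begin

section \<open>Smoothness on open subsets of finite-dimensional spaces\<close>

text \<open>
  The model space is a linear subspace \<open>L\<close> of a Euclidean space rather than the whole space: since
  every \<open>euclidean_space\<close> has positive dimension, this is what makes manifolds of dimension 0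
  available. Throughout, \<open>S\<close> is meant to be open in \<open>L\<close>; then the derivative at a point of \<open>S\<close>
  within \<open>S\<close> is determined on \<open>L\<close>, and it is only ever evaluated on \<open>L\<close>.
\<close>

primrec Ck_on :: "nat \<Rightarrow> 'e::euclidean_space set \<Rightarrow> 'e set \<Rightarrow> ('e \<Rightarrow> 'f::euclidean_space) \<Rightarrow> bool" where
  "Ck_on 0 L S f \<longleftrightarrow> continuous_on S f"
| "Ck_on (Suc k) L S f \<longleftrightarrow>
     (\<exists>f'. (\<forall>x\<in>S. (f has_derivative f' x) (at x within S)) \<and> (\<forall>v\<in>L. Ck_on k L S (\<lambda>x. f' x v)))"

definition smooth_on :: "'e::euclidean_space set \<Rightarrow> 'e set \<Rightarrow> ('e \<Rightarrow> 'f::euclidean_space) \<Rightarrow> bool" where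
  "smooth_on L S f \<longleftrightarrow> (\<forall>k. Ck_on k L S f)"

definition diffeo_on :: "'e::euclidean_space set \<Rightarrow> 'e set \<Rightarrow> ('e \<Rightarrow> 'e) \<Rightarrow> bool" where
  "diffeo_on L S f \<longleftrightarrow>
     openin (top_of_set L) S \<and> openin (top_of_set L) (f ` S) \<and> inj_on f S \<and>
     smooth_on L S f \<and> smooth_on L (f ` S) (inv_into S f)"


section \<open>Smooth manifolds\<close>

text \<open>
  A manifold is presented by an indexed atlas: for each index \<open>i\<close> a domain \<open>mdom M i\<close> and a chart
  \<open>mchart M i\<close> from it to the model space. The point set and the topology are the ones determined
  by the atlas.
\<close>

record ('i, 'a, 'e) manifold =
  midx :: "'i set"
  mdom :: "'i \<Rightarrow> 'a set"
  mchart :: "'i \<Rightarrow> 'a \<Rightarrow> 'e"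
  mmodel :: "'e set"

definition points :: "('i, 'a, 'e) manifold \<Rightarrow> 'a set" where
  "points M = (\<Union>i\<in>midx M. mdom M i)"

definition charts_at :: "('i, 'a, 'e) manifold \<Rightarrow> 'a \<Rightarrow> 'i set" where
  "charts_at M x = {i \<in> midx M. x \<in> mdom M i}"

definition chart_inv :: "('i, 'a, 'e) manifold \<Rightarrow> 'i \<Rightarrow> 'e \<Rightarrow> 'a" where
  "chart_inv M i = inv_into (mdom M i) (mchart M i)"

definition mtop :: "('i, 'a, 'e::euclidean_space) manifold \<Rightarrow> 'a topology" where
  "mtop M = topology (\<lambda>U. U \<subseteq> points M \<and>
     (\<forall>i\<in>midx M. openin (top_of_set (mmodel M)) (mchart M i ` (U \<inter> mdom M i))))"

definition smooth_manifold :: "('i, 'a, 'e::euclidean_space) manifold \<Rightarrow> bool" where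
  "smooth_manifold M \<longleftrightarrow>
     subspace (mmodel M) \<and>
     (\<forall>i\<in>midx M. inj_on (mchart M i) (mdom M i)) \<and>
     (\<forall>i\<in>midx M. \<forall>j\<in>midx M.
        openin (top_of_set (mmodel M)) (mchart M i ` (mdom M i \<inter> mdom M j)) \<and>
        smooth_on (mmodel M) (mchart M i ` (mdom M i \<inter> mdom M j)) (mchart M j \<circ> chart_inv M i)) \<and>
     Hausdorff_space (mtop M) \<and> second_countable (mtop M)"

definition smooth_map ::
  "('i, 'a, 'e::euclidean_space) manifold \<Rightarrow> ('j, 'b, 'f::euclidean_space) manifold \<Rightarrow> ('a \<Rightarrow> 'b) \<Rightarrow> bool" where
  "smooth_map M N f \<longleftrightarrow>
     continuous_map (mtop M) (mtop N) f \<and>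
     (\<forall>i\<in>midx M. \<forall>j\<in>midx N.
        smooth_on (mmodel M) (mchart M i ` (mdom M i \<inter> f -` mdom N j)) (mchart N j \<circ> f \<circ> chart_inv M i))"

definition real_manifold :: "(unit, real, real) manifold" where
  "real_manifold = \<lparr>midx = UNIV, mdom = (\<lambda>_. UNIV), mchart = (\<lambda>_ x. x), mmodel = UNIV\<rparr>"

definition prod_manifold ::
  "('i, 'a, 'e) manifold \<Rightarrow> ('j, 'b, 'f) manifold \<Rightarrow> ('i \<times> 'j, 'a \<times> 'b, 'e \<times> 'f) manifold" where
  "prod_manifold M N =
     \<lparr>midx = midx M \<times> midx N,
      mdom = (\<lambda>(i, j). mdom M i \<times> mdom N j),
      mchart = (\<lambda>(i, j) (x, y). (mchart M i x, mchart N j y)),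
      mmodel = mmodel M \<times> mmodel N\<rparr>"


section \<open>Tangent vectors and covectors\<close>

text \<open>
  Derivative, at a point \<open>x\<close> of both domains, of the transition map from chart \<open>i\<close> to chart \<open>j\<close>.
\<close>

definition transition_deriv ::
  "('i, 'a, 'e::euclidean_space) manifold \<Rightarrow> 'a \<Rightarrow> 'i \<Rightarrow> 'i \<Rightarrow> 'e \<Rightarrow> 'e" where
  "transition_deriv M x i j =
     frechet_derivative (mchart M j \<circ> chart_inv M i)
       (at (mchart M i x) within mchart M i ` (mdom M i \<inter> mdom M j))"

text \<open>
  A tangent vector at \<open>x\<close> is the family of its coordinate representations in all charts at \<open>x\<close>,
  related by the derivatives of the transition maps; the value at all other indices is fixed to 0,
  so that equal tangent vectors are equal as functions. Covectors are represented likewise, the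
  model space being identified with its dual by the inner product, so that the components of a
  covector transform contragrediently.
\<close>

definition tangent_space :: "('i, 'a, 'e::euclidean_space) manifold \<Rightarrow> 'a \<Rightarrow> ('i \<Rightarrow> 'e) set" where
  "tangent_space M x = {v.
     (\<forall>i. i \<notin> charts_at M x \<longrightarrow> v i = 0) \<and>
     (\<forall>i\<in>charts_at M x. v i \<in> mmodel M) \<and>
     (\<forall>i\<in>charts_at M x. \<forall>j\<in>charts_at M x. v j = transition_deriv M x i j (v i))}"

definition cotangent_space :: "('i, 'a, 'e::euclidean_space) manifold \<Rightarrow> 'a \<Rightarrow> ('i \<Rightarrow> 'e) set" where
  "cotangent_space M x = {p.
     (\<forall>i. i \<notin> charts_at M x \<longrightarrow> p i = 0) \<and>
     (\<forall>i\<in>charts_at M x. p i \<in> mmodel M) \<and>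
     (\<forall>i\<in>charts_at M x. \<forall>j\<in>charts_at M x. \<forall>v\<in>mmodel M.
        p i \<bullet> v = p j \<bullet> transition_deriv M x i j v)}"

text \<open>The definition of the differential does not depend on the chart chosen at \<open>x\<close>.\<close>

definition differential ::
  "('i, 'a, 'e::euclidean_space) manifold \<Rightarrow> ('j, 'b, 'f::euclidean_space) manifold \<Rightarrow> ('a \<Rightarrow> 'b) \<Rightarrow>
   'a \<Rightarrow> ('i \<Rightarrow> 'e) \<Rightarrow> ('j \<Rightarrow> 'f)" where
  "differential M N f x v = (\<lambda>j.
     if j \<in> charts_at N (f x) then
       let i = (SOME i. i \<in> charts_at M x) in
         frechet_derivative (mchart N j \<circ> f \<circ> chart_inv M i)
           (at (mchart M i x) within mchart M i ` (mdom M i \<inter> f -` mdom N j)) (v i)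
     else 0)"

definition cotangent ::
  "('i, 'a, 'e::euclidean_space) manifold \<Rightarrow> ('i, ('i \<Rightarrow> 'e) \<times> 'a, 'e \<times> 'e) manifold" where
  "cotangent M =
     \<lparr>midx = midx M,
      mdom = (\<lambda>i. {(p, q). q \<in> mdom M i \<and> p \<in> cotangent_space M q}),
      mchart = (\<lambda>i (p, q). (p i, mchart M i q)),
      mmodel = mmodel M \<times> mmodel M\<rparr>"

definition zero_covector :: "'a \<Rightarrow> ('i \<Rightarrow> 'e::euclidean_space) \<times> 'a" where
  "zero_covector q = ((\<lambda>_. 0), q)"

definition zero_section :: "('i, 'a, 'e::euclidean_space) manifold \<Rightarrow> (('i \<Rightarrow> 'e) \<times> 'a) set" where
  "zero_section M = zero_covector ` points M"

text \<open>The canonical identification of \<open>T\<^sup>*M \<times> T\<^sup>*N\<close> with \<open>T\<^sup>*(M \<times> N)\<close>.\<close>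

definition cotangent_pair ::
  "('i, 'a, 'e::euclidean_space) manifold \<Rightarrow> ('j, 'b, 'f::euclidean_space) manifold \<Rightarrow>
   ('i \<Rightarrow> 'e) \<times> 'a \<Rightarrow> ('j \<Rightarrow> 'f) \<times> 'b \<Rightarrow> ('i \<times> 'j \<Rightarrow> 'e \<times> 'f) \<times> ('a \<times> 'b)" where
  "cotangent_pair M N = (\<lambda>(p, x) (p', y).
     ((\<lambda>(i, j). if i \<in> charts_at M x \<and> j \<in> charts_at N y then (p i, p' j) else 0), (x, y)))"

text \<open>The point \<open>(t, E)\<close> of the cotangent bundle of the real line, which has a single chart.\<close>

definition real_covector :: "real \<Rightarrow> real \<Rightarrow> (unit \<Rightarrow> real) \<times> real" where
  "real_covector t E = ((\<lambda>_. t), E)"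


section \<open>Symplectic forms\<close>

text \<open>A 2-form on a manifold, as a function of a point and two tangent vectors there.\<close>

type_synonym ('i, 'a, 'e) form2 = "'a \<Rightarrow> ('i \<Rightarrow> 'e) \<Rightarrow> ('i \<Rightarrow> 'e) \<Rightarrow> real"

text \<open>
  The form \<open>dp \<and> dq\<close> on the cotangent bundle, evaluated in a cotangent chart. As it is the exterior
  derivative of the tautological 1-form \<open>p dq\<close>, it does not depend on the chart chosen.
\<close>

definition canonical_form :: "('i, 'a, 'e::euclidean_space) manifold \<Rightarrow> ('i, ('i \<Rightarrow> 'e) \<times> 'a, 'e \<times> 'e) form2" where
  "canonical_form M z u v =
     (let i = (SOME i. i \<in> charts_at (cotangent M) z)
      in fst (u i) \<bullet> snd (v i) - fst (v i) \<bullet> snd (u i))"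

definition opposite_form :: "('i, 'a, 'e) form2 \<Rightarrow> ('i, 'a, 'e) form2" where
  "opposite_form \<omega> x u v = - \<omega> x u v"

definition pullback ::
  "('i, 'a, 'e::euclidean_space) manifold \<Rightarrow> ('j, 'b, 'f::euclidean_space) manifold \<Rightarrow> ('a \<Rightarrow> 'b) \<Rightarrow>
   ('j, 'b, 'f) form2 \<Rightarrow> ('i, 'a, 'e) form2" where
  "pullback M N f \<omega> x u v = \<omega> (f x) (differential M N f x u) (differential M N f x v)"

definition prod_form ::
  "('i, 'a, 'e::euclidean_space) manifold \<Rightarrow> ('j, 'b, 'f::euclidean_space) manifold \<Rightarrow>
   ('i, 'a, 'e) form2 \<Rightarrow> ('j, 'b, 'f) form2 \<Rightarrow> ('i \<times> 'j, 'a \<times> 'b, 'e \<times> 'f) form2" where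
  "prod_form M N \<omega> \<sigma> x u v =
     pullback (prod_manifold M N) M fst \<omega> x u v + pullback (prod_manifold M N) N snd \<sigma> x u v"


section \<open>Hamiltonian flows\<close>

definition hamiltonian_field ::
  "('i, 'a, 'e::euclidean_space) manifold \<Rightarrow> ('i, 'a, 'e) form2 \<Rightarrow> ('a \<Rightarrow> real) \<Rightarrow> 'a \<Rightarrow> ('i \<Rightarrow> 'e)" where
  "hamiltonian_field M \<omega> H z =
     (THE v. v \<in> tangent_space M z \<and>
        (\<forall>w\<in>tangent_space M z. \<omega> z v w = differential M real_manifold H z w ()))"

definition integral_curve ::
  "('i, 'a, 'e::euclidean_space) manifold \<Rightarrow> ('a \<Rightarrow> ('i \<Rightarrow> 'e)) \<Rightarrow> real set \<Rightarrow> (real \<Rightarrow> 'a) \<Rightarrow> bool" where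
  "integral_curve M X I c \<longleftrightarrow>
     open I \<and> is_interval I \<and> continuous_map (top_of_set I) (mtop M) c \<and>
     (\<forall>t\<in>I. \<forall>i\<in>charts_at M (c t). ((mchart M i \<circ> c) has_vector_derivative X (c t) i) (at t))"

definition flow_interval ::
  "('i, 'a, 'e::euclidean_space) manifold \<Rightarrow> ('a \<Rightarrow> ('i \<Rightarrow> 'e)) \<Rightarrow> 'a \<Rightarrow> real set" where
  "flow_interval M X z = \<Union>{I. 0 \<in> I \<and> (\<exists>c. integral_curve M X I c \<and> c 0 = z)}"

definition flow ::
  "('i, 'a, 'e::euclidean_space) manifold \<Rightarrow> ('a \<Rightarrow> ('i \<Rightarrow> 'e)) \<Rightarrow> real \<Rightarrow> 'a \<Rightarrow> 'a" where
  "flow M X t z = (THE y. \<exists>I c. integral_curve M X I c \<and> 0 \<in> I \<and> t \<in> I \<and> c 0 = z \<and> c t = y)"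


section \<open>Submanifolds\<close>

text \<open>Embedded submanifolds of dimension \<open>k\<close>, by the local slice condition.\<close>

definition submanifold :: "('i, 'a, 'e::euclidean_space) manifold \<Rightarrow> nat \<Rightarrow> 'a set \<Rightarrow> bool" where
  "submanifold M k S \<longleftrightarrow>
     S \<subseteq> points M \<and>
     (\<forall>x\<in>S. \<exists>i\<in>charts_at M x. \<exists>U \<psi> K.
        mchart M i x \<in> U \<and> U \<subseteq> mchart M i ` mdom M i \<and> diffeo_on (mmodel M) U \<psi> \<and>
        subspace K \<and> K \<subseteq> mmodel M \<and> dim K = k \<and>
        \<psi> ` (U \<inter> mchart M i ` (S \<inter> mdom M i)) = \<psi> ` U \<inter> K)"

text \<open>
  The tangent space of a submanifold, as a subspace of the ambient tangent space: the velocities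
  of smooth curves in \<open>S\<close>.
\<close>

definition tangent_sub :: "('i, 'a, 'e::euclidean_space) manifold \<Rightarrow> 'a set \<Rightarrow> 'a \<Rightarrow> ('i \<Rightarrow> 'e) set" where
  "tangent_sub M S x = {v \<in> tangent_space M x.
     \<exists>i\<in>charts_at M x. \<exists>(\<gamma> :: real \<Rightarrow> 'a) \<epsilon>.
       \<epsilon> > 0 \<and> \<gamma> 0 = x \<and> \<gamma> ` {-\<epsilon><..<\<epsilon>} \<subseteq> S \<inter> mdom M i \<and>
       smooth_on UNIV {-\<epsilon><..<\<epsilon>} (mchart M i \<circ> \<gamma>) \<and>
       ((mchart M i \<circ> \<gamma>) has_vector_derivative v i) (at 0)}"

definition lagrangian :: "('i, 'a, 'e::euclidean_space) manifold \<Rightarrow> ('i, 'a, 'e) form2 \<Rightarrow> 'a set \<Rightarrow> bool" where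
  "lagrangian M \<omega> S \<longleftrightarrow>
     (\<exists>k. 2 * k = dim (mmodel M) \<and> submanifold M k S) \<and>
     (\<forall>x\<in>S. \<forall>u\<in>tangent_sub M S x. \<forall>v\<in>tangent_sub M S x. \<omega> x u v = 0)"

definition transverse_at ::
  "('i, 'a, 'e::euclidean_space) manifold \<Rightarrow> 'a \<Rightarrow> ('i \<Rightarrow> 'e) set \<Rightarrow> ('i \<Rightarrow> 'e) set \<Rightarrow> bool" where
  "transverse_at M x S T \<longleftrightarrow> {(\<lambda>i. u i + v i) | u v. u \<in> S \<and> v \<in> T} = tangent_space M x"


section \<open>Microfolds and symplectic micromorphisms\<close>

text \<open>
  The germ around \<open>C\<close> of a subset \<open>V\<close> of \<open>M\<close>: all subsets of \<open>M\<close> that agree with \<open>V\<close> on an open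
  neighbourhood of \<open>C\<close>.
\<close>

definition germ_around :: "('i, 'a, 'e::euclidean_space) manifold \<Rightarrow> 'a set \<Rightarrow> 'a set \<Rightarrow> 'a set set" where
  "germ_around M C V =
     {V'. V' \<subseteq> points M \<and> (\<exists>U. openin (mtop M) U \<and> C \<subseteq> U \<and> V' \<inter> U = V \<inter> U)}"

text \<open>
  \<open>V\<close> and \<open>C\<close> are representatives exhibiting the germ of \<open>V\<close> around \<open>C\<close> as a submicrofold of the
  microfold given by \<open>M\<close> and its closed submanifold \<open>A\<close>. Replacing \<open>M\<close> by an open neighbourhood of
  \<open>A\<close> in \<open>M\<close> would not give more. As \<open>V\<close> and \<open>A\<close> are embedded, \<open>C\<close> is an embedded submanifold of
  each of them as soon as it is one of \<open>M\<close>.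
\<close>

definition represents_submicrofold ::
  "('i, 'a, 'e::euclidean_space) manifold \<Rightarrow> 'a set \<Rightarrow> 'a set \<Rightarrow> 'a set \<Rightarrow> bool" where
  "represents_submicrofold M A V C \<longleftrightarrow>
     (\<exists>k. submanifold M k V) \<and> (\<exists>k. submanifold M k C) \<and>
     C \<subseteq> A \<and> closedin (subtopology (mtop M) V) C \<and> V \<inter> A = C"

text \<open>
  For the cotangent bundles of \<open>A\<close> and \<open>B\<close>: the manifold underlying the product of \<open>T\<^sup>*A\<close> (with the
  opposite form) and \<open>T\<^sup>*B\<close>, its symplectic form, its core, and the graph of a core map in it.
\<close>

abbreviation morphism_space ::
  "('i, 'a, 'e::euclidean_space) manifold \<Rightarrow> ('j, 'b, 'f::euclidean_space) manifold \<Rightarrow>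
   ('i \<times> 'j, (('i \<Rightarrow> 'e) \<times> 'a) \<times> (('j \<Rightarrow> 'f) \<times> 'b), ('e \<times> 'e) \<times> ('f \<times> 'f)) manifold" where
  "morphism_space A B \<equiv> prod_manifold (cotangent A) (cotangent B)"

definition morphism_form ::
  "('i, 'a, 'e::euclidean_space) manifold \<Rightarrow> ('j, 'b, 'f::euclidean_space) manifold \<Rightarrow>
   ('i \<times> 'j, (('i \<Rightarrow> 'e) \<times> 'a) \<times> (('j \<Rightarrow> 'f) \<times> 'b), ('e \<times> 'e) \<times> ('f \<times> 'f)) form2" where
  "morphism_form A B =
     prod_form (cotangent A) (cotangent B) (opposite_form (canonical_form A)) (canonical_form B)"

definition morphism_core ::
  "('i, 'a, 'e::euclidean_space) manifold \<Rightarrow> ('j, 'b, 'f::euclidean_space) manifold \<Rightarrow>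
   ((('i \<Rightarrow> 'e) \<times> 'a) \<times> (('j \<Rightarrow> 'f) \<times> 'b)) set" where
  "morphism_core A B = zero_section A \<times> zero_section B"

definition core_graph ::
  "('j, 'b, 'f::euclidean_space) manifold \<Rightarrow> ('b \<Rightarrow> 'a) \<Rightarrow>
   ((('i \<Rightarrow> 'e::euclidean_space) \<times> 'a) \<times> (('j \<Rightarrow> 'f) \<times> 'b)) set" where
  "core_graph B \<phi> = {(zero_covector (\<phi> b), zero_covector b) | b. b \<in> points B}"

text \<open>The vertical subbundle: the kernel of the differential of the bundle projection.\<close>

definition vertical_space ::
  "('j, 'b, 'f::euclidean_space) manifold \<Rightarrow> ('j \<Rightarrow> 'f) \<times> 'b \<Rightarrow> ('j \<Rightarrow> 'f \<times> 'f) set" where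
  "vertical_space B y =
     {v \<in> tangent_space (cotangent B) y. differential (cotangent B) B snd y v = (\<lambda>_. 0)}"

text \<open>The fibre at \<open>(x, y)\<close> of the product of the tangent bundle of the zero section and the vertical bundle.\<close>

definition zero_vertical_space ::
  "('i, 'a, 'e::euclidean_space) manifold \<Rightarrow> ('j, 'b, 'f::euclidean_space) manifold \<Rightarrow>
   (('i \<Rightarrow> 'e) \<times> 'a) \<times> (('j \<Rightarrow> 'f) \<times> 'b) \<Rightarrow> ('i \<times> 'j \<Rightarrow> ('e \<times> 'e) \<times> ('f \<times> 'f)) set" where
  "zero_vertical_space A B z =
     {w \<in> tangent_space (morphism_space A B) z.
        differential (morphism_space A B) (cotangent A) fst z w
          \<in> tangent_sub (cotangent A) (zero_section A) (fst z) \<and>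
        differential (morphism_space A B) (cotangent B) snd z w \<in> vertical_space B (snd z)}"

definition symplectic_micromorphism ::
  "('i, 'a, 'e::euclidean_space) manifold \<Rightarrow> ('j, 'b, 'f::euclidean_space) manifold \<Rightarrow>
   ((('i \<Rightarrow> 'e) \<times> 'a) \<times> (('j \<Rightarrow> 'f) \<times> 'b)) set set \<Rightarrow> ('b \<Rightarrow> 'a) \<Rightarrow> bool" where
  "symplectic_micromorphism A B \<V> \<phi> \<longleftrightarrow>
     smooth_manifold A \<and> smooth_manifold B \<and> smooth_map B A \<phi> \<and>
     (\<exists>V. \<V> = germ_around (morphism_space A B) (core_graph B \<phi>) V \<and>
        represents_submicrofold (morphism_space A B) (morphism_core A B) V (core_graph B \<phi>) \<and>
        lagrangian (morphism_space A B) (morphism_form A B) V \<and>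
        (\<forall>z\<in>core_graph B \<phi>.
           transverse_at (morphism_space A B) z
             (tangent_sub (morphism_space A B) V z) (zero_vertical_space A B z)))"


section \<open>The germ generated by a hamiltonian flow\<close>

abbreviation ham_field ::
  "('i, 'q, 'e::euclidean_space) manifold \<Rightarrow> (('i \<Rightarrow> 'e) \<times> 'q \<Rightarrow> real) \<Rightarrow>
   ('i \<Rightarrow> 'e) \<times> 'q \<Rightarrow> ('i \<Rightarrow> 'e \<times> 'e)" where
  "ham_field Q H \<equiv> hamiltonian_field (cotangent Q) (canonical_form Q) H"

definition W_ham ::
  "('i, 'q, 'e::euclidean_space) manifold \<Rightarrow> (('i \<Rightarrow> 'e) \<times> 'q \<Rightarrow> real) \<Rightarrow>
   (((unit \<times> 'i \<Rightarrow> real \<times> 'e) \<times> (real \<times> 'q)) \<times> (('i \<Rightarrow> 'e) \<times> 'q)) set" where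
  "W_ham Q H =
     (let \<Psi> = flow (cotangent Q) (ham_field Q H) in
      {(cotangent_pair real_manifold Q (real_covector t (H (\<Psi> t z))) z, \<Psi> t z) | t z.
         z \<in> points (cotangent Q) \<and> t \<in> flow_interval (cotangent Q) (ham_field Q H) z})"

definition J_ham :: "(('i \<Rightarrow> 'e::euclidean_space) \<times> 'q \<Rightarrow> real) \<Rightarrow> 'q \<Rightarrow> real \<times> 'q" where
  "J_ham H q = (H (zero_covector q), q)"

end

theory Submission
  imports Defs
begin

text \<open>
  Near the zero section the hamiltonian flow is, in a cotangent chart, a smooth map \<open>\<Phi> (\<zeta>, t)\<close>, so
  near \<open>gr J\<close> the set \<open>W\<^sub>H\<close> is the graph of \<open>(t, \<zeta>) \<mapsto> (H (\<Phi> (\<zeta>, t)), \<Phi> (\<zeta>, t))\<close>, a submanifold of half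
  the dimension. Its tangent vectors over \<open>(\<tau>, w)\<close> have image component
  \<open>c = D\<Phi>\<^sub>t w + \<tau> X\<close> and energy component \<open>dH c = \<omega>(X, c)\<close>. Since \<open>D\<Phi>\<^sub>t\<close> is symplectic (the time
  derivative of \<open>\<omega>(D\<Phi>\<^sub>t w, D\<Phi>\<^sub>t w')\<close> vanishes by symmetry of the second derivative of \<open>H\<close>), the form
  vanishes on them. At \<open>t = 0\<close> the map \<open>D\<Phi>\<^sub>t\<close> is the identity, and transversality amounts to solving
  for the base component of \<open>w\<close>.

  Smoothness of the flow is proved for all equations depending on a parameter at once: the derivative
  in the parameter solves the linearised equation, which has the same Lipschitz constant in the state
  and hence lives on the same short time interval. Induction on the order of differentiability thus
  stays within the same types and the same domain.
\<close>

section \<open>Calculus of smooth functions\<close>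

text \<open>Smoothness is given only along the model space \<open>L\<close>, possibly a proper
  subspace, so ambient directions are out of reach. Composing with an orthogonal projection onto
  \<open>L\<close> gives maps smooth on an open set of the whole Euclidean space; equations are
  solved there, and solutions starting in \<open>L\<close> stay in \<open>L\<close>.

  Only a short-time flow inside a single chart is ever constructed. Openness of the maximal flow
  domain and smoothness for large times are avoided by cutting \<open>W_ham\<close> down to an open
  neighbourhood of \<open>gr J\<close>, which leaves the germ alone. There the chart picture is
  exact because \<open>t\<close> and the starting point are themselves coordinates of the ambient
  space: a point of the neighbourhood determines both, and uniqueness of integral curves in a
  Hausdorff manifold determines the rest, so no further sheet of \<open>W_ham\<close> passes nearby.

  The evolution relation near the core, the core and the zero section are all graphs over coordinate
  subspaces. A shear with explicit inverse straightens such a graph, so slice charts and tangent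
  spaces come without the implicit function theorem.\<close>

lemma Ck_on_cong:
  assumes "Ck_on k L S f" "\<And>x. x \<in> S \<Longrightarrow> f x = g x"
  shows "Ck_on k L S g"
proof (cases k)
  case 0
  then show ?thesis using assms by (simp cong: continuous_on_cong)
next
  case (Suc m)
  then obtain f' where f': "\<And>x. x \<in> S \<Longrightarrow> (f has_derivative f' x) (at x within S)"
    "\<And>v. v \<in> L \<Longrightarrow> Ck_on m L S (\<lambda>x. f' x v)"
    using assms(1) by auto
  have "(g has_derivative f' x) (at x within S)" if "x \<in> S" for x
    using has_derivative_transform[OF that _ f'(1)[OF that]] assms(2) by auto
  then show ?thesis using f'(2) Suc by auto
qed

lemma Ck_on_mono:
  assumes "Ck_on k L S f" "S' \<subseteq> S" "L' \<subseteq> L"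
  shows "Ck_on k L' S' f"
  using assms(1)
proof (induction k arbitrary: f)
  case 0
  then show ?case using assms by (auto intro: continuous_on_subset)
next
  case (Suc k)
  then obtain f' where f': "\<And>x. x \<in> S \<Longrightarrow> (f has_derivative f' x) (at x within S)"
    "\<And>v. v \<in> L \<Longrightarrow> Ck_on k L S (\<lambda>x. f' x v)"
    by auto
  have "(f has_derivative f' x) (at x within S')" if "x \<in> S'" for x
    using f'(1)[of x] that assms(2) has_derivative_subset by blast
  then show ?case
    using Suc.IH f'(2) assms(3) by (auto intro!: exI[of _ f'])
qed

lemma Ck_on_continuous: "Ck_on k L S f \<Longrightarrow> continuous_on S f"
  by (cases k) (auto intro: has_derivative_continuous_on)

lemma Ck_on_Suc_imp: "Ck_on (Suc k) L S f \<Longrightarrow> Ck_on k L S f"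
proof (induction k arbitrary: f)
  case 0
  then show ?case using Ck_on_continuous by fastforce
next
  case (Suc k)
  from Suc.prems obtain f' where f': "\<And>x. x \<in> S \<Longrightarrow> (f has_derivative f' x) (at x within S)"
    "\<And>v. v \<in> L \<Longrightarrow> Ck_on (Suc k) L S (\<lambda>x. f' x v)"
    unfolding Ck_on.simps(2)[of "Suc k"] by auto
  then show ?case unfolding Ck_on.simps(2)[of "k"] using Suc.IH[OF f'(2)] by (intro exI[of _ f'] conjI ballI)
qed

lemma Ck_on_const: "Ck_on k L S (\<lambda>_. c)"
  by (induction k arbitrary: c) (auto intro!: exI[of _ "\<lambda>_ _. 0"])

lemma Ck_on_bounded_linear: "bounded_linear f \<Longrightarrow> Ck_on k L S f"
  by (cases k) (auto simp: linear_continuous_on bounded_linear_imp_has_derivative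
      intro!: exI[of _ "\<lambda>_. f"] Ck_on_const)

lemma Ck_on_linear_compose:
  assumes "bounded_linear h" "Ck_on k L S f"
  shows "Ck_on k L S (\<lambda>x. h (f x))"
  using assms(2)
proof (induction k arbitrary: f)
  case 0
  then show ?case using assms(1) by (auto intro: bounded_linear.continuous_on)
next
  case (Suc k)
  then obtain f' where f': "\<And>x. x \<in> S \<Longrightarrow> (f has_derivative f' x) (at x within S)"
    "\<And>v. v \<in> L \<Longrightarrow> Ck_on k L S (\<lambda>x. f' x v)"
    by auto
  have "((\<lambda>x. h (f x)) has_derivative (\<lambda>v. h (f' x v))) (at x within S)" if "x \<in> S" for x
    using bounded_linear.has_derivative[OF assms(1) f'(1)[OF that]] .
  then show ?case
    using Suc.IH f'(2) by (auto intro!: exI[of _ "\<lambda>x v. h (f' x v)"])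
qed

lemma Ck_on_add:
  assumes "Ck_on k L S f" "Ck_on k L S g"
  shows "Ck_on k L S (\<lambda>x. f x + g x)"
  using assms
proof (induction k arbitrary: f g)
  case 0
  then show ?case by (auto intro: continuous_intros)
next
  case (Suc k)
  from Suc.prems(1) obtain f' where "\<And>x. x \<in> S \<Longrightarrow> (f has_derivative f' x) (at x within S)"
    "\<And>v. v \<in> L \<Longrightarrow> Ck_on k L S (\<lambda>x. f' x v)" by auto
  moreover from Suc.prems(2) obtain g' where "\<And>x. x \<in> S \<Longrightarrow> (g has_derivative g' x) (at x within S)"
    "\<And>v. v \<in> L \<Longrightarrow> Ck_on k L S (\<lambda>x. g' x v)" by auto
  ultimately show ?case
    using Suc.IH by (auto intro!: exI[of _ "\<lambda>x v. f' x v + g' x v"] derivative_intros)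
qed

lemma Ck_on_sum:
  "(\<And>i. i \<in> I \<Longrightarrow> Ck_on k L S (f i)) \<Longrightarrow> Ck_on k L S (\<lambda>x. \<Sum>i\<in>I. f i x)"
  by (induction I rule: infinite_finite_induct) (auto intro: Ck_on_const Ck_on_add)

lemma Ck_on_diff:
  assumes "Ck_on k L S f" "Ck_on k L S g"
  shows "Ck_on k L S (\<lambda>x. f x - g x)"
  using Ck_on_add[OF assms(1) Ck_on_linear_compose[OF bounded_linear_minus[OF bounded_linear_ident] assms(2)]]
  by simp

lemma Ck_on_Pair:
  assumes "Ck_on k L S f" "Ck_on k L S g"
  shows "Ck_on k L S (\<lambda>x. (f x, g x))"
proof -
  have "bounded_linear (\<lambda>y. (y, 0::'c))" "bounded_linear (\<lambda>z. (0::'b, z))"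
    by (auto intro!: bounded_linear_Pair bounded_linear_zero bounded_linear_ident)
  from Ck_on_add[OF Ck_on_linear_compose[OF this(1) assms(1)] Ck_on_linear_compose[OF this(2) assms(2)]]
  show ?thesis by simp
qed

lemma Ck_on_bilinear:
  assumes "bounded_bilinear h" "Ck_on k L S f" "Ck_on k L S g"
  shows "Ck_on k L S (\<lambda>x. h (f x) (g x))"
  using assms(2,3)
proof (induction k arbitrary: f g)
  case 0
  then show ?case using bounded_bilinear.continuous_on[OF assms(1)] by auto
next
  case (Suc k)
  from Suc.prems(1) obtain f' where f': "\<And>x. x \<in> S \<Longrightarrow> (f has_derivative f' x) (at x within S)"
    "\<And>v. v \<in> L \<Longrightarrow> Ck_on k L S (\<lambda>x. f' x v)" by auto
  from Suc.prems(2) obtain g' where g': "\<And>x. x \<in> S \<Longrightarrow> (g has_derivative g' x) (at x within S)"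
    "\<And>v. v \<in> L \<Longrightarrow> Ck_on k L S (\<lambda>x. g' x v)" by auto
  have "Ck_on k L S f" "Ck_on k L S g"
    using Suc.prems Ck_on_Suc_imp by blast+
  then have "\<forall>v\<in>L. Ck_on k L S (\<lambda>x. h (f x) (g' x v) + h (f' x v) (g x))"
    by (intro ballI Ck_on_add Suc.IH f'(2) g'(2))
  moreover have "\<forall>x\<in>S. ((\<lambda>x. h (f x) (g x)) has_derivative (\<lambda>v. h (f x) (g' x v) + h (f' x v) (g x))) (at x within S)"
    by (intro ballI bounded_bilinear.FDERIV[OF assms(1)] f'(1) g'(1))
  ultimately show ?case
    unfolding Ck_on.simps by (intro exI[of _ "\<lambda>x v. h (f x) (g' x v) + h (f' x v) (g x)"] conjI)
qed

lemma euclidean_expand: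
  assumes "bounded_linear h"
  shows "h y = (\<Sum>b\<in>Basis. (y \<bullet> b) *\<^sub>R h b)"
proof -
  interpret bounded_linear h by fact
  have "h y = h (\<Sum>b\<in>Basis. (y \<bullet> b) *\<^sub>R b)" by (simp add: euclidean_representation)
  then show ?thesis by (simp add: sum scaleR)
qed

lemma Ck_on_compose_UNIV:
  fixes f :: "'e::euclidean_space \<Rightarrow> 'f::euclidean_space" and g :: "'f \<Rightarrow> 'g::euclidean_space"
  assumes "Ck_on k L S f" "Ck_on k UNIV S' g" "f ` S \<subseteq> S'"
  shows "Ck_on k L S (\<lambda>x. g (f x))"
  using assms(1,2)
proof (induction k arbitrary: g)
  case 0
  then show ?case using assms(3) by (auto intro: continuous_on_compose2)
next
  case (Suc k)
  from Suc.prems obtain f' where f': "\<And>x. x \<in> S \<Longrightarrow> (f has_derivative f' x) (at x within S)"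
    "\<And>v. v \<in> L \<Longrightarrow> Ck_on k L S (\<lambda>x. f' x v)" by auto
  from Suc.prems obtain g' where g': "\<And>x. x \<in> S' \<Longrightarrow> (g has_derivative g' x) (at x within S')"
    "\<And>v. Ck_on k UNIV S' (\<lambda>x. g' x v)" by auto
  have fk: "Ck_on k L S f" using Suc.prems Ck_on_Suc_imp by blast
  have d: "((\<lambda>x. g (f x)) has_derivative (\<lambda>v. g' (f x) (f' x v))) (at x within S)" if "x \<in> S" for x
  proof -
    have "(g has_derivative g' (f x)) (at (f x) within f ` S)"
      using g'(1)[of "f x"] assms(3) that by (auto intro: has_derivative_subset)
    from has_derivative_in_compose[OF f'(1)[OF that] this] show ?thesis .
  qed
  have "Ck_on k L S (\<lambda>x. g' (f x) (f' x v))" if "v \<in> L" for v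
  proof -
    \<comment> \<open>\<open>Ck_on\<close> controls \<open>g'\<close> only in fixed directions,
      whereas the direction \<open>f' x v\<close> moves with \<open>x\<close>; expanding it in
      \<open>Basis\<close> leaves fixed directions with coefficients that are regular
      enough.\<close>
    have "Ck_on k L S (\<lambda>x. \<Sum>b\<in>Basis. (f' x v \<bullet> b) *\<^sub>R g' (f x) b)"
      by (intro Ck_on_sum Ck_on_bilinear[OF bounded_bilinear_scaleR] Suc.IH fk g'(2)
          Ck_on_linear_compose[OF bounded_linear_inner_left] f'(2) that)
    then show ?thesis
    proof (rule Ck_on_cong)
      fix x assume "x \<in> S"
      then show "(\<Sum>b\<in>Basis. (f' x v \<bullet> b) *\<^sub>R g' (f x) b) = g' (f x) (f' x v)"
        using assms(3) by (intro euclidean_expand[symmetric] has_derivative_bounded_linear[OF g'(1)]) auto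
    qed
  qed
  then show ?case using d unfolding Ck_on.simps by (intro exI[of _ "\<lambda>x v. g' (f x) (f' x v)"]) blast
qed

section \<open>Extension from a linear subspace to the ambient space\<close>

lemma orthogonal_projection_exists:
  fixes L :: "'e::euclidean_space set"
  assumes "subspace L"
  obtains P where "bounded_linear P" "\<And>x. P x \<in> L" "\<And>x. x \<in> L \<Longrightarrow> P x = x" "\<And>x y. P x \<bullet> y = x \<bullet> P y"
proof -
  obtain B where B: "B \<subseteq> L" "pairwise orthogonal B" "\<And>x. x \<in> B \<Longrightarrow> norm x = 1" "independent B" "span B = L"
    using orthonormal_basis_subspace[OF assms] by metis
  have fin: "finite B" using B(4) independent_imp_finite by blast
  define P where "P x = (\<Sum>b\<in>B. (x \<bullet> b) *\<^sub>R b)" for x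
  have 1: "bounded_linear P" unfolding P_def
    by (intro bounded_linear_sum bounded_linear_scaleR_const bounded_linear_inner_left)
  have 2: "P x \<in> L" for x unfolding P_def
    using assms B(1) by (auto intro!: subspace_sum subspace_mul)
  have bb: "b \<bullet> c = (if b = c then 1 else 0)" if "b \<in> B" "c \<in> B" for b c
    using that B(2,3) by (auto simp: pairwise_def orthogonal_def norm_eq_1)
  have Pb: "P c = c" if "c \<in> B" for c
  proof -
    have "P c = (\<Sum>b\<in>B. if b = c then c else 0)"
      unfolding P_def using bb that by (intro sum.cong) auto
    then show ?thesis using that fin by simp
  qed
  have 3: "P x = x" if "x \<in> L" for x
  proof -
    have "x \<in> span B" using that B by simp
    then show ?thesis
      using real_vector.linear_eq_on[of P "\<lambda>x. x" x B] bounded_linear.linear[OF 1] Pb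
      by (auto simp: linear_ident)
  qed
  have 4: "P x \<bullet> y = x \<bullet> P y" for x y
    unfolding P_def inner_sum_left inner_sum_right by (intro sum.cong) (auto simp: inner_commute)
  show thesis using that 1 2 3 4 by blast
qed

text \<open>The chain rule gives the derivative \<open>f' (P x) (P v)\<close>, in which
  \<open>f'\<close> is evaluated on \<open>L\<close> only, so every ambient direction becomes
  available. If \<open>S\<close> is open in \<open>L\<close>, the new domain is open in the ambient
  space.\<close>

lemma Ck_on_extend:
  assumes "Ck_on k L S f" "bounded_linear P" "\<And>x. P x \<in> L"
  shows "Ck_on k UNIV (P -` S) (\<lambda>x. f (P x))"
  using assms(1)
proof (induction k arbitrary: f)
  case 0
  then show ?case
    using continuous_on_compose2[of S f "P -` S" P] linear_continuous_on[OF assms(2)] by auto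
next
  case (Suc k)
  then obtain f' where f': "\<And>x. x \<in> S \<Longrightarrow> (f has_derivative f' x) (at x within S)"
    "\<And>v. v \<in> L \<Longrightarrow> Ck_on k L S (\<lambda>x. f' x v)"
    by auto
  have "((\<lambda>x. f (P x)) has_derivative (\<lambda>v. f' (P x) (P v))) (at x within P -` S)" if "P x \<in> S" for x
    using f'(1)[OF that] 
    by (intro has_derivative_in_compose[OF bounded_linear_imp_has_derivative[OF assms(2)]])
       (auto intro: has_derivative_subset)
  then show ?case using Suc.IH[OF f'(2)[OF assms(3)]]
    by (auto intro!: exI[of _ "\<lambda>x v. f' (P x) (P v)"])
qed

text \<open>The chain rule expands in a basis of the ambient space of \<open>g\<close>, but
  \<open>g\<close> is controlled only along \<open>L'\<close>. Precomposing \<open>g\<close> with a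
  projection onto \<open>L'\<close> changes none of the values that matter, since \<open>f\<close>
  maps into \<open>L'\<close>.\<close>

lemma Ck_on_compose:
  fixes f :: "'e::euclidean_space \<Rightarrow> 'f::euclidean_space" and g :: "'f \<Rightarrow> 'g::euclidean_space"
  assumes "Ck_on k L S f" "Ck_on k L' S' g" "f ` S \<subseteq> S'" "S' \<subseteq> L'" "subspace L'"
  shows "Ck_on k L S (\<lambda>x. g (f x))"
proof -
  obtain P where P: "bounded_linear P" "\<And>x. P x \<in> L'" "\<And>x. x \<in> L' \<Longrightarrow> P x = x"
    using orthogonal_projection_exists[OF assms(5)] by metis
  have "f ` S \<subseteq> P -` S'" using assms(3,4) P(3) by auto
  from Ck_on_compose_UNIV[OF assms(1) Ck_on_extend[OF assms(2) P(1,2)] this]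
  show ?thesis
  proof (rule Ck_on_cong)
    fix x assume "x \<in> S"
    then have "f x \<in> L'" using assms(3,4) by auto
    then show "g (P (f x)) = g (f x)" using P(3) by simp
  qed
qed

text \<open>Trades the derivative within \<open>S\<close>, which the definition of smoothness uses,
  for the one within \<open>L\<close>, which no longer mentions the domain.\<close>

lemma at_within_openin:
  assumes "openin (top_of_set L) S" "x \<in> S"
  shows "at x within S = at x within L"
proof -
  obtain T where "open T" "S = L \<inter> T" using assms(1) by (auto simp: openin_open)
  then show ?thesis using assms(2) by (intro at_within_nhd[of x T]) auto
qed

subsection \<open>Derivatives along a subspace\<close>

abbreviation deriv_on :: "'e::euclidean_space set \<Rightarrow> ('e \<Rightarrow> 'f::euclidean_space) \<Rightarrow> 'e \<Rightarrow> 'e \<Rightarrow> 'f" where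
  "deriv_on L f x \<equiv> frechet_derivative f (at x within L)"

text \<open>Two derivatives within \<open>L\<close> may differ off \<open>L\<close>. For
  \<open>v\<close> in \<open>L\<close> the line through \<open>x\<close> stays in \<open>L\<close>,
  and composing with it reduces the claim to uniqueness of derivatives of functions of one real
  variable.\<close>

lemma deriv_on_unique:
  assumes "(f has_derivative f') (at x within L)" "(f has_derivative f'') (at x within L)"
    "subspace L" "x \<in> L" "v \<in> L"
  shows "f' v = f'' v"
proof -
  interpret a: bounded_linear f' using assms(1) by (rule has_derivative_bounded_linear)
  interpret b: bounded_linear f'' using assms(2) by (rule has_derivative_bounded_linear)
  have line: "((\<lambda>s::real. x + s *\<^sub>R v) has_derivative (\<lambda>s. s *\<^sub>R v)) (at 0)"
    by (auto intro!: derivative_eq_intros)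
  have sub: "range (\<lambda>s::real. x + s *\<^sub>R v) \<subseteq> L"
    using assms(3-5) by (auto intro: subspace_add subspace_mul)
  have "((\<lambda>s. f (x + s *\<^sub>R v)) has_derivative (\<lambda>s. g (s *\<^sub>R v))) (at 0)"
    if "(f has_derivative g) (at x within L)" for g
    using has_derivative_in_compose[OF line, of f g] that sub
    by (auto intro: has_derivative_subset)
  from has_derivative_unique[OF this[OF assms(1)] this[OF assms(2)]]
  have "f' (1 *\<^sub>R v) = f'' (1 *\<^sub>R v)" by metis
  then show ?thesis by simp
qed

lemma deriv_on_works:
  "(f has_derivative f') (at x within L) \<Longrightarrow> (f has_derivative deriv_on L f x) (at x within L)"
  by (metis differentiable_def frechet_derivative_works)

lemma deriv_on_eq:
  assumes "(f has_derivative f') (at x within L)" "subspace L" "x \<in> L" "v \<in> L"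
  shows "deriv_on L f x v = f' v"
  using deriv_on_unique[OF deriv_on_works] assms by blast

lemma has_derivative_compose_openin:
  assumes "(f has_derivative f') (at x within L)" "openin (top_of_set L) S" "x \<in> S"
    "f ` S \<subseteq> T" "(g has_derivative g') (at (f x) within T)"
  shows "((\<lambda>x. g (f x)) has_derivative (\<lambda>v. g' (f' v))) (at x within L)"
proof -
  have "(f has_derivative f') (at x within S)"
    using assms(1) by (simp add: at_within_openin[OF assms(2,3)])
  from has_derivative_in_compose[OF this has_derivative_subset[OF assms(5,4)]]
  show ?thesis by (simp add: at_within_openin[OF assms(2,3)])
qed

lemma has_derivative_cong_openin:
  assumes "(f has_derivative f') (at x within L)" "openin (top_of_set L) S" "x \<in> S"
    "\<And>y. y \<in> S \<Longrightarrow> f y = g y"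
  shows "(g has_derivative f') (at x within L)"
proof -
  have "(f has_derivative f') (at x within S)"
    using assms(1) by (simp add: at_within_openin[OF assms(2,3)])
  then have "(g has_derivative f') (at x within S)"
    by (rule has_derivative_transform[OF assms(3), rotated]) (simp add: assms(4))
  then show ?thesis by (simp add: at_within_openin[OF assms(2,3)])
qed

text \<open>Let \<open>P\<close> project onto \<open>K\<close>. On \<open>S\<close> the map followed
  by \<open>P\<close> is the map itself, so uniqueness of the derivative gives
  \<open>f' v = P (f' v)\<close>.\<close>

lemma deriv_on_in_subspace:
  fixes f :: "'e::euclidean_space \<Rightarrow> 'f::euclidean_space"
  assumes "(f has_derivative f') (at x within L)" "openin (top_of_set L) S" "x \<in> S"
    "f ` S \<subseteq> K" "subspace K" "subspace L" "v \<in> L"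
  shows "f' v \<in> K"
proof -
  obtain P where P: "bounded_linear P" "\<And>x. P x \<in> K" "\<And>x. x \<in> K \<Longrightarrow> P x = x"
    using orthogonal_projection_exists[OF assms(5)] by metis
  have "((\<lambda>x. P (f x)) has_derivative (\<lambda>v. P (f' v))) (at x within L)"
    by (rule bounded_linear.has_derivative[OF P(1) assms(1)])
  then have "(f has_derivative (\<lambda>v. P (f' v))) (at x within L)"
    by (rule has_derivative_cong_openin[OF _ assms(2,3)]) (use P(3) assms(4) in auto)
  then have "f' v = P (f' v)"
    using deriv_on_unique[OF assms(1) _ assms(6) _ assms(7)] subsetD[OF openin_imp_subset[OF assms(2)] assms(3)] by blast
  then show ?thesis using P(2) by metis
qed

lemma smooth_on_has_derivative:
  assumes "smooth_on L S f" "openin (top_of_set L) S" "x \<in> S"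
  shows "(f has_derivative deriv_on L f x) (at x within L)"
proof -
  have "Ck_on (Suc 0) L S f" using assms(1) unfolding smooth_on_def by blast
  then obtain f' where "(f has_derivative f' x) (at x within S)" using assms(3) by auto
  then show ?thesis using at_within_openin[OF assms(2,3)] deriv_on_works by metis
qed

lemma smooth_on_deriv_on:
  assumes "smooth_on L S f" "openin (top_of_set L) S" "subspace L" "v \<in> L"
  shows "smooth_on L S (\<lambda>x. deriv_on L f x v)"
  unfolding smooth_on_def
proof
  fix k
  have "Ck_on (Suc k) L S f" using assms(1) unfolding smooth_on_def by blast
  then obtain f' where f': "\<And>x. x \<in> S \<Longrightarrow> (f has_derivative f' x) (at x within S)"
    "Ck_on k L S (\<lambda>x. f' x v)" using assms(4) by auto
  show "Ck_on k L S (\<lambda>x. deriv_on L f x v)"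
  proof (rule Ck_on_cong[OF f'(2)])
    fix x assume x: "x \<in> S"
    then have "(f has_derivative f' x) (at x within L)" using f'(1) at_within_openin[OF assms(2)] by metis
    from deriv_on_eq[OF this assms(3) subsetD[OF openin_imp_subset[OF assms(2)] x] assms(4)]
    show "f' x v = deriv_on L f x v" ..
  qed
qed

section \<open>Maps that are smooth to all orders\<close>

lemma smooth_on_cong: "smooth_on L S f \<Longrightarrow> (\<And>x. x \<in> S \<Longrightarrow> f x = g x) \<Longrightarrow> smooth_on L S g"
  unfolding smooth_on_def by (intro allI, rule Ck_on_cong[where f = f]) auto

lemma smooth_on_mono: "smooth_on L S f \<Longrightarrow> S' \<subseteq> S \<Longrightarrow> L' \<subseteq> L \<Longrightarrow> smooth_on L' S' f"
  unfolding smooth_on_def by (intro allI, rule Ck_on_mono[where S = S and L = L]) auto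

lemma smooth_on_continuous: "smooth_on L S f \<Longrightarrow> continuous_on S f"
  unfolding smooth_on_def by (rule Ck_on_continuous[where L = L and k = 0]) auto

lemma smooth_on_bounded_linear: "bounded_linear f \<Longrightarrow> smooth_on L S f"
  unfolding smooth_on_def by (intro allI, rule Ck_on_bounded_linear[where f = f]) auto

lemma smooth_on_const: "smooth_on L S (\<lambda>_. c)"
  unfolding smooth_on_def by (intro allI Ck_on_const)

lemma smooth_on_linear_compose: "bounded_linear h \<Longrightarrow> smooth_on L S f \<Longrightarrow> smooth_on L S (\<lambda>x. h (f x))"
  unfolding smooth_on_def by (intro allI, rule Ck_on_linear_compose[where h = h and f = f]) auto

lemma smooth_on_add: "smooth_on L S f \<Longrightarrow> smooth_on L S g \<Longrightarrow> smooth_on L S (\<lambda>x. f x + g x)"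
  unfolding smooth_on_def by (intro allI, rule Ck_on_add[where f = f and g = g]) auto

lemma smooth_on_diff: "smooth_on L S f \<Longrightarrow> smooth_on L S g \<Longrightarrow> smooth_on L S (\<lambda>x. f x - g x)"
  unfolding smooth_on_def by (intro allI, rule Ck_on_diff[where f = f and g = g]) auto

lemma smooth_on_sum: "(\<And>i. i \<in> I \<Longrightarrow> smooth_on L S (f i)) \<Longrightarrow> smooth_on L S (\<lambda>x. \<Sum>i\<in>I. f i x)"
  unfolding smooth_on_def by (intro allI, rule Ck_on_sum[where f = f]) auto

lemma smooth_on_Pair: "smooth_on L S f \<Longrightarrow> smooth_on L S g \<Longrightarrow> smooth_on L S (\<lambda>x. (f x, g x))"
  unfolding smooth_on_def by (intro allI, rule Ck_on_Pair[where f = f and g = g]) auto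

lemma smooth_on_bilinear:
  "bounded_bilinear h \<Longrightarrow> smooth_on L S f \<Longrightarrow> smooth_on L S g \<Longrightarrow> smooth_on L S (\<lambda>x. h (f x) (g x))"
  unfolding smooth_on_def by (intro allI, rule Ck_on_bilinear[where h = h and f = f and g = g]) auto

lemma smooth_on_compose:
  "smooth_on L S f \<Longrightarrow> smooth_on L' S' g \<Longrightarrow> f ` S \<subseteq> S' \<Longrightarrow> S' \<subseteq> L' \<Longrightarrow> subspace L' \<Longrightarrow>
   smooth_on L S (\<lambda>x. g (f x))"
  unfolding smooth_on_def by (intro allI, rule Ck_on_compose[where f = f and g = g and L' = L' and S' = S']) auto

section \<open>Derivatives along curves and symmetry of second derivatives\<close>

lemma has_vector_derivative_compose_deriv:
  assumes "(c has_vector_derivative c') (at t)" "open I" "t \<in> I" "c ` I \<subseteq> T"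
    "(g has_derivative g') (at (c t) within T)"
  shows "((\<lambda>s. g (c s)) has_vector_derivative g' c') (at t)"
proof -
  interpret bounded_linear g' using assms(5) by (rule has_derivative_bounded_linear)
  have "(c has_derivative (\<lambda>s. s *\<^sub>R c')) (at t within UNIV)"
    using assms(1) by (simp add: has_vector_derivative_def)
  from has_derivative_compose_openin[OF this _ assms(3,4,5)] show ?thesis
    using assms(2) by (simp add: has_vector_derivative_def scaleR)
qed

lemma line_has_vector_derivative:
  assumes "(f has_derivative f') (at (y + s *\<^sub>R v) within L)" "subspace L" "y \<in> L" "v \<in> L"
  shows "((\<lambda>s. f (y + s *\<^sub>R v)) has_vector_derivative f' v) (at s)"
proof (rule has_vector_derivative_compose_deriv[where T = L and I = UNIV])
  show "((\<lambda>s. y + s *\<^sub>R v) has_vector_derivative v) (at s)"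
    by (auto intro!: derivative_eq_intros)
  show "range (\<lambda>s. y + s *\<^sub>R v) \<subseteq> L" using assms(2-4) by (auto intro: subspace_add subspace_mul)
qed (use assms(1) in auto)

text \<open>The mean value theorem is applied twice: to the increment of \<open>f\<close> along
  \<open>w\<close> as a function of the step along \<open>v\<close>, then to the derivative in
  direction \<open>v\<close> as a function of the step along \<open>w\<close>.\<close>

lemma second_difference:
  fixes f :: "'e::euclidean_space \<Rightarrow> real"
  assumes f: "smooth_on L S f" "openin (top_of_set L) S" "subspace L" "v \<in> L" "w \<in> L" "h > 0"
    and S: "\<And>s t. 0 \<le> s \<Longrightarrow> s \<le> h \<Longrightarrow> 0 \<le> t \<Longrightarrow> t \<le> h \<Longrightarrow> x + s *\<^sub>R v + t *\<^sub>R w \<in> S"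
  obtains s t where "0 < s" "s < h" "0 < t" "t < h"
    "f (x + h *\<^sub>R v + h *\<^sub>R w) - f (x + h *\<^sub>R v) - f (x + h *\<^sub>R w) + f x =
     h * h * deriv_on L (\<lambda>x. deriv_on L f x v) (x + s *\<^sub>R v + t *\<^sub>R w) w"
proof -
  have SL: "S \<subseteq> L" using f(2) openin_imp_subset by blast
  have xL: "x \<in> L" using S[of 0 0] SL f(6) by auto
  define g where "g s = f ((x + h *\<^sub>R w) + s *\<^sub>R v) - f (x + s *\<^sub>R v)" for s
  have xw: "x + t *\<^sub>R w \<in> L" "x + t *\<^sub>R v \<in> L" for t using xL f by (auto intro: subspace_add subspace_mul)
  have g': "(g has_real_derivative (deriv_on L f ((x + h *\<^sub>R w) + s *\<^sub>R v) v - deriv_on L f (x + s *\<^sub>R v) v)) (at s)"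
    if "0 \<le> s" "s \<le> h" for s
    unfolding g_def has_real_derivative_iff_has_vector_derivative
    using that S[of s h] S[of s 0] f(6)
    by (intro has_vector_derivative_diff line_has_vector_derivative[OF _ f(3) _ f(4)]
        smooth_on_has_derivative[OF f(1,2)] xL xw) (auto simp: algebra_simps)
  obtain s where s: "0 < s" "s < h"
    "g h - g 0 = (h - 0) * (deriv_on L f ((x + h *\<^sub>R w) + s *\<^sub>R v) v - deriv_on L f (x + s *\<^sub>R v) v)"
    using MVT2[OF f(6) g'] by blast
  define k where "k t = deriv_on L f ((x + s *\<^sub>R v) + t *\<^sub>R w) v" for t
  have k': "(k has_real_derivative deriv_on L (\<lambda>x. deriv_on L f x v) ((x + s *\<^sub>R v) + t *\<^sub>R w) w) (at t)"
    if "0 \<le> t" "t \<le> h" for t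
    unfolding k_def has_real_derivative_iff_has_vector_derivative
    using that S[of s t] s
    by (intro line_has_vector_derivative[OF _ f(3) _ f(5)]
        smooth_on_has_derivative[OF smooth_on_deriv_on[OF f(1-4)] f(2)] xw) auto
  obtain t where t: "0 < t" "t < h"
    "k h - k 0 = (h - 0) * deriv_on L (\<lambda>x. deriv_on L f x v) ((x + s *\<^sub>R v) + t *\<^sub>R w) w"
    using MVT2[OF f(6) k'] by blast
  have "g h - g 0 = h * (k h - k 0)" using s(3) by (simp add: k_def algebra_simps)
  then have "g h - g 0 = h * h * deriv_on L (\<lambda>x. deriv_on L f x v) ((x + s *\<^sub>R v) + t *\<^sub>R w) w"
    using t(3) by simp
  moreover have "g h - g 0 = f (x + h *\<^sub>R v + h *\<^sub>R w) - f (x + h *\<^sub>R v) - f (x + h *\<^sub>R w) + f x"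
    by (simp add: g_def algebra_simps)
  ultimately show thesis using that[OF s(1,2) t(1,2)] by simp
qed

text \<open>The second difference is symmetric in \<open>v\<close> and \<open>w\<close>, so on every
  small parallelogram the two mixed derivatives share a value, taken at possibly different points;
  continuity at \<open>x\<close> forces equality.\<close>

lemma second_deriv_on_symmetric_real:
  fixes f :: "'e::euclidean_space \<Rightarrow> real"
  assumes f: "smooth_on L S f" "openin (top_of_set L) S" "subspace L" and vw: "v \<in> L" "w \<in> L" "x \<in> S"
  shows "deriv_on L (\<lambda>x. deriv_on L f x v) x w = deriv_on L (\<lambda>x. deriv_on L f x w) x v"
proof (rule ccontr)
  define A where "A y = deriv_on L (\<lambda>x. deriv_on L f x v) y w" for y
  define B where "B y = deriv_on L (\<lambda>x. deriv_on L f x w) y v" for y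
  assume "\<not> ?thesis"
  \<comment> \<open>Half the distance of the two values is the tolerance: numbers closer than that
    to \<open>A x\<close> and to \<open>B x\<close> respectively cannot coincide.\<close>
  then have e: "dist (A x) (B x) / 2 > 0" by (simp add: A_def B_def)
  have cont: "continuous_on S A" "continuous_on S B" unfolding A_def B_def
    by (intro smooth_on_continuous[of L] smooth_on_deriv_on f vw)+
  obtain d1 where d1: "d1 > 0" "\<And>y. y \<in> S \<Longrightarrow> dist y x < d1 \<Longrightarrow> dist (A y) (A x) < dist (A x) (B x) / 2"
    using cont(1) e vw(3) unfolding continuous_on_iff by blast
  obtain d2 where d2: "d2 > 0" "\<And>y. y \<in> S \<Longrightarrow> dist y x < d2 \<Longrightarrow> dist (B y) (B x) < dist (A x) (B x) / 2"
    using cont(2) e vw(3) unfolding continuous_on_iff by blast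
  obtain d3 where d3: "d3 > 0" "\<And>y. y \<in> L \<Longrightarrow> dist y x < d3 \<Longrightarrow> y \<in> S"
    using f(2) vw(3) unfolding openin_euclidean_subtopology_iff by blast
  define d where "d = min d1 (min d2 d3)"
  have d: "d > 0" using d1 d2 d3 by (simp add: d_def)
  \<comment> \<open>Keeps the whole parallelogram within distance \<open>d\<close> of
    \<open>x\<close>; the \<open>1\<close> covers the case that \<open>v\<close> and
    \<open>w\<close> both vanish.\<close>
  define h where "h = d / (norm v + norm w + 1)"
  have nz: "norm v + norm w + 1 > 0" by (smt (verit) norm_ge_zero)
  have h: "h > 0" using d nz by (simp add: h_def)
  have xL: "x \<in> L" using f(2) vw(3) openin_imp_subset by blast
  have near: "dist (x + s *\<^sub>R v + t *\<^sub>R w) x < d" if "0 \<le> s" "s \<le> h" "0 \<le> t" "t \<le> h" for s t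
  proof -
    have "dist (x + s *\<^sub>R v + t *\<^sub>R w) x = norm (s *\<^sub>R v + t *\<^sub>R w)" by (simp add: dist_norm add.assoc)
    also have "\<dots> \<le> s * norm v + t * norm w" using norm_triangle_ineq[of "s *\<^sub>R v" "t *\<^sub>R w"] that by simp
    also have "\<dots> \<le> h * norm v + h * norm w" using that by (intro add_mono mult_right_mono) auto
    also have "\<dots> < h * (norm v + norm w + 1)" using h by (simp add: algebra_simps)
    also have "\<dots> = d" using nz by (simp add: h_def)
    finally show ?thesis .
  qed
  have inS: "x + s *\<^sub>R v + t *\<^sub>R w \<in> S" if "0 \<le> s" "s \<le> h" "0 \<le> t" "t \<le> h" for s t
    using d3(2)[of "x + s *\<^sub>R v + t *\<^sub>R w"] near[OF that] xL vw f(3)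
    by (auto simp: d_def intro: subspace_add subspace_mul)
  obtain s t where 1: "0 < s" "s < h" "0 < t" "t < h"
    "f (x + h *\<^sub>R v + h *\<^sub>R w) - f (x + h *\<^sub>R v) - f (x + h *\<^sub>R w) + f x = h * h * A (x + s *\<^sub>R v + t *\<^sub>R w)"
    using second_difference[OF f vw(1,2) h inS] unfolding A_def by blast
  have inS': "x + s *\<^sub>R w + t *\<^sub>R v \<in> S" if "0 \<le> s" "s \<le> h" "0 \<le> t" "t \<le> h" for s t
    using inS[OF that(3,4,1,2)] by (simp add: algebra_simps)
  obtain s' t' where 2: "0 < s'" "s' < h" "0 < t'" "t' < h"
    "f (x + h *\<^sub>R w + h *\<^sub>R v) - f (x + h *\<^sub>R w) - f (x + h *\<^sub>R v) + f x = h * h * B (x + s' *\<^sub>R w + t' *\<^sub>R v)"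
    using second_difference[OF f vw(2,1) h inS'] unfolding B_def by blast
  have "h * h * A (x + s *\<^sub>R v + t *\<^sub>R w) = h * h * B (x + t' *\<^sub>R v + s' *\<^sub>R w)"
    using 1(5) 2(5) by (simp add: algebra_simps)
  then have "A (x + s *\<^sub>R v + t *\<^sub>R w) = B (x + t' *\<^sub>R v + s' *\<^sub>R w)" using h by simp
  moreover have "dist (A (x + s *\<^sub>R v + t *\<^sub>R w)) (A x) < dist (A x) (B x) / 2"
    using d1(2)[OF inS[of s t]] near[of s t] 1 by (auto simp: d_def)
  moreover have "dist (B (x + t' *\<^sub>R v + s' *\<^sub>R w)) (B x) < dist (A x) (B x) / 2"
    using d2(2)[OF inS[of t' s']] near[of t' s'] 2 by (auto simp: d_def)
  ultimately show False by (metis dist_commute dist_triangle_half_r less_irrefl)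
qed

lemma deriv_on_linear_compose:
  assumes "bounded_linear h" "(f has_derivative f') (at x within L)" "subspace L" "x \<in> L" "v \<in> L"
  shows "deriv_on L (\<lambda>x. h (f x)) x v = h (deriv_on L f x v)"
  using deriv_on_eq[OF bounded_linear.has_derivative[OF assms(1,2)] assms(3-5)] deriv_on_eq[OF assms(2-5)] by simp

text \<open>Reduction to the coordinates of \<open>f\<close>, since the mean value theorem holds as
  an equality only for real-valued maps.\<close>

lemma second_deriv_on_symmetric:
  assumes f: "smooth_on L S f" "openin (top_of_set L) S" "subspace L" and vw: "v \<in> L" "w \<in> L" "x \<in> S"
  shows "deriv_on L (\<lambda>x. deriv_on L f x v) x w = deriv_on L (\<lambda>x. deriv_on L f x w) x v"
proof (rule euclidean_eqI)
  fix b assume "b \<in> (Basis :: 'b set)"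
  have SL: "S \<subseteq> L" using f(2) openin_imp_subset by blast
  have *: "deriv_on L (\<lambda>x. deriv_on L f x v) x w \<bullet> b = deriv_on L (\<lambda>x. deriv_on L (\<lambda>x. f x \<bullet> b) x v) x w"
    if "v \<in> L" "w \<in> L" for v w
  proof -
    have 1: "((\<lambda>x. deriv_on L f x v) has_derivative deriv_on L (\<lambda>x. deriv_on L f x v) x) (at x within L)"
      by (rule smooth_on_has_derivative[OF smooth_on_deriv_on[OF f that(1)] f(2) vw(3)])
    have "((\<lambda>x. deriv_on L f x v \<bullet> b) has_derivative (\<lambda>w. deriv_on L (\<lambda>x. deriv_on L f x v) x w \<bullet> b)) (at x within L)"
      by (rule bounded_linear.has_derivative[OF bounded_linear_inner_left 1])
    then have "((\<lambda>x. deriv_on L (\<lambda>x. f x \<bullet> b) x v) has_derivative (\<lambda>w. deriv_on L (\<lambda>x. deriv_on L f x v) x w \<bullet> b)) (at x within L)"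
    proof (rule has_derivative_cong_openin[OF _ f(2) vw(3)])
      fix y assume y: "y \<in> S"
      show "deriv_on L f y v \<bullet> b = deriv_on L (\<lambda>x. f x \<bullet> b) y v"
        using deriv_on_linear_compose[OF bounded_linear_inner_left smooth_on_has_derivative[OF f(1,2) y] f(3)
          subsetD[OF SL y] that(1)] by (rule sym)
    qed
    from deriv_on_eq[OF this f(3) _ that(2)] show ?thesis using SL vw(3) by auto
  qed
  have "smooth_on L S (\<lambda>x. f x \<bullet> b)"
    by (rule smooth_on_linear_compose[OF bounded_linear_inner_left f(1)])
  then show "deriv_on L (\<lambda>x. deriv_on L f x v) x w \<bullet> b = deriv_on L (\<lambda>x. deriv_on L f x w) x v \<bullet> b"
    using second_deriv_on_symmetric_real[OF _ f(2,3) vw] * vw by metis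
qed

section \<open>Ordinary differential equations with parameters\<close>

lemma norm_diff_le_derivative_bound:
  fixes w :: "real \<Rightarrow> 'a::real_normed_vector"
  assumes "\<And>t. t \<in> {a..b} \<Longrightarrow> (w has_vector_derivative w' t) (at t within {a..b})"
    and "\<And>t. t \<in> {a..b} \<Longrightarrow> norm (w' t) \<le> B" "s \<in> {a..b}" "t \<in> {a..b}"
  shows "norm (w s - w t) \<le> B * \<bar>s - t\<bar>"
proof -
  have "norm (w s - w t) \<le> B * norm (s - t)"
  proof (rule differentiable_bound[where S = "{a..b}" and f' = "\<lambda>t h. h *\<^sub>R w' t"])
    fix t assume t: "t \<in> {a..b}"
    show "onorm (\<lambda>h. h *\<^sub>R w' t) \<le> B"
      using assms(2)[OF t] by (intro onorm_le) (auto simp: mult.commute[of B] intro: mult_left_mono)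
  qed (use assms in \<open>auto simp: has_vector_derivative_def\<close>)
  then show ?thesis by simp
qed

text \<open>On a time interval short against the Lipschitz constant, this replaces Gronwall's inequality.\<close>

lemma contraction_estimate:
  fixes w :: "real \<Rightarrow> 'a::euclidean_space"
  assumes w': "\<And>t. t \<in> {-e..e} \<Longrightarrow> (w has_vector_derivative w' t) (at t within {-e..e})"
    and b: "\<And>t. t \<in> {-e..e} \<Longrightarrow> norm (w' t) \<le> K * norm (w t) + a"
    and e: "K \<ge> 0" "a \<ge> 0" "K * e \<le> 3/4" "t \<in> {-e..e}"
  shows "norm (w t) \<le> 4 * (norm (w 0) + e * a)"
proof -
  have e0: "e \<ge> 0" using e by auto
  have "continuous_on {-e..e} w"
    using w' has_vector_derivative_continuous continuous_on_eq_continuous_within by blast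
  then have "continuous_on {-e..e} (\<lambda>t. norm (w t))" by (intro continuous_intros)
  then obtain m where m: "m \<in> {-e..e}" "\<And>t. t \<in> {-e..e} \<Longrightarrow> norm (w t) \<le> norm (w m)"
    using continuous_attains_sup[of "{-e..e}" "\<lambda>t. norm (w t)"] e by auto
  define M where "M = norm (w m)"
  have "norm (w' t) \<le> K * M + a" if "t \<in> {-e..e}" for t
    using b[OF that] mult_left_mono[OF m(2)[OF that] e(1)] by (simp add: M_def)
  then have "norm (w m - w 0) \<le> (K * M + a) * \<bar>m - 0\<bar>"
    using m(1) e0 by (intro norm_diff_le_derivative_bound[OF w']) auto
  also have "\<dots> \<le> (K * M + a) * e"
    using m(1) e by (intro mult_left_mono add_nonneg_nonneg mult_nonneg_nonneg) (auto simp: M_def)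
  also have "\<dots> \<le> 3/4 * M + e * a"
    using mult_right_mono[OF e(3), of M] by (simp add: M_def algebra_simps)
  \<comment> \<open>The share 3/4 of \<open>M\<close> is absorbed on the left, whence the factor 4.
    Admitting 3/4, where \<open>K * e \<le> 1/2\<close> is available, leaves room for an additional
    error coefficient in the differentiability proof.\<close>
  finally have "M \<le> norm (w 0) + 3/4 * M + e * a"
    unfolding M_def using norm_triangle_sub[of "w m" "w 0"] by linarith
  then show ?thesis using m(2)[OF e(4)] unfolding M_def by simp
qed

text \<open>Picard iteration in the complete space of bounded continuous curves on the whole line;
  \<open>K * e \<le> 1/2\<close> makes the integral operator a contraction.\<close>

lemma lipschitz_ode_exists:
  fixes F :: "real \<Rightarrow> 'a::euclidean_space \<Rightarrow> 'a"
  assumes cont: "continuous_on ({-e..e} \<times> UNIV) (\<lambda>(t, y). F t y)"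
    and lip: "\<And>t y z. t \<in> {-e..e} \<Longrightarrow> norm (F t y - F t z) \<le> K * norm (y - z)"
    and e: "e > 0" "K \<ge> 0" "K * e \<le> 1/2"
  obtains u where "u 0 = u0" "\<And>t. t \<in> {-e..e} \<Longrightarrow> (u has_vector_derivative F t (u t)) (at t within {-e..e})"
proof -
  let ?T = "{-e..e}"
  \<comment> \<open>The integral of the field along \<open>u\<close>, obtained as an antiderivative
    normalised to vanish at 0.\<close>
  have "\<exists>g. g 0 = 0 \<and> (\<forall>t\<in>?T. (g has_vector_derivative F t (apply_bcontfun u t)) (at t within ?T))"
    for u :: "real \<Rightarrow>\<^sub>C 'a"
  proof -
    have "continuous_on ?T (\<lambda>t. (t, apply_bcontfun u t))" by (intro continuous_intros) auto
    from continuous_on_compose2[OF cont this]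
    have "continuous_on ?T (\<lambda>t. F t (apply_bcontfun u t))" by (auto simp: image_def)
    then obtain g where "\<And>t. t \<in> ?T \<Longrightarrow> (g has_vector_derivative F t (apply_bcontfun u t)) (at t within ?T)"
      using antiderivative_continuous by blast
    then show ?thesis
      by (intro exI[of _ "\<lambda>t. g t - g 0"]) (auto simp: has_vector_derivative_diff_const)
  qed
  then obtain G where G: "\<And>u. G u 0 = 0"
    "\<And>u t. t \<in> ?T \<Longrightarrow> (G u has_vector_derivative F t (apply_bcontfun u t)) (at t within ?T)"
    by metis
  \<comment> \<open>Clamping time to the interval makes each iterate a bounded continuous function
    on the whole line without altering it on the interval.\<close>
  define cl where "cl t = max (-e) (min e t)" for t
  have cl: "cl t \<in> ?T" "t \<in> ?T \<Longrightarrow> cl t = t" for t using e by (auto simp: cl_def)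
  have ccl: "continuous_on UNIV cl" unfolding cl_def by (intro continuous_intros)
  have Gc: "continuous_on ?T (G u)" for u
    using G(2) has_vector_derivative_continuous continuous_on_eq_continuous_within by blast
  have bc: "(\<lambda>t. u0 + G u (cl t)) \<in> bcontfun" for u
  proof -
    have "compact (G u ` ?T)" by (intro compact_continuous_image Gc) auto
    then have "bounded (G u ` ?T)" by (rule compact_imp_bounded)
    then have "bounded ((+) u0 ` (G u ` ?T))" by (rule bounded_translation)
    then have "bounded (range (\<lambda>t. u0 + G u (cl t)))"
      by (rule bounded_subset) (use cl in auto)
    moreover have "continuous_on UNIV (\<lambda>t. u0 + G u (cl t))"
      using cl(1) by (intro continuous_intros continuous_on_compose2[OF Gc ccl]) auto
    ultimately show ?thesis by (simp add: bcontfun_def)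
  qed
  define Op where "Op u = Bcontfun (\<lambda>t. u0 + G u (cl t))" for u
  have Op: "apply_bcontfun (Op u) t = u0 + G u (cl t)" for u t
    using Bcontfun_inverse[OF bc] by (simp add: Op_def)
  have "dist (Op u) (Op v) \<le> (1/2) * dist u v" for u v
  proof (rule dist_bound)
    fix t
    have "norm ((G u (cl t) - G v (cl t)) - (G u 0 - G v 0)) \<le> (K * dist u v) * \<bar>cl t - 0\<bar>"
    proof (rule norm_diff_le_derivative_bound[OF has_vector_derivative_diff[OF G(2) G(2)]])
      fix t assume t: "t \<in> ?T"
      have "norm (F t (apply_bcontfun u t) - F t (apply_bcontfun v t)) \<le> K * dist (apply_bcontfun u t) (apply_bcontfun v t)"
        using lip[OF t] by (simp add: dist_norm)
      also have "\<dots> \<le> K * dist u v" using e(2) by (intro mult_left_mono dist_bounded)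
      finally show "norm (F t (apply_bcontfun u t) - F t (apply_bcontfun v t)) \<le> K * dist u v" .
    qed (use cl e in auto)
    also have "\<dots> \<le> (K * dist u v) * e"
      using cl(1)[of t] e by (intro mult_left_mono mult_nonneg_nonneg) auto
    also have "\<dots> \<le> (1/2) * dist u v" using mult_right_mono[OF e(3), of "dist u v"] by (simp add: algebra_simps)
    finally show "dist (apply_bcontfun (Op u) t) (apply_bcontfun (Op v) t) \<le> (1/2) * dist u v"
      by (simp add: Op G(1) dist_norm)
  qed
  then obtain u where u: "Op u = u" using banach_fix_type[of "1/2" Op] by auto
  have ut: "apply_bcontfun u t = u0 + G u (cl t)" for t using Op[of u t] u by simp
  show thesis
  proof (rule that[of "apply_bcontfun u"])
    show "apply_bcontfun u 0 = u0" using ut[of 0] cl(2)[of 0] e G(1) by simp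
    fix t assume t: "t \<in> ?T"
    have "((\<lambda>t. u0 + G u t) has_vector_derivative F t (apply_bcontfun u t)) (at t within ?T)"
      using has_vector_derivative_add[OF has_vector_derivative_const[of u0] G(2)[OF t]] by simp
    then show "(apply_bcontfun u has_vector_derivative F t (apply_bcontfun u t)) (at t within ?T)"
      by (rule has_vector_derivative_transform[OF t, rotated]) (use ut cl in auto)
  qed
qed

text \<open>\<open>C\<close> is compact, but \<open>y\<close> ranges over all of \<open>S\<close>,
  so this is more than uniform continuity on \<open>C\<close>. A Lebesgue number of the cover by
  open sets of small oscillation gives \<open>d\<close>. It provides a tube around a solution curve
  whose width does not depend on time.\<close>

lemma compact_uniformly_near:
  fixes f :: "'a::metric_space \<Rightarrow> 'b::metric_space"
  assumes "compact C" "C \<subseteq> S" "continuous_on S f" "e > 0"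
  obtains d where "d > 0" "\<And>c y. c \<in> C \<Longrightarrow> y \<in> S \<Longrightarrow> dist y c < d \<Longrightarrow> dist (f y) (f c) < e"
proof -
  define GG where "GG = {U. open U \<and> (\<forall>y\<in>S \<inter> U. \<forall>z\<in>S \<inter> U. dist (f y) (f z) < e)}"
  have "C \<subseteq> \<Union>GG"
  proof
    fix c assume c: "c \<in> C"
    then obtain d where d: "d > 0" "\<And>y. y \<in> S \<Longrightarrow> dist y c < d \<Longrightarrow> dist (f y) (f c) < e / 2"
      using assms(2,3,4) unfolding continuous_on_iff by (metis half_gt_zero subsetD)
    have "dist (f y) (f z) < e" if "y \<in> S \<inter> ball c d" "z \<in> S \<inter> ball c d" for y z
      using d(2)[of y] d(2)[of z] that dist_triangle_half_l[of "f y" "f c" e "f z"]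
      by (auto simp: dist_commute)
    then have "ball c d \<in> GG" unfolding GG_def by blast
    then show "c \<in> \<Union>GG" using d(1) by (metis UnionI centre_in_ball)
  qed
  then obtain d where d: "d > 0" "\<And>c. c \<in> C \<Longrightarrow> \<exists>U\<in>GG. ball c d \<subseteq> U"
    using Heine_Borel_lemma[OF assms(1)] unfolding GG_def by (metis (mono_tags, lifting) mem_Collect_eq)
  show thesis
  proof (rule that[OF d(1)])
    fix c y assume *: "c \<in> C" "y \<in> S" "dist y c < d"
    then obtain U where U: "U \<in> GG" "ball c d \<subseteq> U" using d(2) by blast
    then have "y \<in> S \<inter> U" "c \<in> S \<inter> U" using * d(1) assms(2) by (auto simp: dist_commute)
    then show "dist (f y) (f c) < e" using U(1) unfolding GG_def by blast
  qed
qed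

section \<open>Dependence on parameters\<close>

text \<open>The difference \<open>w\<close> of the solutions at \<open>x\<close> and
  \<open>x0\<close> satisfies \<open>norm w' \<le> K * norm w + \<eta>\<close>, where
  \<open>\<eta>\<close> bounds the change of \<open>F\<close> between the two parameters along the
  fixed solution at \<open>x0\<close>; then \<open>contraction_estimate\<close> applies.\<close>

lemma param_ode_continuous:
  fixes F :: "('p::euclidean_space \<times> real) \<times> 'e::euclidean_space \<Rightarrow> 'e"
  assumes e: "e > 0" "K \<ge> 0" "K * e \<le> 1/2"
    and F: "continuous_on ((D \<times> {-e..e}) \<times> Y) F"
    and lip: "\<And>x t y z. x \<in> D \<Longrightarrow> t \<in> {-e..e} \<Longrightarrow> y \<in> Y \<Longrightarrow> z \<in> Y \<Longrightarrow>
       norm (F ((x, t), y) - F ((x, t), z)) \<le> K * norm (y - z)"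
    and u0: "continuous_on D u0"
    and u: "\<And>x. x \<in> D \<Longrightarrow> u (x, 0) = u0 x" "\<And>x t. x \<in> D \<Longrightarrow> t \<in> {-e..e} \<Longrightarrow> u (x, t) \<in> Y"
      "\<And>x t. x \<in> D \<Longrightarrow> t \<in> {-e..e} \<Longrightarrow>
         ((\<lambda>t. u (x, t)) has_vector_derivative F ((x, t), u (x, t))) (at t within {-e..e})"
  shows "continuous_on (D \<times> {-e..e}) u"
  unfolding continuous_on_iff
proof (safe)
  fix x0 t0 and eps :: real assume x0: "x0 \<in> D" and t0: "t0 \<in> {-e..e}" and eps: "eps > 0"
  let ?T = "{-e..e}"
  have cu: "continuous_on ?T (\<lambda>t. u (x0, t))"
    using u(3)[OF x0] has_vector_derivative_continuous continuous_on_eq_continuous_within by blast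
  \<comment> \<open>Chosen so that \<open>4 * (eps / 16 + e * \<eta>)\<close> is
    \<open>eps / 2\<close>; the other half of \<open>eps\<close> pays for the change of time from
    \<open>t0\<close> to \<open>t\<close>.\<close>
  define \<eta> where "\<eta> = eps / (16 * e)"
  have \<eta>: "\<eta> > 0" "e * \<eta> = eps / 16" using eps e by (auto simp: \<eta>_def)
  define C where "C = (\<lambda>s. ((x0, s), u (x0, s))) ` ?T"
  have "compact C" unfolding C_def using cu by (intro compact_continuous_image continuous_intros) auto
  moreover have "C \<subseteq> (D \<times> ?T) \<times> Y" unfolding C_def using x0 u(2) by auto
  ultimately obtain d1 where d1: "d1 > 0"
    "\<And>c y. c \<in> C \<Longrightarrow> y \<in> (D \<times> ?T) \<times> Y \<Longrightarrow> dist y c < d1 \<Longrightarrow> dist (F y) (F c) < \<eta>"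
    using compact_uniformly_near[OF _ _ F \<eta>(1)] by metis
  obtain d2 where d2: "d2 > 0" "\<And>x. x \<in> D \<Longrightarrow> dist x x0 < d2 \<Longrightarrow> dist (u0 x) (u0 x0) < eps / 16"
    using u0 x0 eps unfolding continuous_on_iff by (metis divide_pos_pos zero_less_numeral)
  obtain d3 where d3: "d3 > 0" "\<And>t. t \<in> ?T \<Longrightarrow> dist t t0 < d3 \<Longrightarrow> dist (u (x0, t)) (u (x0, t0)) < eps / 2"
    using cu t0 eps unfolding continuous_on_iff by (metis half_gt_zero)
  define d where "d = min d1 (min d2 d3)"
  have "dist (u (x, t)) (u (x0, t0)) < eps" if x: "x \<in> D" and t: "t \<in> ?T" and d: "dist (x, t) (x0, t0) < d" for x t
  proof -
    have dx: "dist x x0 < d" "dist t t0 < d"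
      using d dist_fst_le[of "(x, t)" "(x0, t0)"] dist_snd_le[of "(x, t)" "(x0, t0)"] by auto
    define w where "w s = u (x, s) - u (x0, s)" for s
    have "norm (w t) \<le> 4 * (norm (w 0) + e * \<eta>)"
    proof (rule contraction_estimate)
      fix s assume s: "s \<in> ?T"
      show "(w has_vector_derivative F ((x, s), u (x, s)) - F ((x0, s), u (x0, s))) (at s within ?T)"
        unfolding w_def by (intro has_vector_derivative_diff u(3) x x0 s)
      have "dist ((x, s), u (x0, s)) ((x0, s), u (x0, s)) < d1"
        using dx by (simp add: dist_Pair_Pair d_def)
      then have "dist (F ((x, s), u (x0, s))) (F ((x0, s), u (x0, s))) < \<eta>"
        using s x u(2)[OF x0 s] by (intro d1(2)) (auto simp: C_def)
      then have "norm (F ((x, s), u (x0, s)) - F ((x0, s), u (x0, s))) \<le> \<eta>" by (simp add: dist_norm)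
      moreover have "norm (F ((x, s), u (x, s)) - F ((x, s), u (x0, s))) \<le> K * norm (w s)"
        unfolding w_def by (intro lip x s u(2) x0)
      ultimately show "norm (F ((x, s), u (x, s)) - F ((x0, s), u (x0, s))) \<le> K * norm (w s) + \<eta>"
        using norm_triangle_ineq[of "F ((x, s), u (x, s)) - F ((x, s), u (x0, s))" "F ((x, s), u (x0, s)) - F ((x0, s), u (x0, s))"]
        by simp
    qed (use e \<eta> t in auto)
    moreover have "norm (w 0) < eps / 16"
      using d2(2)[OF x] dx u(1)[OF x] u(1)[OF x0] by (simp add: w_def dist_norm d_def)
    ultimately have "norm (w t) < eps / 2" using \<eta>(2) by simp
    then have "dist (u (x, t)) (u (x0, t)) < eps / 2" by (simp add: w_def dist_norm)
    moreover have "dist (u (x0, t)) (u (x0, t0)) < eps / 2" using d3(2)[OF t] dx by (simp add: d_def)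
    ultimately show ?thesis using dist_triangle[of "u (x, t)" "u (x0, t0)" "u (x0, t)"] by linarith
  qed
  moreover have "d > 0" using d1 d2 d3 by (simp add: d_def)
  ultimately show "\<exists>d>0. \<forall>x'\<in>D \<times> ?T. dist x' (x0, t0) < d \<longrightarrow> dist (u x') (u (x0, t0)) < eps" by force
qed

text \<open>Turns the Lipschitz constant of an equation in the state into a bound for its derivative
  in the state, so that the linearised equation inherits the constant.\<close>

lemma lipschitz_derivative_bound:
  fixes g :: "real \<Rightarrow> 'a::real_normed_vector"
  assumes "(g has_vector_derivative g') (at 0)" "eventually (\<lambda>s. norm (g s - g 0) \<le> C * \<bar>s\<bar>) (at 0)"
  shows "norm g' \<le> C"
proof (rule field_le_epsilon)
  fix e :: real assume e: "e > 0"
  obtain d1 where d1: "d1 > 0" "\<And>s. norm s < d1 \<Longrightarrow> norm (g s - g 0 - s *\<^sub>R g') \<le> e * norm s"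
    using assms(1) e unfolding has_vector_derivative_def has_derivative_at_alt by fastforce
  obtain d2 where d2: "d2 > 0" "\<And>s. s \<noteq> 0 \<Longrightarrow> \<bar>s\<bar> < d2 \<Longrightarrow> norm (g s - g 0) \<le> C * \<bar>s\<bar>"
    using assms(2) unfolding eventually_at by (auto simp: dist_norm)
  define s where "s = min d1 d2 / 2"
  have s: "s > 0" "\<bar>s\<bar> < d1" "\<bar>s\<bar> < d2" using d1(1) d2(1) by (auto simp: s_def)
  have "norm (s *\<^sub>R g') \<le> norm (g s - g 0) + norm (g s - g 0 - s *\<^sub>R g')"
    using norm_triangle_ineq4[of "g s - g 0" "g s - g 0 - s *\<^sub>R g'"] by simp
  also have "\<dots> \<le> C * s + e * s" using d1(2)[of s] d2(2)[of s] s by simp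
  finally have "s * norm g' \<le> s * (C + e)" using s by (simp add: algebra_simps)
  then show "norm g' \<le> C + e" using s(1) by simp
qed

text \<open>The remainder \<open>u (y, s) - u (x, s) - Z (y - x) s\<close> solves the linearised
  equation up to an error that is small relative to \<open>norm (y - x)\<close> and to the remainder
  itself, so \<open>contraction_estimate\<close> bounds it by
  \<open>\<eta> * norm (y - x)\<close>.\<close>

lemma param_ode_differentiable:
  fixes F :: "('p::euclidean_space \<times> real) \<times> 'e::euclidean_space \<Rightarrow> 'e"
  assumes e: "e > 0" "K \<ge> 0" "K * e \<le> 1/2"
    and DY: "convex D" "convex Y"
    and F: "\<And>c. c \<in> (D \<times> {-e..e}) \<times> Y \<Longrightarrow> (F has_derivative F' c) (at c within (D \<times> {-e..e}) \<times> Y)"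
    and F': "\<And>v. continuous_on ((D \<times> {-e..e}) \<times> Y) (\<lambda>c. F' c v)"
    and K: "\<And>c Z. c \<in> (D \<times> {-e..e}) \<times> Y \<Longrightarrow> norm (F' c (0, Z)) \<le> K * norm Z"
    and u0: "(u0 has_derivative u0') (at x within D)"
    and x: "x \<in> D"
    and u: "\<And>x. x \<in> D \<Longrightarrow> u (x, 0) = u0 x" "\<And>x t. x \<in> D \<Longrightarrow> t \<in> {-e..e} \<Longrightarrow> u (x, t) \<in> Y"
      "\<And>x t. x \<in> D \<Longrightarrow> t \<in> {-e..e} \<Longrightarrow>
         ((\<lambda>t. u (x, t)) has_vector_derivative F ((x, t), u (x, t))) (at t within {-e..e})"
    and cu: "continuous_on (D \<times> {-e..e}) u"
    and Z: "\<And>w t. t \<in> {-e..e} \<Longrightarrow> Z w t = (\<Sum>b\<in>Basis. (w \<bullet> b) *\<^sub>R Z b t)" "\<And>w. Z w 0 = u0' w"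
      "\<And>w t. t \<in> {-e..e} \<Longrightarrow>
        ((\<lambda>t. Z w t) has_vector_derivative F' ((x, t), u (x, t)) ((w, 0), Z w t)) (at t within {-e..e})"
    and t: "t \<in> {-e..e}"
  shows "((\<lambda>x. u (x, t)) has_derivative (\<lambda>w. Z w t)) (at x within D)"
  unfolding has_derivative_within_alt
proof (intro conjI allI impI)
  let ?T = "{-e..e}" and ?\<Omega> = "(D \<times> {-e..e}) \<times> Y"
  have "bounded_linear (\<lambda>w. \<Sum>b\<in>Basis. (w \<bullet> b) *\<^sub>R Z b t)"
    by (intro bounded_linear_sum bounded_linear_scaleR_const bounded_linear_inner_left)
  moreover have "(\<lambda>w. Z w t) = (\<lambda>w. \<Sum>b\<in>Basis. (w \<bullet> b) *\<^sub>R Z b t)" using Z(1)[OF t] by (rule ext)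
  ultimately show "bounded_linear (\<lambda>w. Z w t)" by (rule ssubst[rotated])
  fix \<eta> :: real assume \<eta>: "\<eta> > 0"
  have "\<exists>B. \<forall>s\<in>?T. norm (Z b s) \<le> B" for b
  proof -
    have "continuous_on ?T (Z b)"
      using Z(3) has_vector_derivative_continuous continuous_on_eq_continuous_within by blast
    then have "bounded (Z b ` ?T)" by (intro compact_imp_bounded compact_continuous_image) auto
    then show ?thesis by (auto simp: bounded_iff)
  qed
  then obtain B where B: "\<And>b s. s \<in> ?T \<Longrightarrow> norm (Z b s) \<le> B b" by metis
  \<comment> \<open>Bounds for the individual basis directions add up to a bound for the linear maps
    \<open>w \<mapsto> Z w s\<close> that is uniform in \<open>s\<close>.\<close>
  define C where "C = (\<Sum>b\<in>(Basis::'p set). B b)"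
  have B0: "B b \<ge> 0" for b using order_trans[OF norm_ge_zero B[of 0 b]] e by auto
  have C0: "C \<ge> 0" unfolding C_def using B0 by (intro sum_nonneg) auto
  have ZC: "norm (Z w s) \<le> C * norm w" if s: "s \<in> ?T" for w s
  proof -
    have "norm (Z w s) \<le> (\<Sum>b\<in>Basis. norm ((w \<bullet> b) *\<^sub>R Z b s))" unfolding Z(1)[OF s, of w] by (rule norm_sum)
    also have "\<dots> \<le> (\<Sum>b\<in>Basis. norm w * B b)"
      by (intro sum_mono) (auto intro!: mult_mono Basis_le_norm B s)
    finally show ?thesis by (simp add: C_def sum_distrib_left mult.commute)
  qed
  \<comment> \<open>The first entry keeps \<open>(K + \<epsilon>) * e\<close> at most 3/4, the
    second makes the final estimate come out as \<open>\<eta>\<close>.\<close>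
  define \<epsilon> where "\<epsilon> = min (1 / (4 * e)) (\<eta> / (4 * (1 + e * (1 + C))))"
  have pos: "1 + e * (1 + C) > 0" using e C0 by (intro add_pos_nonneg mult_nonneg_nonneg) auto
  have \<epsilon>: "\<epsilon> > 0" using e \<eta> pos by (simp add: \<epsilon>_def)
  have \<epsilon>e: "\<epsilon> * e \<le> 1/4"
    using mult_right_mono[of \<epsilon> "1 / (4 * e)" e] e by (simp add: \<epsilon>_def)
  have \<epsilon>\<eta>: "4 * (\<epsilon> + e * (\<epsilon> * (1 + C))) \<le> \<eta>"
  proof -
    have "4 * (\<epsilon> + e * (\<epsilon> * (1 + C))) = \<epsilon> * (4 * (1 + e * (1 + C)))" by (simp add: algebra_simps)
    also have "\<dots> \<le> \<eta> / (4 * (1 + e * (1 + C))) * (4 * (1 + e * (1 + C)))"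
      using pos by (intro mult_right_mono) (auto simp: \<epsilon>_def)
    also have "\<dots> = \<eta>" using pos by simp
    finally show ?thesis .
  qed
  define CC where "CC = (\<lambda>s. ((x, s), u (x, s))) ` ?T"
  have CC: "compact CC" unfolding CC_def
    using x by (intro compact_continuous_image continuous_intros continuous_on_compose2[OF cu]) auto
  have CCsub: "CC \<subseteq> ?\<Omega>" unfolding CC_def using x u(2) by auto
  have bl: "bounded_linear (F' c)" if "c \<in> ?\<Omega>" for c by (rule has_derivative_bounded_linear[OF F[OF that]])
  \<comment> \<open>Continuity in every fixed direction is upgraded to continuity in operator norm,
    which finite dimension permits and the estimate along segments requires.\<close>
  have "continuous_on ?\<Omega> (\<lambda>c. Blinfun (F' c))"
  proof (rule continuous_on_blinfun_componentwise)
    fix i :: "('p \<times> real) \<times> 'e" assume "i \<in> Basis"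
    show "continuous_on ?\<Omega> (\<lambda>c. blinfun_apply (Blinfun (F' c)) i)"
      by (rule continuous_on_eq[OF F'[of i]]) (use bl in \<open>simp add: bounded_linear_Blinfun_apply\<close>)
  qed
  then obtain d1 where d1: "d1 > 0"
    "\<And>c y. c \<in> CC \<Longrightarrow> y \<in> ?\<Omega> \<Longrightarrow> dist y c < d1 \<Longrightarrow> dist (Blinfun (F' y)) (Blinfun (F' c)) < \<epsilon>"
    using compact_uniformly_near[OF CC CCsub _ \<epsilon>] by metis
  have d1': "onorm (F' y - F' c) \<le> \<epsilon>" if "c \<in> CC" "y \<in> ?\<Omega>" "dist y c < d1" for c y
  proof -
    have "blinfun_apply (Blinfun (F' y) - Blinfun (F' c)) = F' y - F' c"
      using bl[OF that(2)] bl[of c] that(1) CCsub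
      by (auto simp: fun_eq_iff blinfun.diff_left bounded_linear_Blinfun_apply)
    then show ?thesis using d1(2)[OF that] by (simp add: dist_norm norm_blinfun.rep_eq)
  qed
  have "compact ({x} \<times> ?T)" by (intro compact_Times) auto
  moreover have "{x} \<times> ?T \<subseteq> D \<times> ?T" using x by auto
  ultimately obtain d2 where d2: "d2 > 0"
    "\<And>c y. c \<in> {x} \<times> ?T \<Longrightarrow> y \<in> D \<times> ?T \<Longrightarrow> dist y c < d2 \<Longrightarrow> dist (u y) (u c) < d1 / 2"
    using compact_uniformly_near[OF _ _ cu half_gt_zero[OF d1(1)]] by metis
  obtain d3 where d3: "d3 > 0" "\<And>y. y \<in> D \<Longrightarrow> norm (y - x) < d3 \<Longrightarrow> norm (u0 y - u0 x - u0' (y - x)) \<le> \<epsilon> * norm (y - x)"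
    using u0 \<epsilon> unfolding has_derivative_within_alt by blast
  define d where "d = min (d1 / 2) (min d2 d3)"
  have "norm (u (y, t) - u (x, t) - Z (y - x) t) \<le> \<eta> * norm (y - x)" if y: "y \<in> D" and yd: "norm (y - x) < d" for y
  proof -
    define W where "W s = u (y, s) - u (x, s) - Z (y - x) s" for s
    have "norm (W t) \<le> 4 * (norm (W 0) + e * (\<epsilon> * (1 + C) * norm (y - x)))"
    proof (rule contraction_estimate)
      show "(K + \<epsilon>) * e \<le> 3/4" using e(3) \<epsilon>e by (simp add: algebra_simps)
      fix s assume s: "s \<in> ?T"
      let ?c = "((x, s), u (x, s))" and ?c' = "((y, s), u (y, s))"
      show "(W has_vector_derivative F ?c' - F ?c - F' ?c ((y - x, 0), Z (y - x) s)) (at s within ?T)"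
        unfolding W_def by (intro has_vector_derivative_diff u(3) Z(3) x y s)
      have c: "?c \<in> CC" "?c \<in> ?\<Omega>" "?c' \<in> ?\<Omega>" using s x y u(2) by (auto simp: CC_def)
      interpret bounded_linear "F' ?c" by (rule bl[OF c(2)])
      have du: "dist (u (y, s)) (u (x, s)) < d1 / 2"
        using s x y yd by (intro d2(2)) (auto simp: dist_Pair_Pair dist_norm d_def)
      have dcc: "?c' - ?c = ((y - x, 0), u (y, s) - u (x, s))" by simp
      have nd: "norm (?c' - ?c) \<le> norm (y - x) + norm (u (y, s) - u (x, s))"
        unfolding dcc using norm_Pair_le[of "(y - x, 0::real)" "u (y, s) - u (x, s)"] by (simp add: norm_Pair)
      have cc: "dist ?c' ?c < d1" using nd du yd by (simp add: dist_norm d_def)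
      \<comment> \<open>Mean value inequality for \<open>F\<close> minus its linearisation at
        \<open>?c\<close>, on the segment to \<open>?c'\<close>, which stays in the domain because
        \<open>D\<close> and \<open>Y\<close> are convex.\<close>
      have "norm (F ?c' - F ?c - F' ?c (?c' - ?c)) \<le> norm (?c' - ?c) * \<epsilon>"
      proof (rule differentiable_bound_linearization[where S = "closed_segment ?c ?c'"])
        have "convex ?\<Omega>" using DY by (intro convex_Times) auto
        then have seg: "closed_segment ?c ?c' \<subseteq> ?\<Omega>" using c by (intro closed_segment_subset) auto
        fix \<xi> assume \<xi>: "\<xi> \<in> closed_segment ?c ?c'"
        show "(F has_derivative F' \<xi>) (at \<xi> within closed_segment ?c ?c')"
          using F seg \<xi> has_derivative_subset by blast
        have "dist \<xi> ?c \<le> dist ?c' ?c" using dist_in_closed_segment[OF \<xi>] by (simp add: dist_commute)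
        then show "onorm (F' \<xi> - F' ?c) \<le> \<epsilon>" using d1'[OF c(1), of \<xi>] cc seg \<xi> by auto
      next
        fix r :: real assume "r \<in> {0..1}"
        then show "?c + r *\<^sub>R (?c' - ?c) \<in> closed_segment ?c ?c'"
          unfolding in_segment by (intro exI[of _ r]) (simp add: algebra_simps)
      qed auto
      also have "\<dots> \<le> (norm (y - x) + norm (u (y, s) - u (x, s))) * \<epsilon>" using nd \<epsilon> by (intro mult_right_mono) auto
      also have "\<dots> \<le> (norm (y - x) + (norm (W s) + C * norm (y - x))) * \<epsilon>"
      proof -
        have "norm (u (y, s) - u (x, s)) \<le> norm (W s) + norm (Z (y - x) s)"
          unfolding W_def using norm_triangle_ineq[of "u (y, s) - u (x, s) - Z (y - x) s" "Z (y - x) s"] by simp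
        then show ?thesis using ZC[OF s, of "y - x"] \<epsilon> by (intro mult_right_mono) auto
      qed
      finally have 1: "norm (F ?c' - F ?c - F' ?c (?c' - ?c)) \<le> \<epsilon> * norm (W s) + \<epsilon> * (1 + C) * norm (y - x)"
        by (simp add: algebra_simps)
      \<comment> \<open>The true increment and the one predicted by \<open>Z\<close> differ in the
        state only, by \<open>W s\<close>, so the bound \<open>K\<close> on the state derivative
        suffices.\<close>
      have "(?c' - ?c) - ((y - x, 0), Z (y - x) s) = ((0, 0), W s)" by (simp add: W_def flip: zero_prod_def)
      then have "F' ?c (?c' - ?c) - F' ?c ((y - x, 0), Z (y - x) s) = F' ?c (0, W s)"
        using diff[of "?c' - ?c" "((y - x, 0), Z (y - x) s)"] by (simp only: zero_prod_def)
      then have 2: "norm (F' ?c (?c' - ?c) - F' ?c ((y - x, 0), Z (y - x) s)) \<le> K * norm (W s)"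
        using K[OF c(2)] by simp
      show "norm (F ?c' - F ?c - F' ?c ((y - x, 0), Z (y - x) s)) \<le> (K + \<epsilon>) * norm (W s) + \<epsilon> * (1 + C) * norm (y - x)"
        using norm_triangle_ineq[of "F ?c' - F ?c - F' ?c (?c' - ?c)" "F' ?c (?c' - ?c) - F' ?c ((y - x, 0), Z (y - x) s)"] 1 2
        by (simp add: algebra_simps)
    qed (use e \<epsilon> C0 t in auto)
    moreover have "norm (W 0) \<le> \<epsilon> * norm (y - x)"
      using d3(2)[OF y] yd u(1)[OF y] u(1)[OF x] Z(2) by (simp add: W_def d_def)
    ultimately have "norm (W t) \<le> 4 * (\<epsilon> * norm (y - x) + e * (\<epsilon> * (1 + C) * norm (y - x)))" by argo
    also have "\<dots> = 4 * (\<epsilon> + e * (\<epsilon> * (1 + C))) * norm (y - x)" by (simp add: algebra_simps)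
    also have "\<dots> \<le> \<eta> * norm (y - x)" using \<epsilon>\<eta> by (intro mult_right_mono) auto
    finally show ?thesis by (simp add: W_def)
  qed
  moreover have "d > 0" using d1 d2 d3 by (simp add: d_def)
  ultimately show "\<exists>d>0. \<forall>y\<in>D. norm (y - x) < d \<longrightarrow> norm (u (y, t) - u (x, t) - Z (y - x) t) \<le> \<eta> * norm (y - x)"
    by blast
qed

text \<open>The direction of differentiation enters the linearised equation as a constant and not as
  a further parameter, which is why the types do not grow. The derivative of \<open>u\<close> is
  assembled from the solutions of that equation and from the time derivative, which the equation for
  \<open>u\<close> itself supplies.\<close>

lemma param_ode_Ck:
  fixes F :: "('p::euclidean_space \<times> real) \<times> 'e::euclidean_space \<Rightarrow> 'e"
  assumes e: "e > 0" "K \<ge> 0" "K * e \<le> 1/2" and D: "convex D"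
    and Y: "convex Y" "open Y"
    and F: "Ck_on k UNIV ((D \<times> {-e..e}) \<times> Y) F"
    and lip: "\<And>x t y z. x \<in> D \<Longrightarrow> t \<in> {-e..e} \<Longrightarrow> y \<in> Y \<Longrightarrow> z \<in> Y \<Longrightarrow>
       norm (F ((x, t), y) - F ((x, t), z)) \<le> K * norm (y - z)"
    and u0: "Ck_on k UNIV D u0"
    and u: "\<And>x. x \<in> D \<Longrightarrow> u (x, 0) = u0 x" "\<And>x t. x \<in> D \<Longrightarrow> t \<in> {-e..e} \<Longrightarrow> u (x, t) \<in> Y"
      "\<And>x t. x \<in> D \<Longrightarrow> t \<in> {-e..e} \<Longrightarrow>
         ((\<lambda>t. u (x, t)) has_vector_derivative F ((x, t), u (x, t))) (at t within {-e..e})"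
  shows "Ck_on k UNIV (D \<times> {-e..e}) u"
  using Y F lip u0 u
proof (induction k arbitrary: Y F u0 u)
  case 0
  then show ?case using param_ode_continuous[OF e, of D Y F u0 u] by simp
next
  case (Suc k)
  note Y = Suc.prems(1,2) and lip = Suc.prems(4) and u = Suc.prems(6-8)
  let ?T = "{-e..e}" and ?\<Omega> = "(D \<times> {-e..e}) \<times> Y"
  have Fk: "Ck_on k UNIV ?\<Omega> F" and u0k: "Ck_on k UNIV D u0"
    using Suc.prems(3,5) Ck_on_Suc_imp by blast+
  obtain F' where F': "\<And>c. c \<in> ?\<Omega> \<Longrightarrow> (F has_derivative F' c) (at c within ?\<Omega>)"
    "\<And>v. Ck_on k UNIV ?\<Omega> (\<lambda>c. F' c v)" using Suc.prems(3) by auto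
  obtain u0' where u0': "\<And>x. x \<in> D \<Longrightarrow> (u0 has_derivative u0' x) (at x within D)"
    "\<And>v. Ck_on k UNIV D (\<lambda>x. u0' x v)" using Suc.prems(5) by auto
  have uk: "Ck_on k UNIV (D \<times> ?T) u" by (rule Suc.IH[OF Y Fk lip u0k u])
  have cu: "continuous_on (D \<times> ?T) u" by (rule Ck_on_continuous[OF uk])
  have bl: "bounded_linear (F' c)" if "c \<in> ?\<Omega>" for c by (rule has_derivative_bounded_linear[OF F'(1)[OF that]])
  have dom: "(p, u p) \<in> ?\<Omega>" if "p \<in> D \<times> ?T" for p using that u(2) by auto
  \<comment> \<open>\<open>Y\<close> is open, so short segments in the state direction stay in the
    domain and the Lipschitz bound passes to the derivative.\<close>
  have K: "norm (F' c (0, Z)) \<le> K * norm Z" if c: "c \<in> ?\<Omega>" for c Z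
  proof -
    obtain x t y where xty: "c = ((x, t), y)" "x \<in> D" "t \<in> ?T" "y \<in> Y" using c by auto
    define I where "I = (\<lambda>s::real. y + s *\<^sub>R Z) -` Y"
    have I: "open I" "0 \<in> I" unfolding I_def using Y xty(4)
      by (auto intro!: open_vimage continuous_intros)
    have "((\<lambda>s. F ((x, t), y + s *\<^sub>R Z)) has_vector_derivative F' c (0, Z)) (at 0)"
    proof (rule has_vector_derivative_compose_deriv[where T = ?\<Omega> and I = I])
      show "((\<lambda>s. ((x, t), y + s *\<^sub>R Z)) has_vector_derivative (0, Z)) (at 0)"
        by (auto intro!: derivative_eq_intros has_vector_derivative_Pair simp: zero_prod_def)
      show "(\<lambda>s. ((x, t), y + s *\<^sub>R Z)) ` I \<subseteq> ?\<Omega>" using xty by (auto simp: I_def)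
      show "(F has_derivative F' c) (at ((x, t), y + 0 *\<^sub>R Z) within ?\<Omega>)"
        using F'(1)[OF c] xty(1) by simp
    qed (use I in auto)
    moreover have "eventually (\<lambda>s. s \<in> I) (at 0)"
      using eventually_at_in_open'[OF I] by simp
    then have "eventually (\<lambda>s. norm (F ((x, t), y + s *\<^sub>R Z) - F ((x, t), y + 0 *\<^sub>R Z)) \<le> K * norm Z * \<bar>s\<bar>) (at 0)"
    proof eventually_elim
      case (elim s)
      then have "norm (F ((x, t), y + s *\<^sub>R Z) - F ((x, t), y)) \<le> K * norm (y + s *\<^sub>R Z - y)"
        using xty by (intro lip) (auto simp: I_def)
      then show ?case by (simp add: mult_ac)
    qed
    ultimately show ?thesis by (rule lipschitz_derivative_bound)
  qed
  have A: "Ck_on k UNIV (D \<times> ?T) (\<lambda>p. F' (p, u p) v)" for v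
    by (rule Ck_on_compose_UNIV[OF Ck_on_Pair[OF Ck_on_bounded_linear[OF bounded_linear_ident] uk] F'(2)])
      (use dom in auto)
  define F2 where "F2 w = (\<lambda>(p, z). F' (p, u p) ((w, 0), z))" for w
  have F2: "Ck_on k UNIV ((D \<times> ?T) \<times> UNIV) (F2 w)" for w
  proof -
    have A': "Ck_on k UNIV ((D \<times> ?T) \<times> UNIV) (\<lambda>c. F' (fst c, u (fst c)) v)" for v
      by (rule Ck_on_compose_UNIV[OF Ck_on_bounded_linear[OF bounded_linear_fst] A]) auto
    \<comment> \<open>The direction \<open>z\<close> moves, so it is again expanded in
      \<open>Basis\<close>.\<close>
    have "Ck_on k UNIV ((D \<times> ?T) \<times> UNIV)
       (\<lambda>c. F' (fst c, u (fst c)) ((w, 0), 0) + (\<Sum>b\<in>Basis. (snd c \<bullet> b) *\<^sub>R F' (fst c, u (fst c)) (0, b)))"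
      by (intro Ck_on_add A' Ck_on_sum Ck_on_bilinear[OF bounded_bilinear_scaleR] Ck_on_bounded_linear
        bounded_linear_compose[OF bounded_linear_inner_left bounded_linear_snd])
    then show ?thesis
    proof (rule Ck_on_cong)
      fix c assume "c \<in> (D \<times> ?T) \<times> (UNIV :: 'e set)"
      then have c: "(fst c, u (fst c)) \<in> ?\<Omega>" using dom by auto
      interpret bounded_linear "F' (fst c, u (fst c))" by (rule bl[OF c])
      have "F' (fst c, u (fst c)) (0, snd c) = (\<Sum>b\<in>Basis. (snd c \<bullet> b) *\<^sub>R F' (fst c, u (fst c)) (0, b))"
        by (rule euclidean_expand) (intro bounded_linear_compose[OF bl[OF c]] bounded_linear_Pair
            bounded_linear_zero bounded_linear_ident)
      moreover have "F' (fst c, u (fst c)) ((w, 0), snd c) =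
          F' (fst c, u (fst c)) ((w, 0), 0) + F' (fst c, u (fst c)) (0, snd c)"
        by (simp add: add[symmetric])
      ultimately show "F' (fst c, u (fst c)) ((w, 0), 0) + (\<Sum>b\<in>Basis. (snd c \<bullet> b) *\<^sub>R F' (fst c, u (fst c)) (0, b)) = F2 w c"
        by (simp add: F2_def case_prod_beta)
    qed
  qed
  have F2lip: "norm (F2 w ((x, t), y) - F2 w ((x, t), z)) \<le> K * norm (y - z)" if "x \<in> D" "t \<in> ?T" for w x t y z
  proof -
    have c: "((x, t), u (x, t)) \<in> ?\<Omega>" using that dom by auto
    interpret bounded_linear "F' ((x, t), u (x, t))" by (rule bl[OF c])
    have "F2 w ((x, t), y) - F2 w ((x, t), z) = F' ((x, t), u (x, t)) (0, y - z)"
      by (simp add: F2_def diff[symmetric] zero_prod_def)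
    then show ?thesis using K[OF c] by simp
  qed
  have "\<exists>z. x \<in> D \<longrightarrow> z 0 = u0' x b \<and> (\<forall>t\<in>?T. (z has_vector_derivative F2 b ((x, t), z t)) (at t within ?T))" for x b
  proof (cases "x \<in> D")
    case True
    have "continuous_on (?T \<times> UNIV) (\<lambda>(t, y). ((x, t), y :: 'e))"
      by (auto simp: case_prod_beta intro!: continuous_intros)
    moreover have "(\<lambda>(t, y). ((x, t), y :: 'e)) ` (?T \<times> UNIV) \<subseteq> (D \<times> ?T) \<times> UNIV" using True by auto
    ultimately have "continuous_on (?T \<times> UNIV) (\<lambda>c. F2 b ((\<lambda>(t, y). ((x, t), y)) c))"
      by (rule continuous_on_compose2[OF Ck_on_continuous[OF F2[of b]]])
    then have "continuous_on (?T \<times> UNIV) (\<lambda>(t, y). F2 b ((x, t), y))" by (simp add: case_prod_beta')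
    from lipschitz_ode_exists[of e "\<lambda>t y. F2 b ((x, t), y)" K "u0' x b", OF this F2lip[OF True] e]
    show ?thesis by metis
  qed auto
  then obtain Zb where Zb: "\<And>x b. x \<in> D \<Longrightarrow> Zb x b 0 = u0' x b"
    "\<And>x b t. x \<in> D \<Longrightarrow> t \<in> ?T \<Longrightarrow> (Zb x b has_vector_derivative F2 b ((x, t), Zb x b t)) (at t within ?T)"
    by metis
  \<comment> \<open>Only the solutions for basis directions are kept, and superposed, so that
    linearity in \<open>w\<close> holds by construction.\<close>
  define Z where "Z x w t = (\<Sum>b\<in>Basis. (w \<bullet> b) *\<^sub>R Zb x b t)" for x w t
  have Z_Basis: "Z x b t = Zb x b t" if "b \<in> Basis" for x b t
  proof -
    have "Z x b t = (\<Sum>b'\<in>Basis. if b' = b then Zb x b t else 0)"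
      unfolding Z_def using that by (intro sum.cong) (auto simp: inner_Basis)
    then show ?thesis using that by simp
  qed
  have Z1: "Z x w t = (\<Sum>b\<in>Basis. (w \<bullet> b) *\<^sub>R Z x b t)" for x w t
    unfolding Z_def[of x w] using Z_Basis by (intro sum.cong) auto
  have Z2: "Z x w 0 = u0' x w" if "x \<in> D" for x w
    unfolding Z_def Zb(1)[OF that]
    by (rule euclidean_expand[OF has_derivative_bounded_linear[OF u0'(1)[OF that]], symmetric])
  have Z3: "((\<lambda>t. Z x w t) has_vector_derivative F2 w ((x, t), Z x w t)) (at t within ?T)"
    if x: "x \<in> D" and t: "t \<in> ?T" for x w t
  proof -
    have c: "((x, t), u (x, t)) \<in> ?\<Omega>" using that dom by auto
    interpret bounded_linear "F' ((x, t), u (x, t))" by (rule bl[OF c])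
    have "((\<lambda>t. Z x w t) has_vector_derivative (\<Sum>b\<in>Basis. (w \<bullet> b) *\<^sub>R F2 b ((x, t), Zb x b t))) (at t within ?T)"
      unfolding Z_def
      by (intro has_vector_derivative_sum bounded_linear.has_vector_derivative[OF bounded_linear_scaleR_right] Zb(2) x t)
    moreover have "(\<Sum>b\<in>Basis. (w \<bullet> b) *\<^sub>R F2 b ((x, t), Zb x b t)) =
        F' ((x, t), u (x, t)) (\<Sum>b\<in>Basis. (w \<bullet> b) *\<^sub>R ((b, 0), Zb x b t))"
      by (simp add: F2_def sum scaleR del: scaleR_Pair)
    moreover have "(\<Sum>b\<in>Basis. (w \<bullet> b) *\<^sub>R ((b, 0::real), Zb x b t)) = ((w, 0), Z x w t)"
      by (auto simp: prod_eq_iff fst_sum snd_sum Z_def euclidean_representation)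
    ultimately show ?thesis by (simp add: F2_def)
  qed
  have ZC: "Ck_on k UNIV (D \<times> ?T) (\<lambda>p. Z (fst p) w (snd p))" for w
  proof -
    have "((\<lambda>t. Z (fst (x, t)) w (snd (x, t))) has_vector_derivative
          F2 w ((x, t), Z (fst (x, t)) w (snd (x, t)))) (at t within ?T)" if "x \<in> D" "t \<in> ?T" for x t
      using Z3[OF that] by simp
    then show ?thesis
      by (intro Suc.IH[OF convex_UNIV open_UNIV F2 F2lip u0'(2)]) (use Z2 in auto)
  qed
  have Dx: "((\<lambda>x. u (x, t)) has_derivative (\<lambda>w. Z x w t)) (at x within D)" if x: "x \<in> D" and t: "t \<in> ?T" for x t
    by (rule param_ode_differentiable[where F = F and F' = F' and u = u and Z = "Z x", OF e D Y(1) F'(1) Ck_on_continuous[OF F'(2)] K u0'(1)[OF x] x u cu Z1 Z2[OF x] _ t])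
      (use Z3[OF x] in \<open>auto simp: F2_def\<close>)
  have FC: "Ck_on k UNIV (D \<times> ?T) (\<lambda>p. F (p, u p))"
    by (rule Ck_on_compose_UNIV[OF Ck_on_Pair[OF Ck_on_bounded_linear[OF bounded_linear_ident] uk] Fk])
      (use dom in auto)
  \<comment> \<open>The partial derivatives combine to a total one because the one in time is
    continuous; for the parameter, existence at the point is enough.\<close>
  have "((\<lambda>(x, t). u (x, t)) has_derivative (\<lambda>(w, \<tau>). Z x w t + blinfun_apply (blinfun_scaleR_left (F ((x, t), u (x, t)))) \<tau>))
      (at (x, t) within D \<times> ?T)" if x: "x \<in> D" and t: "t \<in> ?T" for x t
  proof (rule has_derivative_partialsI[where f = "\<lambda>x t. u (x, t)" and fx = "\<lambda>w. Z x w t"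
        and fy = "\<lambda>x t. blinfun_scaleR_left (F ((x, t), u (x, t)))" and X = D and Y = ?T])
    show "((\<lambda>x. u (x, t)) has_derivative (\<lambda>w. Z x w t)) (at x within D)" by (rule Dx[OF x t])
    show "((\<lambda>t. u (x, t)) has_derivative blinfun_apply (blinfun_scaleR_left (F ((x, t), u (x, t))))) (at t within ?T)"
      if "x \<in> D" "t \<in> ?T" for x t
      using u(3)[OF that] by (simp add: has_vector_derivative_def)
    have "continuous_on (D \<times> ?T) (\<lambda>p. blinfun_scaleR_left (F (p, u p)))"
      using Ck_on_continuous[OF FC] by (rule bounded_linear.continuous_on[OF bounded_linear_blinfun_scaleR_left])
    then show "continuous (at (x, t) within D \<times> ?T) (\<lambda>(x, t). blinfun_scaleR_left (F ((x, t), u (x, t))))"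
      using x t by (simp add: continuous_on_eq_continuous_within case_prod_beta')
  qed (use t in auto)
  then have "\<forall>p\<in>D \<times> ?T. (u has_derivative (\<lambda>v. Z (fst p) (fst v) (snd p) + snd v *\<^sub>R F (p, u p))) (at p within D \<times> ?T)"
    by (auto simp: case_prod_beta')
  moreover have "\<forall>v\<in>UNIV. Ck_on k UNIV (D \<times> ?T) (\<lambda>p. Z (fst p) (fst v) (snd p) + snd v *\<^sub>R F (p, u p))"
    by (intro ballI Ck_on_add ZC Ck_on_linear_compose[OF bounded_linear_scaleR_right] FC)
  ultimately show ?case
    unfolding Ck_on.simps by (intro exI[of _ "\<lambda>p v. Z (fst p) (fst v) (snd p) + snd v *\<^sub>R F (p, u p)"] conjI)
qed

subsection \<open>Flows of smooth vector fields\<close>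

text \<open>Compactness of a closed ball bounds the derivative in each basis direction, and
  convexity of the ball turns this into a Lipschitz constant.\<close>

lemma smooth_locally_lipschitz:
  fixes X :: "'e::euclidean_space \<Rightarrow> 'f::euclidean_space"
  assumes "Ck_on 1 UNIV S X" "open S" "z0 \<in> S"
  obtains R K M where "R > 0" "K > 0" "M > 0" "cball z0 R \<subseteq> S"
    "\<And>x. x \<in> cball z0 R \<Longrightarrow> norm (X x) \<le> M"
    "\<And>x y. x \<in> cball z0 R \<Longrightarrow> y \<in> cball z0 R \<Longrightarrow> norm (X x - X y) \<le> K * norm (x - y)"
proof -
  obtain R where R: "R > 0" "cball z0 R \<subseteq> S" using assms(2,3) open_contains_cball by blast
  obtain X' where X': "\<And>x. x \<in> S \<Longrightarrow> (X has_derivative X' x) (at x within S)"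
    "\<And>v. continuous_on S (\<lambda>x. X' x v)"
    using assms(1) by auto
  have bd: "\<exists>B. \<forall>x\<in>cball z0 R. norm (f x) \<le> B" if "continuous_on S f" for f :: "'e \<Rightarrow> 'f"
  proof -
    have "bounded (f ` cball z0 R)"
      using that R(2) by (intro compact_imp_bounded compact_continuous_image) (auto intro: continuous_on_subset)
    then show ?thesis by (auto simp: bounded_iff)
  qed
  obtain M where M: "\<And>x. x \<in> cball z0 R \<Longrightarrow> norm (X x) \<le> M"
    using bd[OF Ck_on_continuous[OF assms(1)]] by blast
  obtain B where B: "\<And>v x. x \<in> cball z0 R \<Longrightarrow> norm (X' x v) \<le> B v" using bd[OF X'(2)] by metis
  define K where "K = (\<Sum>b\<in>Basis. B b)"
  have lip: "norm (X x - X y) \<le> K * norm (x - y)" if "x \<in> cball z0 R" "y \<in> cball z0 R" for x y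
  proof (rule differentiable_bound[where S = "cball z0 R" and f' = X'])
    fix x assume x: "x \<in> cball z0 R"
    show d: "(X has_derivative X' x) (at x within cball z0 R)"
      using X'(1)[of x] x R(2) has_derivative_subset by blast
    have "onorm (X' x) \<le> (\<Sum>b\<in>Basis. norm (X' x b))"
      by (rule onorm_componentwise[OF has_derivative_bounded_linear[OF d]])
    also have "\<dots> \<le> K" unfolding K_def by (intro sum_mono B x)
    finally show "onorm (X' x) \<le> K" .
  qed (use that in auto)
  show thesis
  \<comment> \<open>The maximum with 1 makes both constants positive, as they are going to be
    denominators.\<close>
  proof (rule that[of R "max 1 K" "max 1 M"])
    fix x y assume "x \<in> cball z0 R" "y \<in> cball z0 R"
    then have "norm (X x - X y) \<le> K * norm (x - y)" by (rule lip)
    also have "\<dots> \<le> max 1 K * norm (x - y)" by (intro mult_right_mono) auto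
    finally show "norm (X x - X y) \<le> max 1 K * norm (x - y)" .
  next
    fix x assume "x \<in> cball z0 R"
    then show "norm (X x) \<le> max 1 M" using M by force
  qed (use R in auto)
qed

lemma open_projection_vimage:
  assumes "openin (top_of_set L) S" "bounded_linear P" "\<And>x. P x \<in> L"
  shows "open (P -` S)"
proof -
  obtain T where T: "open T" "S = L \<inter> T" using assms(1) by (auto simp: openin_open)
  then have "P -` S = P -` T" using assms(3) by auto
  then show ?thesis using T(1) assms(2) by (simp add: open_vimage linear_continuous_on)
qed

text \<open>With equal initial values and no inhomogeneity, \<open>contraction_estimate\<close>
  forces the difference of the curves to vanish. The field is first extended off \<open>L\<close> by
  a projection, because the Lipschitz constant is obtained on an ambient ball.\<close>

lemma ode_locally_unique:
  fixes X :: "'e::euclidean_space \<Rightarrow> 'e"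
  assumes L: "subspace L" "openin (top_of_set L) S" and X: "smooth_on L S X"
    and I: "open I" "t0 \<in> I"
    and c: "\<And>t. t \<in> I \<Longrightarrow> c t \<in> S" "\<And>t. t \<in> I \<Longrightarrow> (c has_vector_derivative X (c t)) (at t)"
    and c': "\<And>t. t \<in> I \<Longrightarrow> c' t \<in> S" "\<And>t. t \<in> I \<Longrightarrow> (c' has_vector_derivative X (c' t)) (at t)"
    and eq: "c t0 = c' t0"
  obtains d where "d > 0" "\<And>t. \<bar>t - t0\<bar> < d \<Longrightarrow> c t = c' t"
proof -
  obtain P where P: "bounded_linear P" "\<And>x. P x \<in> L" "\<And>x. x \<in> L \<Longrightarrow> P x = x"
    using orthogonal_projection_exists[OF L(1)] by metis
  have SL: "S \<subseteq> L" using L(2) openin_imp_subset by blast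
  have XC: "Ck_on 1 UNIV (P -` S) (\<lambda>x. X (P x))"
    using X P(1,2) unfolding smooth_on_def by (intro Ck_on_extend[of _ L]) auto
  have z0: "c t0 \<in> P -` S" using c(1)[OF I(2)] SL P(3) by (metis subsetD vimage_eq)
  obtain R K M where R: "R > 0" "K > 0" "cball (c t0) R \<subseteq> P -` S"
    "\<And>x y. x \<in> cball (c t0) R \<Longrightarrow> y \<in> cball (c t0) R \<Longrightarrow> norm (X (P x) - X (P y)) \<le> K * norm (x - y)"
    using smooth_locally_lipschitz[OF XC open_projection_vimage[OF L(2) P(1,2)] z0] by metis
  have cont: "continuous (at t0) c" "continuous (at t0) c'"
    using c(2)[OF I(2)] c'(2)[OF I(2)] has_vector_derivative_continuous by blast+
  obtain d1 where d1: "d1 > 0" "\<And>t. dist t t0 < d1 \<Longrightarrow> dist (c t) (c t0) < R"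
    using cont(1) R(1) unfolding continuous_at_eps_delta dist_norm by metis
  obtain d2 where d2: "d2 > 0" "\<And>t. dist t t0 < d2 \<Longrightarrow> dist (c' t) (c' t0) < R"
    using cont(2) R(1) unfolding continuous_at_eps_delta dist_norm by metis
  obtain d3 where d3: "d3 > 0" "\<And>t. dist t t0 < d3 \<Longrightarrow> t \<in> I"
    using I unfolding open_dist by blast
  \<comment> \<open>Small enough for both curves to stay in the ball of the Lipschitz bound, for the
    time to stay in \<open>I\<close>, and for \<open>K * e\<close> to be at most 1/2.\<close>
  define e where "e = min (min (d1 / 2) (d2 / 2)) (min (d3 / 2) (1 / (2 * K)))"
  have e: "e > 0" using d1 d2 d3 R by (simp add: e_def)
  have "K * e \<le> K * (1 / (2 * K))" using R(2) by (intro mult_left_mono) (auto simp: e_def)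
  then have Ke: "K * e \<le> 3/4" using R(2) by simp
  define w where "w s = c (t0 + s) - c' (t0 + s)" for s
  have "norm (w s) \<le> 4 * (norm (w 0) + e * 0)" if "s \<in> {-e..e}" for s
  proof (rule contraction_estimate[where K = K])
    fix s assume s: "s \<in> {-e..e}"
    have d: "dist (t0 + s) t0 < d1" "dist (t0 + s) t0 < d2" "dist (t0 + s) t0 < d3"
      using s d1 d2 d3 by (auto simp: dist_norm e_def)
    have tI: "t0 + s \<in> I" using d3(2) d(3) .
    have "((\<lambda>s. t0 + s) has_vector_derivative 1) (at s)" by (auto intro!: derivative_eq_intros)
    from vector_diff_chain_at[OF this, of c] vector_diff_chain_at[OF this, of c'] c(2)[OF tI] c'(2)[OF tI]
    have "(w has_vector_derivative X (c (t0 + s)) - X (c' (t0 + s))) (at s)"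
      unfolding w_def by (auto simp: o_def intro!: has_vector_derivative_diff)
    then show "(w has_vector_derivative X (c (t0 + s)) - X (c' (t0 + s))) (at s within {-e..e})"
      by (rule has_vector_derivative_at_within)
    have "c (t0 + s) \<in> cball (c t0) R" "c' (t0 + s) \<in> cball (c t0) R"
      using d1(2)[OF d(1)] d2(2)[OF d(2)] eq by (auto simp: dist_commute)
    from R(4)[OF this] show "norm (X (c (t0 + s)) - X (c' (t0 + s))) \<le> K * norm (w s) + 0"
      using P(3) c(1)[OF tI] c'(1)[OF tI] SL by (auto simp: w_def subset_iff)
  qed (use R Ke that in auto)
  then have w0: "w s = 0" if "s \<in> {-e..e}" for s using that eq by (simp add: w_def)
  show thesis
  proof (rule that[OF e])
    fix t assume "\<bar>t - t0\<bar> < e"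
    then have "t - t0 \<in> {-e..e}" by auto
    from w0[OF this] show "c t = c' t" by (simp add: w_def)
  qed
qed

text \<open>The field is extended off \<open>L\<close> by \<open>P\<close> and composed with the
  closest-point map of a ball, which makes it globally Lipschitz. For short times solutions do not
  leave the ball, so they do not notice the cut-off, and those starting in \<open>L\<close> stay
  there.\<close>

lemma local_flow:
  fixes X :: "'e::euclidean_space \<Rightarrow> 'e"
  assumes L: "subspace L" "openin (top_of_set L) S" and X: "smooth_on L S X" "X ` S \<subseteq> L" and z0: "z0 \<in> S"
  obtains e r \<Phi> where "e > 0" "r > 0" "L \<inter> ball z0 r \<subseteq> S"
    "\<And>x. x \<in> L \<inter> ball z0 r \<Longrightarrow> \<Phi> (x, 0) = x"
    "\<And>x t. x \<in> L \<inter> ball z0 r \<Longrightarrow> t \<in> {-e<..<e} \<Longrightarrow> \<Phi> (x, t) \<in> S"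
    "\<And>x t. x \<in> L \<inter> ball z0 r \<Longrightarrow> t \<in> {-e<..<e} \<Longrightarrow>
       ((\<lambda>t. \<Phi> (x, t)) has_vector_derivative X (\<Phi> (x, t))) (at t)"
    "smooth_on (L \<times> UNIV) ((L \<inter> ball z0 r) \<times> {-e<..<e}) \<Phi>"
proof -
  obtain P where P: "bounded_linear P" "\<And>x. P x \<in> L" "\<And>x. x \<in> L \<Longrightarrow> P x = x"
    using orthogonal_projection_exists[OF L(1)] by metis
  interpret P: bounded_linear P by (rule P(1))
  have SL: "S \<subseteq> L" using L(2) openin_imp_subset by blast
  have XC: "Ck_on k UNIV (P -` S) (\<lambda>x. X (P x))" for k
    using X P(1,2) unfolding smooth_on_def by (intro Ck_on_extend[of _ L]) auto
  have z0': "z0 \<in> P -` S" using z0 SL P(3) by (metis subsetD vimage_eq)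
  obtain R K M where R: "R > 0" "K > 0" "M > 0" "cball z0 R \<subseteq> P -` S"
    "\<And>x. x \<in> cball z0 R \<Longrightarrow> norm (X (P x)) \<le> M"
    "\<And>x y. x \<in> cball z0 R \<Longrightarrow> y \<in> cball z0 R \<Longrightarrow> norm (X (P x) - X (P y)) \<le> K * norm (x - y)"
    using smooth_locally_lipschitz[OF XC open_projection_vimage[OF L(2) P(1,2)] z0'] by metis
  \<comment> \<open>The first bound serves the contraction; the second limits the motion to
    \<open>R / 4\<close>, so that a curve starting within \<open>R / 2\<close> of \<open>z0\<close>
    stays in the open ball of radius \<open>R\<close>.\<close>
  define e where "e = min (1 / (2 * K)) (R / (4 * M))"
  have e: "e > 0" using R by (simp add: e_def)
  have Ke: "K * e \<le> 1/2"
    using mult_left_mono[of e "1 / (2 * K)" K] R(2) by (simp add: e_def)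
  have Me: "M * e \<le> R / 4"
    using mult_left_mono[of e "R / (4 * M)" M] R(3) by (simp add: e_def)
  define cp where "cp = closest_point (cball z0 R)"
  have cp: "cp y \<in> cball z0 R" for y unfolding cp_def using R(1) by (intro closest_point_in_set) auto
  have cp_lip: "dist (cp y) (cp z) \<le> dist y z" for y z
    unfolding cp_def using R(1) by (intro closest_point_lipschitz) auto
  have cp_id: "cp y = y" if "y \<in> cball z0 R" for y unfolding cp_def using that by (rule closest_point_self)
  let ?T = "{-e..e}" and ?D = "ball z0 (R / 2)"
  have "\<exists>u. x \<in> ?D \<longrightarrow> u 0 = x \<and> (\<forall>t\<in>?T. u t \<in> ball z0 R \<and> (u has_vector_derivative X (P (u t))) (at t within ?T))" for x
  proof (cases "x \<in> ?D")
    case True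
    have lip: "norm (X (P (cp y)) - X (P (cp z))) \<le> K * norm (y - z)" for y z
      using R(6)[OF cp cp, of y z] mult_left_mono[OF cp_lip[of y z] less_imp_le[OF R(2)]]
      unfolding dist_norm by (rule order_trans)
    have "continuous_on UNIV (\<lambda>y. X (P (cp y)))"
      using R(1) cp R(4) unfolding cp_def
      by (intro continuous_on_compose2[OF Ck_on_continuous[OF XC]] continuous_on_closest_point) auto
    then have cont: "continuous_on (?T \<times> UNIV) (\<lambda>(t, y). X (P (cp y)))"
      unfolding case_prod_beta by (rule continuous_on_compose2) (auto intro: continuous_intros)
    obtain u where u: "u 0 = x" "\<And>t. t \<in> ?T \<Longrightarrow> (u has_vector_derivative X (P (cp (u t)))) (at t within ?T)"
      using lipschitz_ode_exists[OF cont lip e less_imp_le[OF R(2)] Ke] by metis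
    have in_ball: "u t \<in> ball z0 R" if t: "t \<in> ?T" for t
    proof -
      have "norm (u t - u 0) \<le> M * \<bar>t - 0\<bar>"
        using R(5) cp t e by (intro norm_diff_le_derivative_bound[OF u(2)]) auto
      also have "\<dots> \<le> M * e" using t R(3) by (intro mult_left_mono) auto
      finally have "dist (u t) x \<le> R / 4" using Me u(1) by (simp add: dist_norm)
      then show ?thesis using True R(1) dist_triangle[of z0 "u t" x] by (auto simp: dist_commute)
    qed
    have "(u has_vector_derivative X (P (u t))) (at t within ?T)" if t: "t \<in> ?T" for t
      using u(2)[OF t] cp_id[of "u t"] in_ball[OF t] by auto
    then show ?thesis using u(1) in_ball by blast
  qed auto
  then obtain u where u: "\<And>x. x \<in> ?D \<Longrightarrow> u x 0 = x" "\<And>x t. x \<in> ?D \<Longrightarrow> t \<in> ?T \<Longrightarrow> u x t \<in> ball z0 R"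
    "\<And>x t. x \<in> ?D \<Longrightarrow> t \<in> ?T \<Longrightarrow> (u x has_vector_derivative X (P (u x t))) (at t within ?T)"
    by metis
  define \<Phi> where "\<Phi> = (\<lambda>(x, t). u x t)"
  have sub: "ball z0 R \<subseteq> P -` S" using R(4) by auto
  have smooth: "Ck_on k UNIV (?D \<times> ?T) \<Phi>" for k
  proof -
    have 1: "Ck_on k UNIV ((?D \<times> ?T) \<times> ball z0 R) (\<lambda>c. X (P (snd c)))"
      by (rule Ck_on_compose_UNIV[OF Ck_on_bounded_linear[OF bounded_linear_snd] XC]) (use sub in auto)
    have 2: "Ck_on k UNIV ?D (\<lambda>x. x)" by (rule Ck_on_bounded_linear[OF bounded_linear_ident])
    show ?thesis
      by (rule param_ode_Ck[OF e less_imp_le[OF R(2)] Ke convex_ball convex_ball open_ball 1 _ 2])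
        (use R(6) u in \<open>auto simp: \<Phi>_def\<close>)
  qed
  \<comment> \<open>The component \<open>u - P u\<close> vanishes initially and has derivative zero,
    since the extended field takes values in \<open>L\<close> along the curve.\<close>
  have inL: "u x t \<in> L" if x: "x \<in> ?D" "x \<in> L" and t: "t \<in> ?T" for x t
  proof -
    have d: "((\<lambda>t. u x t - P (u x t)) has_vector_derivative X (P (u x t)) - P (X (P (u x t)))) (at t within ?T)"
      if "t \<in> ?T" for t
      by (intro has_vector_derivative_diff P.has_vector_derivative u(3) x(1) that)
    have "P (u x t) \<in> S" if "t \<in> ?T" for t using u(2)[OF x(1) that] sub by auto
    then have z: "norm (X (P (u x t)) - P (X (P (u x t)))) \<le> 0" if "t \<in> ?T" for t
      using that X(2) P(3) by (auto simp: image_subset_iff)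
    have "norm ((u x t - P (u x t)) - (u x 0 - P (u x 0))) \<le> 0 * \<bar>t - 0\<bar>"
      using e t by (intro norm_diff_le_derivative_bound[OF d z]) auto
    then have "u x t = P (u x t)" using u(1)[OF x(1)] P(3)[OF x(2)] by simp
    then show ?thesis using P(2) by metis
  qed
  show thesis
  proof (rule that[of e "R / 2" \<Phi>])
    show "L \<inter> ball z0 (R / 2) \<subseteq> S"
    proof
      fix x assume x: "x \<in> L \<inter> ball z0 (R / 2)"
      then have "x \<in> ball z0 R" using R(1) by auto
      then show "x \<in> S" using sub x P(3) by fastforce
    qed
    fix x t assume x: "x \<in> L \<inter> ball z0 (R / 2)" and t: "t \<in> {-e<..<e}"
    have PS: "P (u x t) = u x t" using inL[of x t] x t P(3) by auto
    show "\<Phi> (x, t) \<in> S" using u(2)[of x t] x t sub PS by (auto simp: \<Phi>_def)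
    have "(u x has_vector_derivative X (P (u x t))) (at t)"
      using u(3)[of x t] x t at_within_interior[of t ?T] by auto
    then show "((\<lambda>t. \<Phi> (x, t)) has_vector_derivative X (\<Phi> (x, t))) (at t)"
      using PS by (simp add: \<Phi>_def)
  next
    show "smooth_on (L \<times> UNIV) ((L \<inter> ball z0 (R / 2)) \<times> {-e<..<e}) \<Phi>"
      unfolding smooth_on_def by (intro allI Ck_on_mono[OF smooth]) auto
  qed (use e R u(1) in \<open>auto simp: \<Phi>_def\<close>)
qed

section \<open>Charts and tangent vectors\<close>

text \<open>\<open>smooth_manifold\<close> without its separation and countability axioms, so that
  cotangent bundles and products can be handled by computing in charts. Hausdorff separation is
  brought in where integral curves are compared.\<close>

locale smooth_atlas =
  fixes M :: "('i, 'a, 'e::euclidean_space) manifold"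
  assumes subspace_model: "subspace (mmodel M)"
    and inj_chart: "i \<in> midx M \<Longrightarrow> inj_on (mchart M i) (mdom M i)"
    and open_overlap: "i \<in> midx M \<Longrightarrow> j \<in> midx M \<Longrightarrow>
          openin (top_of_set (mmodel M)) (mchart M i ` (mdom M i \<inter> mdom M j))"
    and smooth_transition: "i \<in> midx M \<Longrightarrow> j \<in> midx M \<Longrightarrow>
          smooth_on (mmodel M) (mchart M i ` (mdom M i \<inter> mdom M j)) (mchart M j \<circ> chart_inv M i)"

lemma smooth_manifold_atlas: "smooth_manifold M \<Longrightarrow> smooth_atlas M"
  unfolding smooth_manifold_def by unfold_locales auto

lemma charts_at_iff: "i \<in> charts_at M x \<longleftrightarrow> i \<in> midx M \<and> x \<in> mdom M i"
  by (auto simp: charts_at_def)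

lemma points_iff: "x \<in> points M \<longleftrightarrow> (\<exists>i. i \<in> charts_at M x)"
  by (auto simp: charts_at_def points_def)

lemma chart_chart_inv: "y \<in> mchart M i ` mdom M i \<Longrightarrow> mchart M i (chart_inv M i y) = y"
  unfolding chart_inv_def by (rule f_inv_into_f)

lemma chart_inv_in_mdom: "y \<in> mchart M i ` mdom M i \<Longrightarrow> chart_inv M i y \<in> mdom M i"
  unfolding chart_inv_def by (rule inv_into_into)

lemma tangent_space_iff:
  "v \<in> tangent_space M x \<longleftrightarrow>
     (\<forall>i. i \<notin> charts_at M x \<longrightarrow> v i = 0) \<and>
     (\<forall>i\<in>charts_at M x. v i \<in> mmodel M) \<and>
     (\<forall>i\<in>charts_at M x. \<forall>j\<in>charts_at M x. v j = transition_deriv M x i j (v i))"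
  by (simp add: tangent_space_def)

lemma tangent_space_transition:
  "v \<in> tangent_space M x \<Longrightarrow> i \<in> charts_at M x \<Longrightarrow> j \<in> charts_at M x \<Longrightarrow> transition_deriv M x i j (v i) = v j"
  unfolding tangent_space_iff by metis

lemma tangent_space_in_model: "v \<in> tangent_space M x \<Longrightarrow> i \<in> charts_at M x \<Longrightarrow> v i \<in> mmodel M"
  unfolding tangent_space_iff by blast

context smooth_atlas
begin

lemma chart_inv_chart: "i \<in> midx M \<Longrightarrow> x \<in> mdom M i \<Longrightarrow> chart_inv M i (mchart M i x) = x"
  unfolding chart_inv_def by (rule inv_into_f_f[OF inj_chart])

lemma openin_image: "i \<in> midx M \<Longrightarrow> openin (top_of_set (mmodel M)) (mchart M i ` mdom M i)"
  using open_overlap[of i i] by simp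

lemma chart_in_model: "i \<in> midx M \<Longrightarrow> x \<in> mdom M i \<Longrightarrow> mchart M i x \<in> mmodel M"
  using openin_imp_subset[OF openin_image] by blast

text \<open>\<open>topology\<close> yields the intended open sets only once the family is known to
  be a topology; injectivity of the charts enters for intersections.\<close>

lemma openin_mtop:
  "openin (mtop M) U \<longleftrightarrow> U \<subseteq> points M \<and>
     (\<forall>i\<in>midx M. openin (top_of_set (mmodel M)) (mchart M i ` (U \<inter> mdom M i)))"
proof -
  let ?P = "\<lambda>U. U \<subseteq> points M \<and> (\<forall>i\<in>midx M. openin (top_of_set (mmodel M)) (mchart M i ` (U \<inter> mdom M i)))"
  have "istopology ?P"
    unfolding istopology_def
  proof (intro conjI allI impI ballI)
    fix S T i assume ST: "?P S" "?P T" and i: "i \<in> midx M"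
    have "mchart M i ` (S \<inter> T \<inter> mdom M i) = mchart M i ` (S \<inter> mdom M i) \<inter> mchart M i ` (T \<inter> mdom M i)"
      using inj_chart[OF i] by (auto simp: inj_on_def)
    then show "openin (top_of_set (mmodel M)) (mchart M i ` (S \<inter> T \<inter> mdom M i))" using ST i by auto
  next
    fix \<K> i assume K: "\<forall>K\<in>\<K>. ?P K" and i: "i \<in> midx M"
    have "mchart M i ` (\<Union>\<K> \<inter> mdom M i) = (\<Union>K\<in>\<K>. mchart M i ` (K \<inter> mdom M i))" by auto
    moreover have "openin (top_of_set (mmodel M)) (\<Union>K\<in>\<K>. mchart M i ` (K \<inter> mdom M i))"
      using K i by (intro openin_Union) auto
    ultimately show "openin (top_of_set (mmodel M)) (mchart M i ` (\<Union>\<K> \<inter> mdom M i))" by simp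
  qed auto
  then show ?thesis unfolding mtop_def by (simp add: topology_inverse')
qed

lemma openin_points: "openin (mtop M) (points M)"
  unfolding openin_mtop
proof (intro conjI ballI)
  fix i assume i: "i \<in> midx M"
  then have "points M \<inter> mdom M i = mdom M i" by (auto simp: points_def)
  then show "openin (top_of_set (mmodel M)) (mchart M i ` (points M \<inter> mdom M i))" using openin_image[OF i] by simp
qed simp

lemma topspace_mtop: "topspace (mtop M) = points M"
  using openin_points openin_mtop[of "topspace (mtop M)"] openin_subset[of "mtop M" "points M"] by auto

lemma openin_mdom: "i \<in> midx M \<Longrightarrow> openin (mtop M) (mdom M i)"
  unfolding openin_mtop using open_overlap[of _ i] by (auto simp: points_def Int_commute)

text \<open>Openness has to be tested in every chart \<open>j\<close>; there the set is a preimage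
  under the transition map, which is continuous on an open overlap.\<close>

lemma openin_chart_vimage:
  assumes i: "i \<in> midx M" and W: "openin (top_of_set (mmodel M)) W"
  shows "openin (mtop M) {x \<in> mdom M i. mchart M i x \<in> W}"
  unfolding openin_mtop
proof (intro conjI ballI)
  show "{x \<in> mdom M i. mchart M i x \<in> W} \<subseteq> points M" using i by (auto simp: points_def)
  fix j assume j: "j \<in> midx M"
  let ?S = "mchart M j ` (mdom M j \<inter> mdom M i)"
  have "openin (top_of_set ?S) (?S \<inter> (mchart M i \<circ> chart_inv M j) -` W)"
  proof (rule continuous_openin_preimage[OF smooth_on_continuous[OF smooth_transition[OF j i]] _ W])
    show "mchart M i \<circ> chart_inv M j \<in> ?S \<rightarrow> mmodel M"
      using chart_in_model[OF i] chart_inv_chart[OF j] by auto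
  qed
  then have "openin (top_of_set (mmodel M)) (?S \<inter> (mchart M i \<circ> chart_inv M j) -` W)"
    using openin_trans open_overlap[OF j i] by blast
  moreover have "?S \<inter> (mchart M i \<circ> chart_inv M j) -` W = mchart M j ` ({x \<in> mdom M i. mchart M i x \<in> W} \<inter> mdom M j)"
    using chart_inv_chart[OF j] by auto
  ultimately show "openin (top_of_set (mmodel M)) (mchart M j ` ({x \<in> mdom M i. mchart M i x \<in> W} \<inter> mdom M j))"
    by simp
qed

section \<open>Derivatives of transition maps\<close>

lemma transition_has_derivative:
  assumes "i \<in> charts_at M x" "j \<in> charts_at M x"
  shows "((mchart M j \<circ> chart_inv M i) has_derivative transition_deriv M x i j) (at (mchart M i x) within mmodel M)"
proof -
  have ij: "i \<in> midx M" "j \<in> midx M" "mchart M i x \<in> mchart M i ` (mdom M i \<inter> mdom M j)"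
    using assms by (auto simp: charts_at_iff)
  show ?thesis
    using smooth_on_has_derivative[OF smooth_transition[OF ij(1,2)] open_overlap[OF ij(1,2)] ij(3)]
    by (simp add: transition_deriv_def at_within_openin[OF open_overlap[OF ij(1,2)] ij(3)])
qed

lemma transition_deriv_bounded_linear:
  "i \<in> charts_at M x \<Longrightarrow> j \<in> charts_at M x \<Longrightarrow> bounded_linear (transition_deriv M x i j)"
  using has_derivative_bounded_linear[OF transition_has_derivative] .

lemma chart_at_in_model: "i \<in> charts_at M x \<Longrightarrow> mchart M i x \<in> mmodel M"
  using chart_in_model by (auto simp: charts_at_iff)

lemma transition_deriv_eq:
  assumes "i \<in> charts_at M x" "j \<in> charts_at M x" "v \<in> mmodel M"
  shows "transition_deriv M x i j v = deriv_on (mmodel M) (mchart M j \<circ> chart_inv M i) (mchart M i x) v"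
  using deriv_on_eq[OF transition_has_derivative[OF assms(1,2)] subspace_model chart_at_in_model[OF assms(1)] assms(3)]
  by simp

lemma transition_deriv_in_model:
  assumes "i \<in> charts_at M x" "j \<in> charts_at M x" "v \<in> mmodel M"
  shows "transition_deriv M x i j v \<in> mmodel M"
proof -
  have ij: "i \<in> midx M" "j \<in> midx M" "mchart M i x \<in> mchart M i ` (mdom M i \<inter> mdom M j)"
    using assms by (auto simp: charts_at_iff)
  have "(mchart M j \<circ> chart_inv M i) ` (mchart M i ` (mdom M i \<inter> mdom M j)) \<subseteq> mmodel M"
    using chart_in_model[OF ij(2)] chart_inv_chart[OF ij(1)] by auto
  then show ?thesis
    using deriv_on_in_subspace[OF transition_has_derivative[OF assms(1,2)] open_overlap[OF ij(1,2)] ij(3)]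
      subspace_model assms(3) by blast
qed

text \<open>\<open>f\<close> and \<open>g\<close> express the same map in the charts
  \<open>i\<close> and \<open>k\<close>. Both the cocycle rule and the independence of the
  differential from the chart come from this chain rule.\<close>

lemma derivative_change_chart:
  assumes i: "i \<in> charts_at M x" and k: "k \<in> charts_at M x"
    and g: "(g has_derivative g') (at (mchart M k x) within mmodel M)"
    and eq: "\<And>y. y \<in> mdom M i \<inter> mdom M k \<Longrightarrow> f (mchart M i y) = g (mchart M k y)"
  shows "(f has_derivative (\<lambda>v. g' (transition_deriv M x i k v))) (at (mchart M i x) within mmodel M)"
proof -
  have ik: "i \<in> midx M" "k \<in> midx M" "mchart M i x \<in> mchart M i ` (mdom M i \<inter> mdom M k)" "chart_inv M i (mchart M i x) = x"
    using i k chart_inv_chart by (auto simp: charts_at_iff)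
  have "((\<lambda>y. g ((mchart M k \<circ> chart_inv M i) y)) has_derivative (\<lambda>v. g' (transition_deriv M x i k v)))
     (at (mchart M i x) within mmodel M)"
  proof (rule has_derivative_compose_openin[OF transition_has_derivative[OF i k] open_overlap[OF ik(1,2)] ik(3)])
    show "(mchart M k \<circ> chart_inv M i) ` (mchart M i ` (mdom M i \<inter> mdom M k)) \<subseteq> mmodel M"
      using chart_in_model[OF ik(2)] chart_inv_chart[OF ik(1)] by auto
    show "(g has_derivative g') (at ((mchart M k \<circ> chart_inv M i) (mchart M i x)) within mmodel M)"
      using g ik(4) by simp
  qed
  then show ?thesis
    by (rule has_derivative_cong_openin[OF _ open_overlap[OF ik(1,2)] ik(3)])
      (use eq chart_inv_chart[OF ik(1)] in auto)
qed

lemma transition_deriv_trans: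
  assumes "i \<in> charts_at M x" "j \<in> charts_at M x" "k \<in> charts_at M x" "v \<in> mmodel M"
  shows "transition_deriv M x j k (transition_deriv M x i j v) = transition_deriv M x i k v"
proof -
  have "chart_inv M i (mchart M i y) = chart_inv M j (mchart M j y)" if "y \<in> mdom M i \<inter> mdom M j" for y
    using chart_inv_chart assms(1,2) that by (auto simp: charts_at_iff)
  then have "((mchart M k \<circ> chart_inv M i) has_derivative (\<lambda>v. transition_deriv M x j k (transition_deriv M x i j v)))
     (at (mchart M i x) within mmodel M)"
    by (intro derivative_change_chart[OF assms(1,2) transition_has_derivative[OF assms(2,3)]]) auto
  from deriv_on_unique[OF this transition_has_derivative[OF assms(1,3)] subspace_model chart_at_in_model[OF assms(1)] assms(4)]
  show ?thesis .
qed

lemma transition_deriv_self: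
  assumes "i \<in> charts_at M x" "v \<in> mmodel M"
  shows "transition_deriv M x i i v = v"
proof -
  have i: "i \<in> midx M" "x \<in> mdom M i" using assms by (auto simp: charts_at_iff)
  have "((mchart M i \<circ> chart_inv M i) has_derivative (\<lambda>v. v)) (at (mchart M i x) within mmodel M)"
    by (rule has_derivative_cong_openin[OF has_derivative_ident openin_image[OF i(1)]])
      (use i chart_chart_inv in \<open>auto simp: chart_inv_chart\<close>)
  from deriv_on_unique[OF transition_has_derivative[OF assms(1,1)] this subspace_model chart_at_in_model[OF assms(1)] assms(2)]
  show ?thesis .
qed

section \<open>Tangent spaces, differentials and tangent curves\<close>

text \<open>Transport to the other charts by the transition derivatives is consistent by the cocycle
  rule, so the coordinates in one chart can be prescribed freely; by
  \<open>tangent_space_eqI\<close> they also determine the vector.\<close>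

lemma tangent_vector_exists:
  assumes "i \<in> charts_at M x" "v \<in> mmodel M"
  obtains u where "u \<in> tangent_space M x" "u i = v"
proof (rule that)
  let ?u = "\<lambda>j. if j \<in> charts_at M x then transition_deriv M x i j v else 0"
  show "?u \<in> tangent_space M x"
    unfolding tangent_space_iff using assms transition_deriv_in_model transition_deriv_trans by auto
  show "?u i = v" using assms transition_deriv_self by simp
qed

lemma tangent_space_eqI:
  assumes "u \<in> tangent_space M x" "v \<in> tangent_space M x" "i \<in> charts_at M x" "u i = v i"
  shows "u = v"
proof
  fix j show "u j = v j"
  proof (cases "j \<in> charts_at M x")
    case True
    show ?thesis
      using tangent_space_transition[OF assms(1,3) True] tangent_space_transition[OF assms(2,3) True] assms(4) by simp
  next
    case False
    then show ?thesis using assms(1,2) unfolding tangent_space_iff by simp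
  qed
qed

lemma tangent_space_add:
  assumes "u \<in> tangent_space M x" "v \<in> tangent_space M x"
  shows "(\<lambda>i. u i + v i) \<in> tangent_space M x"
  unfolding tangent_space_iff
proof (intro conjI allI impI ballI)
  fix i j assume ij: "i \<in> charts_at M x" "j \<in> charts_at M x"
  show "u j + v j = transition_deriv M x i j (u i + v i)"
    using linear_simps(1)[OF transition_deriv_bounded_linear[OF ij], of "u i" "v i"]
    by (simp only: tangent_space_transition[OF assms(1) ij] tangent_space_transition[OF assms(2) ij])
next
  fix i assume i: "i \<in> charts_at M x"
  show "u i + v i \<in> mmodel M"
    using tangent_space_in_model[OF assms(1) i] tangent_space_in_model[OF assms(2) i] by (rule subspace_add[OF subspace_model])
next
  fix i assume "i \<notin> charts_at M x"
  then show "u i + v i = 0" using assms unfolding tangent_space_iff by simp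
qed

text \<open>\<open>differential\<close> picks its chart at \<open>x\<close> by \<open>SOME\<close>;
  here it is replaced by any convenient one. The openness condition makes the derivative within the
  domain of \<open>f\<close> in the chart agree with the one within the model space.\<close>

lemma differential_eq:
  fixes N :: "('j, 'b, 'f::euclidean_space) manifold"
  assumes v: "v \<in> tangent_space M x" and i: "i \<in> charts_at M x" and j: "j \<in> charts_at N (f x)"
    and opn: "openin (mtop M) {y \<in> points M. f y \<in> mdom N j}"
    and D: "((\<lambda>y. mchart N j (f (chart_inv M i y))) has_derivative D) (at (mchart M i x) within mmodel M)"
  shows "differential M N f x v j = D (v i)"
proof -
  define k where "k = (SOME k. k \<in> charts_at M x)"
  have k: "k \<in> charts_at M x" unfolding k_def using i by (rule someI)
  have k': "k \<in> midx M" "x \<in> mdom M k" using k by (auto simp: charts_at_iff)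
  let ?T = "mchart M k ` (mdom M k \<inter> f -` mdom N j)"
  have "mdom M k \<inter> f -` mdom N j = {y \<in> points M. f y \<in> mdom N j} \<inter> mdom M k"
    using k' by (auto simp: points_def)
  then have T: "openin (top_of_set (mmodel M)) ?T" using opn k' unfolding openin_mtop by simp
  have xT: "mchart M k x \<in> ?T" using k' j by (auto simp: charts_at_iff)
  have "((mchart N j \<circ> f \<circ> chart_inv M k) has_derivative (\<lambda>v. D (transition_deriv M x k i v)))
     (at (mchart M k x) within mmodel M)"
    by (rule derivative_change_chart[OF k i D]) (use k i chart_inv_chart in \<open>auto simp: charts_at_iff\<close>)
  from deriv_on_eq[OF this subspace_model chart_at_in_model[OF k] tangent_space_in_model[OF v k]]
  have "deriv_on (mmodel M) (mchart N j \<circ> f \<circ> chart_inv M k) (mchart M k x) (v k) = D (v i)"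
    unfolding tangent_space_transition[OF v k i] .
  then show ?thesis
    using j unfolding differential_def k_def[symmetric] by (simp add: Let_def at_within_openin[OF T xT])
qed

text \<open>The curve in the definition of \<open>tangent_sub\<close> lives in some chart of its own
  choice. Shortening the time brings it into a prescribed chart, where the transition derivative
  gives the velocity.\<close>

lemma tangent_sub_curve:
  assumes v: "v \<in> tangent_sub M S x" and i: "i \<in> charts_at M x"
  obtains c and d :: real where "d > 0" "c 0 = x" "\<And>s. \<bar>s\<bar> < d \<Longrightarrow> c s \<in> S" "\<And>s. \<bar>s\<bar> < d \<Longrightarrow> c s \<in> mdom M i"
    "((\<lambda>s. mchart M i (c s)) has_vector_derivative v i) (at 0)"
proof -
  obtain j c e where j: "j \<in> charts_at M x" and c: "(e::real) > 0" "c 0 = x" "c ` {-e<..<e} \<subseteq> S \<inter> mdom M j"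
    "smooth_on UNIV {-e<..<e} (mchart M j \<circ> c)" "((mchart M j \<circ> c) has_vector_derivative v j) (at 0)"
    using v unfolding tangent_sub_def by blast
  have vT: "v \<in> tangent_space M x" using v by (simp add: tangent_sub_def)
  have ij: "i \<in> midx M" "j \<in> midx M" "x \<in> mdom M i" "x \<in> mdom M j" using i j by (auto simp: charts_at_iff)
  let ?O = "mchart M j ` (mdom M j \<inter> mdom M i)"
  have cj: "c s \<in> S" "c s \<in> mdom M j" if "s \<in> {-e<..<e}" for s using c(3) that by auto
  have "openin (top_of_set {-e<..<e}) ({-e<..<e} \<inter> (mchart M j \<circ> c) -` ?O)"
    by (rule continuous_openin_preimage[OF smooth_on_continuous[OF c(4)] _ open_overlap[OF ij(2,1)]])
      (use cj chart_in_model[OF ij(2)] in auto)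
  then have "open ({-e<..<e} \<inter> (mchart M j \<circ> c) -` ?O)"
    using open_greaterThanLessThan by (rule openin_open_trans)
  moreover have "0 \<in> {-e<..<e} \<inter> (mchart M j \<circ> c) -` ?O" using c(1,2) ij by auto
  ultimately obtain d where d: "d > 0" "ball 0 d \<subseteq> {-e<..<e} \<inter> (mchart M j \<circ> c) -` ?O"
    using open_contains_ball by metis
  have in_e: "s \<in> {-e<..<e}" and in_O: "mchart M j (c s) \<in> ?O" if "\<bar>s\<bar> < d" for s
  proof -
    have "s \<in> ball 0 d" using that by simp
    with d(2) have "s \<in> {-e<..<e} \<inter> (mchart M j \<circ> c) -` ?O" by blast
    then show "s \<in> {-e<..<e}" "mchart M j (c s) \<in> ?O" by auto
  qed
  have ci: "c s \<in> mdom M i" if s: "\<bar>s\<bar> < d" for s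
  proof -
    obtain y where "y \<in> mdom M j" "y \<in> mdom M i" "mchart M j (c s) = mchart M j y" using in_O[OF s] by blast
    then show ?thesis using inj_onD[OF inj_chart[OF ij(2)], of "c s" y] cj(2)[OF in_e[OF s]] by simp
  qed
  have "((\<lambda>s. (mchart M i \<circ> chart_inv M j) ((mchart M j \<circ> c) s)) has_vector_derivative transition_deriv M x j i (v j)) (at 0)"
  proof (rule has_vector_derivative_compose_deriv[OF c(5), where I = "{-e<..<e}" and T = "mmodel M"])
    show "(mchart M j \<circ> c) ` {-e<..<e} \<subseteq> mmodel M" using cj(2) chart_in_model[OF ij(2)] by auto
    show "((mchart M i \<circ> chart_inv M j) has_derivative transition_deriv M x j i) (at ((mchart M j \<circ> c) 0) within mmodel M)"
      using transition_has_derivative[OF j i] c(2) by simp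
  qed (use c(1) in auto)
  then have "((\<lambda>s. (mchart M i \<circ> chart_inv M j) ((mchart M j \<circ> c) s)) has_vector_derivative v i) (at 0)"
    unfolding tangent_space_transition[OF vT j i] .
  then have "((\<lambda>s. mchart M i (c s)) has_vector_derivative v i) (at 0)"
    by (rule has_vector_derivative_transform_within_open[where S = "ball 0 d"])
      (use d(1) cj(2) in_e chart_inv_chart[OF ij(2)] in auto)
  then show thesis using that[of d c] d(1) c(2) cj(1) in_e ci by blast
qed

lemma tangent_subI:
  assumes v: "v \<in> tangent_space M x" and i: "i \<in> charts_at M x" and "e > 0" and \<xi>0: "\<xi> 0 = mchart M i x"
    and \<xi>: "\<And>s. s \<in> {-e<..<e} \<Longrightarrow> \<xi> s \<in> mchart M i ` mdom M i"
      "\<And>s. s \<in> {-e<..<e} \<Longrightarrow> chart_inv M i (\<xi> s) \<in> S"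
    and sm: "smooth_on UNIV {-e<..<e} \<xi>" and d: "(\<xi> has_vector_derivative v i) (at (0::real))"
  shows "v \<in> tangent_sub M S x"
  unfolding tangent_sub_def mem_Collect_eq
proof (intro conjI bexI exI)
  let ?c = "\<lambda>s. chart_inv M i (\<xi> s)"
  show "v \<in> tangent_space M x" "i \<in> charts_at M x" "e > 0" by fact+
  show "?c 0 = x" using i \<xi>0 chart_inv_chart by (auto simp: charts_at_iff)
  show "?c ` {-e<..<e} \<subseteq> S \<inter> mdom M i" using \<xi>(2) chart_inv_in_mdom[OF \<xi>(1)] by blast
  have eq: "\<xi> s = (mchart M i \<circ> ?c) s" if "s \<in> {-e<..<e}" for s
    using chart_chart_inv[OF \<xi>(1)[OF that]] by simp
  show "smooth_on UNIV {-e<..<e} (mchart M i \<circ> ?c)" by (rule smooth_on_cong[OF sm eq])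
  show "((mchart M i \<circ> ?c) has_vector_derivative v i) (at 0)"
    by (rule has_vector_derivative_transform_within_open[OF d open_greaterThanLessThan _ eq]) (use \<open>e > 0\<close> in auto)
qed

end

section \<open>Products and cotangent bundles\<close>

text \<open>
  The Riesz representative of a linear form on \<open>L\<close>, written as a sum so that its smooth dependence
  on the form is visible.
\<close>

definition riesz :: "'e::euclidean_space set \<Rightarrow> ('e \<Rightarrow> real) \<Rightarrow> 'e" where
  "riesz L f = (let P = (SOME P. bounded_linear P \<and> (\<forall>x. P x \<in> L) \<and> (\<forall>x\<in>L. P x = x) \<and> (\<forall>x y. P x \<bullet> y = x \<bullet> P y))
     in \<Sum>b\<in>Basis. f (P b) *\<^sub>R P b)"

text \<open>One projection serves all forms \<open>f\<close>, so the representative depends on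
  \<open>f\<close> only through its values at fixed vectors.\<close>

lemma riesz_projection:
  assumes "subspace (L :: 'e::euclidean_space set)"
  obtains P where "bounded_linear P" "\<And>x. P x \<in> L" "\<And>x. x \<in> L \<Longrightarrow> P x = x" "\<And>x y. P x \<bullet> y = x \<bullet> P y"
    "\<And>f. riesz L f = (\<Sum>b\<in>Basis. f (P b) *\<^sub>R P b)"
proof -
  let ?R = "\<lambda>P. bounded_linear P \<and> (\<forall>x. P x \<in> L) \<and> (\<forall>x\<in>L. P x = x) \<and> (\<forall>x y. P x \<bullet> y = x \<bullet> P y)"
  have "\<exists>P. ?R P" using orthogonal_projection_exists[OF assms] by metis
  then have "?R (SOME P. ?R P)" by (rule someI_ex)
  then show thesis using that[of "SOME P. ?R P"] unfolding riesz_def Let_def by blast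
qed

lemma riesz_in: "subspace L \<Longrightarrow> riesz L f \<in> L"
  by (rule riesz_projection[of L]) (auto intro!: subspace_sum subspace_mul)

lemma riesz_inner:
  assumes "subspace L" "bounded_linear f" "v \<in> L"
  shows "riesz L f \<bullet> v = f v"
proof -
  obtain P where P: "bounded_linear P" "\<And>x. x \<in> L \<Longrightarrow> P x = x" "\<And>x y. P x \<bullet> y = x \<bullet> P y"
    "\<And>f. riesz L f = (\<Sum>b\<in>Basis. f (P b) *\<^sub>R P b)" using riesz_projection[OF assms(1)] by metis
  have "riesz L f \<bullet> v = (\<Sum>b\<in>Basis. (v \<bullet> b) *\<^sub>R f (P b))"
    unfolding P(4) inner_sum_left inner_scaleR_left P(3) P(2)[OF assms(3)]
    by (simp add: inner_commute mult.commute)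
  also have "\<dots> = f (P v)"
    by (rule euclidean_expand[OF bounded_linear_compose[OF assms(2) P(1)], symmetric])
  finally show ?thesis using P(2)[OF assms(3)] by simp
qed

lemma smooth_on_riesz:
  fixes L :: "'e::euclidean_space set"
  assumes "subspace L" "\<And>v. v \<in> L \<Longrightarrow> smooth_on K S (\<lambda>x. f x v)"
  shows "smooth_on K S (\<lambda>x. riesz L (f x))"
proof -
  obtain P :: "'e \<Rightarrow> 'e" where P: "\<And>x. P x \<in> L" "\<And>f. riesz L f = (\<Sum>b\<in>Basis. f (P b) *\<^sub>R P b)"
    using riesz_projection[OF assms(1)] by metis
  have "smooth_on K S (\<lambda>x. \<Sum>b\<in>Basis. f x (P b) *\<^sub>R P b)"
    by (intro smooth_on_sum smooth_on_linear_compose[OF bounded_linear_scaleR_left] assms(2) P(1))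
  then show ?thesis unfolding P(2) .
qed

lemma inner_eq_on_subspace:
  assumes "subspace L" "p \<in> L" "q \<in> L" "\<And>v. v \<in> L \<Longrightarrow> p \<bullet> v = q \<bullet> v"
  shows "p = q"
proof -
  have "(p - q) \<bullet> (p - q) = 0"
    using assms(4)[OF subspace_diff[OF assms(1-3)]] by (simp add: inner_diff_left)
  then show ?thesis by simp
qed

subsection \<open>Products\<close>

lemma prod_manifold_simps [simp]:
  "midx (prod_manifold M N) = midx M \<times> midx N"
  "mdom (prod_manifold M N) (i, j) = mdom M i \<times> mdom N j"
  "mchart (prod_manifold M N) (i, j) (x, y) = (mchart M i x, mchart N j y)"
  "mmodel (prod_manifold M N) = mmodel M \<times> mmodel N"
  by (simp_all add: prod_manifold_def)

lemma charts_at_prod [simp]: "(i, j) \<in> charts_at (prod_manifold M N) (x, y) \<longleftrightarrow> i \<in> charts_at M x \<and> j \<in> charts_at N y"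
  by (auto simp: charts_at_iff)

lemma points_prod: "points (prod_manifold M N) = points M \<times> points N"
  by (auto simp: points_def prod_manifold_def)

locale two_atlases = M: smooth_atlas M + N: smooth_atlas N
  for M :: "('i, 'a, 'e::euclidean_space) manifold" and N :: "('j, 'b, 'f::euclidean_space) manifold"
begin

lemma inj_prod_chart: "ij \<in> midx (prod_manifold M N) \<Longrightarrow> inj_on (mchart (prod_manifold M N) ij) (mdom (prod_manifold M N) ij)"
  using M.inj_chart N.inj_chart by (cases ij) (auto simp: inj_on_def)

lemma prod_chart_image:
  "mchart (prod_manifold M N) (i, j) ` (A \<times> B) = mchart M i ` A \<times> mchart N j ` B"
  by (auto simp: image_def)

lemma prod_chart_inv:
  assumes "i \<in> midx M" "j \<in> midx N" "a \<in> mchart M i ` mdom M i" "b \<in> mchart N j ` mdom N j"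
  shows "chart_inv (prod_manifold M N) (i, j) (a, b) = (chart_inv M i a, chart_inv N j b)"
  unfolding chart_inv_def[of "prod_manifold M N"]
proof (rule inv_into_f_eq[OF inj_prod_chart])
  show "(chart_inv M i a, chart_inv N j b) \<in> mdom (prod_manifold M N) (i, j)"
    using assms by (simp add: chart_inv_in_mdom)
qed (use assms in \<open>simp_all add: chart_chart_inv\<close>)

lemma prod_transition_smooth:
  assumes "i \<in> midx M" "j \<in> midx N" "k \<in> midx M" "l \<in> midx N"
  shows "smooth_on (mmodel M \<times> mmodel N) (mchart M i ` (mdom M i \<inter> mdom M k) \<times> mchart N j ` (mdom N j \<inter> mdom N l))
     (\<lambda>z. ((mchart M k \<circ> chart_inv M i) (fst z), (mchart N l \<circ> chart_inv N j) (snd z)))"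
    (is "smooth_on _ (?A \<times> ?B) _")
proof -
  have "?A \<subseteq> mmodel M" "?B \<subseteq> mmodel N"
    using M.open_overlap[OF assms(1,3)] N.open_overlap[OF assms(2,4)] openin_imp_subset by blast+
  then show ?thesis
    by (intro smooth_on_Pair smooth_on_compose[OF _ M.smooth_transition[OF assms(1,3)] _ _ M.subspace_model]
      smooth_on_compose[OF _ N.smooth_transition[OF assms(2,4)] _ _ N.subspace_model]
      smooth_on_bounded_linear bounded_linear_fst bounded_linear_snd) auto
qed

sublocale prod: smooth_atlas "prod_manifold M N"
proof
  show "subspace (mmodel (prod_manifold M N))"
    using subspace_Times[OF M.subspace_model N.subspace_model] by simp
  fix ij assume ij: "ij \<in> midx (prod_manifold M N)"
  then show "inj_on (mchart (prod_manifold M N) ij) (mdom (prod_manifold M N) ij)" by (rule inj_prod_chart)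
  fix kl assume kl: "kl \<in> midx (prod_manifold M N)"
  obtain i j k l where eq: "ij = (i, j)" "kl = (k, l)" by fastforce
  have idx: "i \<in> midx M" "j \<in> midx N" "k \<in> midx M" "l \<in> midx N" using ij kl eq by auto
  have img: "mchart (prod_manifold M N) ij ` (mdom (prod_manifold M N) ij \<inter> mdom (prod_manifold M N) kl) =
    mchart M i ` (mdom M i \<inter> mdom M k) \<times> mchart N j ` (mdom N j \<inter> mdom N l)"
    unfolding eq prod_manifold_simps Times_Int_Times prod_chart_image ..
  show "openin (top_of_set (mmodel (prod_manifold M N)))
     (mchart (prod_manifold M N) ij ` (mdom (prod_manifold M N) ij \<inter> mdom (prod_manifold M N) kl))"
    unfolding img using openin_Times[OF M.open_overlap[OF idx(1,3)] N.open_overlap[OF idx(2,4)]] by simp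
  show "smooth_on (mmodel (prod_manifold M N))
     (mchart (prod_manifold M N) ij ` (mdom (prod_manifold M N) ij \<inter> mdom (prod_manifold M N) kl))
     (mchart (prod_manifold M N) kl \<circ> chart_inv (prod_manifold M N) ij)"
    unfolding img prod_manifold_simps
  proof (rule smooth_on_cong[OF prod_transition_smooth[OF idx]])
    fix z assume z: "z \<in> mchart M i ` (mdom M i \<inter> mdom M k) \<times> mchart N j ` (mdom N j \<inter> mdom N l)"
    then have "fst z \<in> mchart M i ` mdom M i" "snd z \<in> mchart N j ` mdom N j" by auto
    from prod_chart_inv[OF idx(1,2) this]
    show "((mchart M k \<circ> chart_inv M i) (fst z), (mchart N l \<circ> chart_inv N j) (snd z)) =
        (mchart (prod_manifold M N) kl \<circ> chart_inv (prod_manifold M N) ij) z"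
      by (simp add: eq)
  qed
qed

lemma prod_transition_deriv:
  assumes "i \<in> charts_at M x" "k \<in> charts_at M x" "j \<in> charts_at N y" "l \<in> charts_at N y"
    "u \<in> mmodel M" "v \<in> mmodel N"
  shows "transition_deriv (prod_manifold M N) (x, y) (i, j) (k, l) (u, v) =
    (transition_deriv M x i k u, transition_deriv N y j l v)"
proof -
  have idx: "i \<in> midx M" "j \<in> midx N" "k \<in> midx M" "l \<in> midx N" "x \<in> mdom M i" "x \<in> mdom M k" "y \<in> mdom N j" "y \<in> mdom N l"
    using assms by (auto simp: charts_at_iff)
  let ?L = "mmodel M \<times> mmodel N"
  let ?S = "mchart M i ` (mdom M i \<inter> mdom M k) \<times> mchart N j ` (mdom N j \<inter> mdom N l)"
  have S: "openin (top_of_set ?L) ?S" by (rule openin_Times[OF M.open_overlap[OF idx(1,3)] N.open_overlap[OF idx(2,4)]])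
  have xy: "(mchart M i x, mchart N j y) \<in> ?S" using idx by auto
  have sub: "?S \<subseteq> ?L" using S by (rule openin_imp_subset)
  have 1: "((\<lambda>z. (mchart M k \<circ> chart_inv M i) (fst z)) has_derivative (\<lambda>z. transition_deriv M x i k (fst z)))
      (at (mchart M i x, mchart N j y) within ?L)"
  proof (rule has_derivative_compose_openin[OF bounded_linear_imp_has_derivative[OF bounded_linear_fst] S xy])
    show "fst ` ?S \<subseteq> mmodel M" using sub by auto
    show "((mchart M k \<circ> chart_inv M i) has_derivative transition_deriv M x i k) (at (fst (mchart M i x, mchart N j y)) within mmodel M)"
      unfolding prod.sel by (rule M.transition_has_derivative[OF assms(1,2)])
  qed
  have 2: "((\<lambda>z. (mchart N l \<circ> chart_inv N j) (snd z)) has_derivative (\<lambda>z. transition_deriv N y j l (snd z)))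
      (at (mchart M i x, mchart N j y) within ?L)"
  proof (rule has_derivative_compose_openin[OF bounded_linear_imp_has_derivative[OF bounded_linear_snd] S xy])
    show "snd ` ?S \<subseteq> mmodel N" using sub by auto
    show "((mchart N l \<circ> chart_inv N j) has_derivative transition_deriv N y j l) (at (snd (mchart M i x, mchart N j y)) within mmodel N)"
      unfolding prod.sel by (rule N.transition_has_derivative[OF assms(3,4)])
  qed
  have "((mchart (prod_manifold M N) (k, l) \<circ> chart_inv (prod_manifold M N) (i, j)) has_derivative
      (\<lambda>z. (transition_deriv M x i k (fst z), transition_deriv N y j l (snd z)))) (at (mchart M i x, mchart N j y) within ?L)"
  proof (rule has_derivative_cong_openin[OF has_derivative_Pair[OF 1 2] S xy])
    fix z assume "z \<in> ?S"
    then have "fst z \<in> mchart M i ` mdom M i" "snd z \<in> mchart N j ` mdom N j" by auto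
    from prod_chart_inv[OF idx(1,2) this]
    show "((mchart M k \<circ> chart_inv M i) (fst z), (mchart N l \<circ> chart_inv N j) (snd z)) =
        (mchart (prod_manifold M N) (k, l) \<circ> chart_inv (prod_manifold M N) (i, j)) z"
      by simp
  qed
  from deriv_on_unique[OF prod.transition_has_derivative[of "(i, j)" "(x, y)" "(k, l)", simplified, OF _ _] this, of "(u, v)"]
  show ?thesis using assms sub xy prod.subspace_model by auto
qed

lemma openin_prod_rect:
  assumes "openin (mtop M) U" "openin (mtop N) V"
  shows "openin (mtop (prod_manifold M N)) (U \<times> V)"
  unfolding prod.openin_mtop
proof (intro conjI ballI)
  show "U \<times> V \<subseteq> points (prod_manifold M N)"
    using assms unfolding M.openin_mtop N.openin_mtop points_prod by blast
  fix ij assume "ij \<in> midx (prod_manifold M N)"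
  then obtain i j where ij: "ij = (i, j)" "i \<in> midx M" "j \<in> midx N" by auto
  have "openin (top_of_set (mmodel M \<times> mmodel N)) (mchart M i ` (U \<inter> mdom M i) \<times> mchart N j ` (V \<inter> mdom N j))"
    using assms ij unfolding M.openin_mtop N.openin_mtop by (intro openin_Times) auto
  then show "openin (top_of_set (mmodel (prod_manifold M N))) (mchart (prod_manifold M N) ij ` (U \<times> V \<inter> mdom (prod_manifold M N) ij))"
    unfolding ij prod_manifold_simps Times_Int_Times prod_chart_image .
qed

text \<open>Inheritance from the factors goes through this identification: separation, countability,
  closedness of the product of zero sections and continuity of the core map.\<close>

lemma mtop_prod: "mtop (prod_manifold M N) = prod_topology (mtop M) (mtop N)"
  unfolding topology_eq
proof (intro allI iffI)
  fix U assume U: "openin (prod_topology (mtop M) (mtop N)) U"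
  show "openin (mtop (prod_manifold M N)) U"
  proof (subst openin_subopen, intro ballI)
    fix z assume "z \<in> U"
    then obtain A B where "openin (mtop M) A" "openin (mtop N) B" "z \<in> A \<times> B" "A \<times> B \<subseteq> U"
      using U unfolding openin_prod_topology_alt by (metis SigmaI surj_pair)
    then show "\<exists>T. openin (mtop (prod_manifold M N)) T \<and> z \<in> T \<and> T \<subseteq> U" using openin_prod_rect by blast
  qed
next
  fix U assume U: "openin (mtop (prod_manifold M N)) U"
  show "openin (prod_topology (mtop M) (mtop N)) U"
    unfolding openin_prod_topology_alt
  proof (intro allI impI)
    fix x y assume xy: "(x, y) \<in> U"
    have "(x, y) \<in> points M \<times> points N" using U xy unfolding prod.openin_mtop points_prod by blast
    then obtain i j where ij: "i \<in> midx M" "j \<in> midx N" "x \<in> mdom M i" "y \<in> mdom N j"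
      by (auto simp: points_def)
    let ?W = "mchart (prod_manifold M N) (i, j) ` (U \<inter> mdom (prod_manifold M N) (i, j))"
    have "openin (top_of_set (mmodel M \<times> mmodel N)) ?W"
      using U ij unfolding prod.openin_mtop by auto
    \<comment> \<open>The image of \<open>U\<close> in the product chart is open, so it contains a
      rectangle around the point, whose sides are pulled back through the charts of the
      factors.\<close>
    then obtain T where T: "open T" "?W = (mmodel M \<times> mmodel N) \<inter> T" by (auto simp: openin_open)
    have "mchart (prod_manifold M N) (i, j) (x, y) \<in> ?W" using xy ij by (intro imageI) auto
    then have "(mchart M i x, mchart N j y) \<in> T" using T(2) by auto
    then obtain A B where AB: "open A" "open B" "mchart M i x \<in> A" "mchart N j y \<in> B" "A \<times> B \<subseteq> T"
      using T(1) open_prod_elim by (metis SigmaD1 SigmaD2)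
    let ?A = "{x \<in> mdom M i. mchart M i x \<in> mmodel M \<inter> A}" and ?B = "{y \<in> mdom N j. mchart N j y \<in> mmodel N \<inter> B}"
    have "openin (mtop M) ?A" "openin (mtop N) ?B"
      using M.openin_chart_vimage[OF ij(1) openin_open_Int[OF AB(1)]] N.openin_chart_vimage[OF ij(2) openin_open_Int[OF AB(2)]]
      by blast+
    moreover have "x \<in> ?A" "y \<in> ?B" using ij AB M.chart_in_model N.chart_in_model by auto
    moreover have "?A \<times> ?B \<subseteq> U"
    proof
      fix z assume z: "z \<in> ?A \<times> ?B"
      then have "mchart (prod_manifold M N) (i, j) z \<in> ?W" using T(2) AB(5) by auto
      then obtain w where w: "w \<in> U" "w \<in> mdom (prod_manifold M N) (i, j)"
        "mchart (prod_manifold M N) (i, j) z = mchart (prod_manifold M N) (i, j) w" by blast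
      have "z = w" using inj_onD[OF prod.inj_chart[of "(i, j)"] w(3) _ w(2)] z ij by auto
      then show "z \<in> U" using w(1) by simp
    qed
    ultimately show "\<exists>A B. openin (mtop M) A \<and> openin (mtop N) B \<and> x \<in> A \<and> y \<in> B \<and> A \<times> B \<subseteq> U" by blast
  qed
qed

end

section \<open>Manifold structure of products and of the real line\<close>

lemma second_countable_prod_topology:
  assumes "second_countable X" "second_countable Y"
  shows "second_countable (prod_topology X Y)"
proof -
  obtain \<B> where \<B>: "countable \<B>" "\<And>V. V \<in> \<B> \<Longrightarrow> openin X V"
    "\<And>U x. openin X U \<Longrightarrow> x \<in> U \<Longrightarrow> \<exists>V\<in>\<B>. x \<in> V \<and> V \<subseteq> U"
    using assms(1) unfolding second_countable_def by metis
  obtain \<C> where \<C>: "countable \<C>" "\<And>V. V \<in> \<C> \<Longrightarrow> openin Y V"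
    "\<And>U x. openin Y U \<Longrightarrow> x \<in> U \<Longrightarrow> \<exists>V\<in>\<C>. x \<in> V \<and> V \<subseteq> U"
    using assms(2) unfolding second_countable_def by metis
  show ?thesis
    unfolding second_countable_def
  proof (intro exI conjI ballI allI impI)
    show "countable ((\<lambda>(A, B). A \<times> B) ` (\<B> \<times> \<C>))" using \<B>(1) \<C>(1) by auto
    show "openin (prod_topology X Y) V" if "V \<in> (\<lambda>(A, B). A \<times> B) ` (\<B> \<times> \<C>)" for V
      using that \<B>(2) \<C>(2) by (auto simp: openin_prod_Times_iff)
    fix U z assume *: "openin (prod_topology X Y) U \<and> z \<in> U"
    obtain x y where z: "z = (x, y)" by fastforce
    obtain A B where AB: "openin X A" "openin Y B" "x \<in> A" "y \<in> B" "A \<times> B \<subseteq> U"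
      using * unfolding openin_prod_topology_alt z by blast
    obtain V W where "V \<in> \<B>" "x \<in> V" "V \<subseteq> A" "W \<in> \<C>" "y \<in> W" "W \<subseteq> B"
      using \<B>(3)[OF AB(1,3)] \<C>(3)[OF AB(2,4)] by blast
    then show "\<exists>V\<in>(\<lambda>(A, B). A \<times> B) ` (\<B> \<times> \<C>). z \<in> V \<and> V \<subseteq> U"
      using AB(5) z by (intro bexI[of _ "V \<times> W"]) auto
  qed
qed

lemma smooth_manifold_prod:
  assumes "smooth_manifold M" "smooth_manifold N"
  shows "smooth_manifold (prod_manifold M N)"
proof -
  interpret two_atlases M N
    by (intro two_atlases.intro smooth_manifold_atlas assms)
  have "Hausdorff_space (mtop M)" "Hausdorff_space (mtop N)" "second_countable (mtop M)" "second_countable (mtop N)"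
    using assms unfolding smooth_manifold_def by blast+
  then have "Hausdorff_space (mtop (prod_manifold M N))" "second_countable (mtop (prod_manifold M N))"
    unfolding mtop_prod by (simp_all add: Hausdorff_space_prod_topology second_countable_prod_topology)
  then show ?thesis
    unfolding smooth_manifold_def
    by (intro conjI ballI prod.subspace_model prod.inj_chart prod.open_overlap prod.smooth_transition)
qed

lemma real_manifold_simps [simp]:
  "midx real_manifold = UNIV" "mdom real_manifold i = UNIV" "mchart real_manifold = (\<lambda>_ x. x)"
  "mmodel real_manifold = UNIV" "points real_manifold = UNIV" "charts_at real_manifold x = UNIV"
  "chart_inv real_manifold i x = x"
  by (auto simp: real_manifold_def points_def charts_at_def chart_inv_def intro: inv_into_f_eq)

lemma smooth_atlas_real: "smooth_atlas real_manifold"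
  by unfold_locales (auto intro: smooth_on_cong[OF smooth_on_bounded_linear[OF bounded_linear_ident]])

lemma mtop_real: "mtop real_manifold = euclidean"
  unfolding topology_eq smooth_atlas.openin_mtop[OF smooth_atlas_real] by auto

lemma smooth_manifold_real: "smooth_manifold real_manifold"
proof -
  interpret smooth_atlas real_manifold by (rule smooth_atlas_real)
  have "second_countable (euclidean :: real topology)"
    unfolding second_countable_def
  proof (rule univ_second_countable[where 'a = real], intro exI conjI allI impI ballI)
    fix \<B> :: "real set set" and U :: "real set" and x
    assume \<B>: "\<And>S :: real set. open S \<Longrightarrow> \<exists>U. U \<subseteq> \<B> \<and> S = \<Union>U" and U: "openin euclidean U \<and> x \<in> U"
    then obtain V where "V \<subseteq> \<B>" "U = \<Union>V" by auto
    then show "\<exists>V\<in>\<B>. x \<in> V \<and> V \<subseteq> U" using U by blast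
  qed auto
  then show ?thesis
    unfolding smooth_manifold_def mtop_real
    by (intro conjI ballI subspace_model inj_chart open_overlap smooth_transition) auto
qed

subsection \<open>Cotangent bundles\<close>

lemma cotangent_simps [simp]:
  "midx (cotangent M) = midx M"
  "mdom (cotangent M) i = {(p, q). q \<in> mdom M i \<and> p \<in> cotangent_space M q}"
  "mchart (cotangent M) i (p, q) = (p i, mchart M i q)"
  "mmodel (cotangent M) = mmodel M \<times> mmodel M"
  by (simp_all add: cotangent_def)

lemma charts_at_cotangent [simp]:
  "i \<in> charts_at (cotangent M) (p, q) \<longleftrightarrow> i \<in> charts_at M q \<and> p \<in> cotangent_space M q"
  by (auto simp: charts_at_iff)

lemma points_cotangent: "(p, q) \<in> points (cotangent M) \<longleftrightarrow> q \<in> points M \<and> p \<in> cotangent_space M q"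
  by (auto simp: points_iff)

lemma cotangent_space_in_model: "p \<in> cotangent_space M x \<Longrightarrow> i \<in> charts_at M x \<Longrightarrow> p i \<in> mmodel M"
  by (auto simp: cotangent_space_def)

lemma cotangent_space_transition:
  "p \<in> cotangent_space M x \<Longrightarrow> i \<in> charts_at M x \<Longrightarrow> j \<in> charts_at M x \<Longrightarrow> v \<in> mmodel M \<Longrightarrow>
     p j \<bullet> transition_deriv M x i j v = p i \<bullet> v"
  unfolding cotangent_space_def mem_Collect_eq by metis

lemma cotangent_space_in_model': "p \<in> cotangent_space M x \<Longrightarrow> i \<in> midx M \<Longrightarrow> x \<in> mdom M i \<Longrightarrow> p i \<in> mmodel M"
  using cotangent_space_in_model charts_at_iff by metis

text \<open>Inverse of the fibre coordinate of the cotangent chart \<open>i\<close>: for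
  \<open>p\<close> in the model space, the covector at \<open>x\<close> whose component there is
  \<open>p\<close>. The other components are pulled back along the transition from \<open>j\<close>
  to \<open>i\<close>.\<close>

definition covector_of :: "('i, 'a, 'e::euclidean_space) manifold \<Rightarrow> 'a \<Rightarrow> 'i \<Rightarrow> 'e \<Rightarrow> 'i \<Rightarrow> 'e" where
  "covector_of M x i p = (\<lambda>j. if j \<in> charts_at M x
     then riesz (mmodel M) (\<lambda>v. p \<bullet> transition_deriv M x j i v) else 0)"

context smooth_atlas
begin

lemma cotangent_space_eqI:
  assumes "p \<in> cotangent_space M x" "p' \<in> cotangent_space M x" "i \<in> charts_at M x" "p i = p' i"
  shows "p = p'"
proof
  fix j show "p j = p' j"
  proof (cases "j \<in> charts_at M x")
    case True
    show ?thesis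
    proof (rule inner_eq_on_subspace[OF subspace_model])
      fix v assume v: "v \<in> mmodel M"
      show "p j \<bullet> v = p' j \<bullet> v"
        using cotangent_space_transition[OF assms(1) True assms(3) v]
          cotangent_space_transition[OF assms(2) True assms(3) v] assms(4) by simp
    qed (use assms(1,2) True in \<open>auto intro: cotangent_space_in_model\<close>)
  next
    case False
    then show ?thesis using assms(1,2) by (simp add: cotangent_space_def)
  qed
qed

lemma covector_of_inner:
  assumes "i \<in> charts_at M x" "j \<in> charts_at M x" "v \<in> mmodel M"
  shows "covector_of M x i p j \<bullet> v = p \<bullet> transition_deriv M x j i v"
proof -
  have "bounded_linear (\<lambda>v. p \<bullet> transition_deriv M x j i v)"
    by (rule bounded_linear_compose[OF bounded_linear_inner_right transition_deriv_bounded_linear[OF assms(2,1)]])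
  from riesz_inner[OF subspace_model this assms(3)] show ?thesis using assms(2) by (simp add: covector_of_def)
qed

lemma covector_of_in:
  assumes "i \<in> charts_at M x"
  shows "covector_of M x i p \<in> cotangent_space M x"
  unfolding cotangent_space_def mem_Collect_eq
proof (intro conjI ballI allI impI)
  fix j k v assume *: "j \<in> charts_at M x" "k \<in> charts_at M x" "v \<in> mmodel M"
  show "covector_of M x i p j \<bullet> v = covector_of M x i p k \<bullet> transition_deriv M x j k v"
    using * assms by (simp add: covector_of_inner transition_deriv_in_model transition_deriv_trans)
qed (simp_all add: covector_of_def riesz_in[OF subspace_model])

lemma covector_of_self:
  assumes "i \<in> charts_at M x" "p \<in> mmodel M"
  shows "covector_of M x i p i = p"
  by (rule inner_eq_on_subspace[OF subspace_model cotangent_space_in_model[OF covector_of_in[OF assms(1)] assms(1)] assms(2)])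
    (simp add: covector_of_inner[OF assms(1,1)] transition_deriv_self[OF assms(1)])

lemma zero_in_cotangent_space: "(\<lambda>_. 0) \<in> cotangent_space M x"
  using subspace_0[OF subspace_model] by (simp add: cotangent_space_def)

lemma inj_cotangent_chart: "i \<in> midx M \<Longrightarrow> inj_on (mchart (cotangent M) i) (mdom (cotangent M) i)"
proof (rule inj_onI, clarsimp)
  fix p q p' q' assume *: "i \<in> midx M" "q \<in> mdom M i" "p \<in> cotangent_space M q" "q' \<in> mdom M i"
    "p' \<in> cotangent_space M q'" "p i = p' i" "mchart M i q = mchart M i q'"
  then have "q = q'" using inj_chart unfolding inj_on_def by metis
  then show "p = p' \<and> q = q'"
    using * cotangent_space_eqI[of p q p' i] by (simp add: charts_at_iff)
qed

text \<open>The fibre coordinate fills the whole model space because \<open>covector_of\<close>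
  extends any prescribed component to a covector.\<close>

lemma cotangent_chart_image:
  assumes i: "i \<in> midx M" and j: "j \<in> midx M"
  shows "mchart (cotangent M) i ` (mdom (cotangent M) i \<inter> mdom (cotangent M) j) =
    mmodel M \<times> mchart M i ` (mdom M i \<inter> mdom M j)"
proof (intro subset_antisym subsetI)
  fix z assume "z \<in> mmodel M \<times> mchart M i ` (mdom M i \<inter> mdom M j)"
  then obtain p q where z: "z = (p, mchart M i q)" "p \<in> mmodel M" "q \<in> mdom M i" "q \<in> mdom M j" by auto
  have "i \<in> charts_at M q" using i z by (simp add: charts_at_iff)
  then have *: "z = mchart (cotangent M) i (covector_of M q i p, q)" "covector_of M q i p \<in> cotangent_space M q"
    using z covector_of_self covector_of_in by auto
  show "z \<in> mchart (cotangent M) i ` (mdom (cotangent M) i \<inter> mdom (cotangent M) j)"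
    unfolding *(1) by (rule imageI) (use z(3,4) *(2) in auto)
next
  fix z assume "z \<in> mchart (cotangent M) i ` (mdom (cotangent M) i \<inter> mdom (cotangent M) j)"
  then show "z \<in> mmodel M \<times> mchart M i ` (mdom M i \<inter> mdom M j)"
    using i by (auto intro: cotangent_space_in_model')
qed

lemma cotangent_chart_inv:
  assumes "i \<in> midx M" "p \<in> mmodel M" "y \<in> mchart M i ` mdom M i"
  shows "chart_inv (cotangent M) i (p, y) = (covector_of M (chart_inv M i y) i p, chart_inv M i y)"
proof -
  have i: "i \<in> charts_at M (chart_inv M i y)" using assms chart_inv_in_mdom by (simp add: charts_at_iff)
  show ?thesis
    unfolding chart_inv_def[of "cotangent M"]
    by (rule inv_into_f_eq[OF inj_cotangent_chart[OF assms(1)]])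
      (use i assms in \<open>simp_all add: covector_of_in covector_of_self chart_chart_inv chart_inv_in_mdom\<close>)
qed

text \<open>Covector components transform by the transpose of the derivative of the reverse
  transition \<open>?\<sigma>\<close>, taken at \<open>?\<tau> y\<close>. So no derivative has to be
  inverted: composition and Riesz representatives suffice.\<close>

lemma cotangent_transition_smooth:
  assumes i: "i \<in> midx M" and j: "j \<in> midx M"
  shows "smooth_on (mmodel M \<times> mmodel M) (mmodel M \<times> mchart M i ` (mdom M i \<inter> mdom M j))
    (mchart (cotangent M) j \<circ> chart_inv (cotangent M) i)"
proof -
  let ?S = "mmodel M \<times> mchart M i ` (mdom M i \<inter> mdom M j)"
  let ?\<tau> = "mchart M j \<circ> chart_inv M i" and ?\<sigma> = "mchart M i \<circ> chart_inv M j"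
  have ov: "mchart M i ` (mdom M i \<inter> mdom M j) \<subseteq> mmodel M" "mchart M j ` (mdom M j \<inter> mdom M i) \<subseteq> mmodel M"
    using open_overlap i j openin_imp_subset by blast+
  have \<tau>ov: "?\<tau> ` (mchart M i ` (mdom M i \<inter> mdom M j)) \<subseteq> mchart M j ` (mdom M j \<inter> mdom M i)"
    using chart_inv_chart[OF i] by auto
  have \<tau>: "smooth_on (mmodel M \<times> mmodel M) ?S (\<lambda>c. ?\<tau> (snd c))"
    by (rule smooth_on_compose[OF smooth_on_bounded_linear[OF bounded_linear_snd] smooth_transition[OF i j] _ ov(1) subspace_model]) auto
  have "smooth_on (mmodel M \<times> mmodel M) ?S (\<lambda>c. fst c \<bullet> deriv_on (mmodel M) ?\<sigma> (?\<tau> (snd c)) v)" if v: "v \<in> mmodel M" for v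
    by (intro smooth_on_bilinear[OF bounded_bilinear_inner] smooth_on_bounded_linear bounded_linear_fst
        smooth_on_compose[OF \<tau> smooth_on_deriv_on[OF smooth_transition[OF j i] open_overlap[OF j i] subspace_model v]
          _ ov(2) subspace_model]) (use \<tau>ov in auto)
  then have "smooth_on (mmodel M \<times> mmodel M) ?S
      (\<lambda>c. (riesz (mmodel M) (\<lambda>v. fst c \<bullet> transition_deriv M (chart_inv M i (snd c)) j i v), ?\<tau> (snd c)))"
  proof (intro smooth_on_Pair \<tau> smooth_on_riesz[OF subspace_model])
    fix v assume sm: "\<And>v. v \<in> mmodel M \<Longrightarrow> smooth_on (mmodel M \<times> mmodel M) ?S (\<lambda>c. fst c \<bullet> deriv_on (mmodel M) ?\<sigma> (?\<tau> (snd c)) v)"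
      and v: "v \<in> mmodel M"
    show "smooth_on (mmodel M \<times> mmodel M) ?S (\<lambda>c. fst c \<bullet> transition_deriv M (chart_inv M i (snd c)) j i v)"
    proof (rule smooth_on_cong[OF sm[OF v]])
      fix c assume "c \<in> ?S"
      then have "i \<in> charts_at M (chart_inv M i (snd c))" "j \<in> charts_at M (chart_inv M i (snd c))"
        using i j chart_inv_chart[OF i] by (auto simp: charts_at_iff)
      from transition_deriv_eq[OF this(2,1) v]
      show "fst c \<bullet> deriv_on (mmodel M) ?\<sigma> (?\<tau> (snd c)) v = fst c \<bullet> transition_deriv M (chart_inv M i (snd c)) j i v"
        by simp
    qed
  qed
  then show ?thesis
  proof (rule smooth_on_cong)
    fix c assume c: "c \<in> ?S"
    then have *: "fst c \<in> mmodel M" "snd c \<in> mchart M i ` mdom M i" by auto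
    have "j \<in> charts_at M (chart_inv M i (snd c))"
      using c j chart_inv_chart[OF i] by (auto simp: charts_at_iff)
    then show "(riesz (mmodel M) (\<lambda>v. fst c \<bullet> transition_deriv M (chart_inv M i (snd c)) j i v), ?\<tau> (snd c)) =
       (mchart (cotangent M) j \<circ> chart_inv (cotangent M) i) c"
      using cotangent_chart_inv[OF i *] by (simp add: covector_of_def)
  qed
qed

lemma smooth_atlas_cotangent: "smooth_atlas (cotangent M)"
proof
  show "subspace (mmodel (cotangent M))"
    using subspace_Times[OF subspace_model subspace_model] by simp
  fix i assume i: "i \<in> midx (cotangent M)"
  then show "inj_on (mchart (cotangent M) i) (mdom (cotangent M) i)" using inj_cotangent_chart by simp
  fix j assume j: "j \<in> midx (cotangent M)"
  have ij: "i \<in> midx M" "j \<in> midx M" using i j by simp_all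
  show "openin (top_of_set (mmodel (cotangent M))) (mchart (cotangent M) i ` (mdom (cotangent M) i \<inter> mdom (cotangent M) j))"
    unfolding cotangent_chart_image[OF ij] cotangent_simps(4)
    by (rule openin_Times[OF openin_subtopology_self open_overlap[OF ij]])
  show "smooth_on (mmodel (cotangent M)) (mchart (cotangent M) i ` (mdom (cotangent M) i \<inter> mdom (cotangent M) j))
     (mchart (cotangent M) j \<circ> chart_inv (cotangent M) i)"
    unfolding cotangent_chart_image[OF ij] cotangent_simps(4) by (rule cotangent_transition_smooth[OF ij])
qed

lemma openin_cotangent_snd_vimage:
  assumes "openin (mtop M) U"
  shows "openin (mtop (cotangent M)) {z \<in> points (cotangent M). snd z \<in> U}"
proof -
  interpret C: smooth_atlas "cotangent M" by (rule smooth_atlas_cotangent)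
  show ?thesis
    unfolding C.openin_mtop
  proof (intro conjI ballI)
    fix i assume "i \<in> midx (cotangent M)"
    then have i: "i \<in> midx M" by simp
    have "mchart (cotangent M) i ` ({z \<in> points (cotangent M). snd z \<in> U} \<inter> mdom (cotangent M) i) =
        mmodel M \<times> mchart M i ` (U \<inter> mdom M i)" (is "?A = ?B")
    proof (intro subset_antisym subsetI)
      fix c assume "c \<in> ?A"
      then show "c \<in> ?B" using i by (auto intro: cotangent_space_in_model')
    next
      fix c assume "c \<in> ?B"
      then obtain p q where c: "c = (p, mchart M i q)" "p \<in> mmodel M" "q \<in> U" "q \<in> mdom M i" by auto
      have "i \<in> charts_at M q" using i c by (simp add: charts_at_iff)
      then have *: "c = mchart (cotangent M) i (covector_of M q i p, q)" "covector_of M q i p \<in> cotangent_space M q"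
        using c covector_of_self covector_of_in by auto
      moreover have "q \<in> points M" using \<open>i \<in> charts_at M q\<close> points_iff by metis
      ultimately show "c \<in> ?A"
        unfolding *(1) using c(3,4) by (intro imageI) (auto simp: points_cotangent)
    qed
    moreover have "openin (top_of_set (mmodel M \<times> mmodel M)) ?B"
      using assms i unfolding openin_mtop by (intro openin_Times) auto
    ultimately show "openin (top_of_set (mmodel (cotangent M)))
        (mchart (cotangent M) i ` ({z \<in> points (cotangent M). snd z \<in> U} \<inter> mdom (cotangent M) i))" by simp
  qed auto
qed

text \<open>Different base points are separated by preimages of open sets of the base; covectors
  over the same point lie in a common chart, where the model space separates them.\<close>

lemma Hausdorff_cotangent:
  assumes "Hausdorff_space (mtop M)"
  shows "Hausdorff_space (mtop (cotangent M))"
proof -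
  interpret C: smooth_atlas "cotangent M" by (rule smooth_atlas_cotangent)
  show ?thesis
    unfolding Hausdorff_space_def C.topspace_mtop
  proof (intro allI impI)
    fix z w assume zw: "z \<in> points (cotangent M) \<and> w \<in> points (cotangent M) \<and> z \<noteq> w"
    have sM: "snd z \<in> points M" "snd w \<in> points M" using zw by (metis points_cotangent prod.collapse)+
    show "\<exists>U V. openin (mtop (cotangent M)) U \<and> openin (mtop (cotangent M)) V \<and> z \<in> U \<and> w \<in> V \<and> disjnt U V"
    proof (cases "snd z = snd w")
      case False
      then obtain U V where UV: "openin (mtop M) U" "openin (mtop M) V" "snd z \<in> U" "snd w \<in> V" "disjnt U V"
        using assms sM unfolding Hausdorff_space_def topspace_mtop by blast
      have "disjnt {z \<in> points (cotangent M). snd z \<in> U} {z \<in> points (cotangent M). snd z \<in> V}"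
        using UV(5) by (auto simp: disjnt_iff)
      moreover have "z \<in> {z \<in> points (cotangent M). snd z \<in> U}" "w \<in> {z \<in> points (cotangent M). snd z \<in> V}"
        using zw UV(3,4) by simp_all
      ultimately show ?thesis
        by (intro exI[of _ "{z \<in> points (cotangent M). snd z \<in> U}"] exI[of _ "{z \<in> points (cotangent M). snd z \<in> V}"]
            conjI openin_cotangent_snd_vimage UV(1,2))
    next
      case True
      obtain i where i: "i \<in> charts_at (cotangent M) z" using zw unfolding points_iff by blast
      have dom: "i \<in> midx (cotangent M)" "z \<in> mdom (cotangent M) i" "w \<in> mdom (cotangent M) i"
        using i zw True by (auto simp: charts_at_iff points_def)
      have "mchart (cotangent M) i z \<noteq> mchart (cotangent M) i w"
        using inj_onD[OF C.inj_chart[OF dom(1)] _ dom(2,3)] zw by blast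
      from hausdorff[OF this]
      obtain A B where AB: "open A" "open B" "mchart (cotangent M) i z \<in> A" "mchart (cotangent M) i w \<in> B" "A \<inter> B = {}"
        by blast
      let ?V = "\<lambda>A. {x \<in> mdom (cotangent M) i. mchart (cotangent M) i x \<in> mmodel (cotangent M) \<inter> A}"
      have "z \<in> ?V A" "w \<in> ?V B"
        using dom AB(3,4) C.chart_in_model[OF dom(1)] by blast+
      moreover have "disjnt (?V A) (?V B)" using AB(5) unfolding disjnt_iff by blast
      ultimately show ?thesis
        by (intro exI[of _ "?V A"] exI[of _ "?V B"] conjI C.openin_chart_vimage[OF dom(1)] openin_open_Int AB(1,2))
    qed
  qed
qed

text \<open>
  Transitions of the cotangent bundle preserve \<open>p \<bullet> v\<close> when \<open>v\<close> is pushed forward. Differentiating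
  this identity expresses the form in the second chart by the form in the first one and a second
  derivative of the transition map, which cancels by symmetry.
\<close>

lemma canonical_form_chart:
  assumes i: "i \<in> charts_at (cotangent M) z" and u: "u \<in> tangent_space (cotangent M) z" and v: "v \<in> tangent_space (cotangent M) z"
  shows "canonical_form M z u v = fst (u i) \<bullet> snd (v i) - fst (v i) \<bullet> snd (u i)"
proof -
  interpret C: smooth_atlas "cotangent M" by (rule smooth_atlas_cotangent)
  define j where "j = (SOME j. j \<in> charts_at (cotangent M) z)"
  have j: "j \<in> charts_at (cotangent M) z" unfolding j_def using i by (rule someI)
  obtain p q where z: "z = (p, q)" by fastforce
  have iq: "i \<in> charts_at M q" "j \<in> charts_at M q" "p \<in> cotangent_space M q" using i j z by auto
  have idx: "i \<in> midx M" "j \<in> midx M" "q \<in> mdom M i" "q \<in> mdom M j" using iq by (auto simp: charts_at_iff)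
  let ?L = "mmodel M" and ?\<tau> = "mchart M j \<circ> chart_inv M i" and ?y = "mchart M i q"
  let ?ov = "mchart M i ` (mdom M i \<inter> mdom M j)"
  let ?S = "?L \<times> ?ov" and ?T = "mchart (cotangent M) j \<circ> chart_inv (cotangent M) i"
  let ?D = "transition_deriv (cotangent M) z i j"
  have LL: "subspace (?L \<times> ?L)" by (rule subspace_Times[OF subspace_model subspace_model])
  have ov: "?ov \<subseteq> ?L" "?y \<in> ?ov" using open_overlap[OF idx(1,2)] openin_imp_subset idx by blast+
  have S: "openin (top_of_set (?L \<times> ?L)) ?S" by (rule openin_Times[OF openin_subtopology_self open_overlap[OF idx(1,2)]])
  have c0: "(p i, ?y) \<in> ?S" using cotangent_space_in_model[OF iq(3,1)] ov by simp
  have c0L: "(p i, ?y) \<in> ?L \<times> ?L" using c0 ov by auto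
  have inv: "chart_inv (cotangent M) i (p i, ?y) = (p, q)"
    using C.chart_inv_chart[of i z] i z by (simp add: charts_at_iff)
  have D: "(?T has_derivative ?D) (at (p i, ?y) within ?L \<times> ?L)"
    using C.transition_has_derivative[OF i j] by (simp add: z)
  have A: "((\<lambda>y. deriv_on ?L ?\<tau> y w) has_derivative deriv_on ?L (\<lambda>y. deriv_on ?L ?\<tau> y w) ?y) (at ?y within ?L)" if "w \<in> ?L" for w
    by (rule smooth_on_has_derivative[OF smooth_on_deriv_on[OF smooth_transition[OF idx(1,2)] open_overlap[OF idx(1,2)] subspace_model that]
          open_overlap[OF idx(1,2)] ov(2)])
  have rel: "fst (?T c) \<bullet> deriv_on ?L ?\<tau> (snd c) w = fst c \<bullet> w" if c: "c \<in> ?S" and w: "w \<in> ?L" for c w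
  proof -
    let ?x = "chart_inv M i (snd c)"
    have "snd c \<in> mchart M i ` mdom M i" "fst c \<in> ?L" using c by auto
    from cotangent_chart_inv[OF idx(1) this(2,1)]
    have T: "fst (?T c) = covector_of M ?x i (fst c) j" by simp
    have x: "i \<in> charts_at M ?x" "j \<in> charts_at M ?x" "mchart M i ?x = snd c"
      using c idx chart_inv_chart[OF idx(1)] by (auto simp: charts_at_iff)
    have "deriv_on ?L ?\<tau> (snd c) w = transition_deriv M ?x i j w" using transition_deriv_eq[OF x(1,2) w] x(3) by simp
    then show ?thesis
      using cotangent_space_transition[OF covector_of_in[OF x(1)] x(1,2) w] covector_of_self[OF x(1) \<open>fst c \<in> ?L\<close>] T by simp
  qed
  have snd_D: "snd (?D (a, b)) = deriv_on ?L ?\<tau> ?y b" if "a \<in> ?L" "b \<in> ?L" for a b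
  proof -
    have 1: "((\<lambda>c. snd (?T c)) has_derivative (\<lambda>c. snd (?D c))) (at (p i, ?y) within ?L \<times> ?L)"
      by (rule bounded_linear.has_derivative[OF bounded_linear_snd D])
    have "((\<lambda>c. ?\<tau> (snd c)) has_derivative (\<lambda>c. deriv_on ?L ?\<tau> ?y (snd c))) (at (p i, ?y) within ?L \<times> ?L)"
    proof (rule has_derivative_compose_openin[OF bounded_linear_imp_has_derivative[OF bounded_linear_snd] S c0])
      show "snd ` ?S \<subseteq> ?L" using ov by auto
      show "(?\<tau> has_derivative deriv_on ?L ?\<tau> ?y) (at (snd (p i, ?y)) within ?L)"
        unfolding prod.sel by (rule smooth_on_has_derivative[OF smooth_transition[OF idx(1,2)] open_overlap[OF idx(1,2)] ov(2)])
    qed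
    then have "((\<lambda>c. snd (?T c)) has_derivative (\<lambda>c. deriv_on ?L ?\<tau> ?y (snd c))) (at (p i, ?y) within ?L \<times> ?L)"
    proof (rule has_derivative_cong_openin[OF _ S c0])
      fix c assume "c \<in> ?S"
      then have "fst c \<in> ?L" "snd c \<in> mchart M i ` mdom M i" by auto
      from cotangent_chart_inv[OF idx(1) this] show "?\<tau> (snd c) = snd (?T c)" by simp
    qed
    from deriv_on_unique[OF 1 this LL c0L, of "(a, b)"] show ?thesis using that by simp
  qed
  \<comment> \<open>The second summand is what the product rule adds; it is symmetric in
    \<open>b\<close> and \<open>w\<close>, so it cancels in the difference of the two instances used
    at the end.\<close>
  have fst_D: "fst (?D (a, b)) \<bullet> deriv_on ?L ?\<tau> ?y w + p j \<bullet> deriv_on ?L (\<lambda>y. deriv_on ?L ?\<tau> y w) ?y b = a \<bullet> w"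
    if "a \<in> ?L" "b \<in> ?L" "w \<in> ?L" for a b w
  proof -
    have "((\<lambda>c. deriv_on ?L ?\<tau> (snd c) w) has_derivative (\<lambda>c. deriv_on ?L (\<lambda>y. deriv_on ?L ?\<tau> y w) ?y (snd c)))
        (at (p i, ?y) within ?L \<times> ?L)"
    proof (rule has_derivative_compose_openin[OF bounded_linear_imp_has_derivative[OF bounded_linear_snd] S c0])
      show "snd ` ?S \<subseteq> ?L" using ov by auto
      show "((\<lambda>y. deriv_on ?L ?\<tau> y w) has_derivative deriv_on ?L (\<lambda>y. deriv_on ?L ?\<tau> y w) ?y) (at (snd (p i, ?y)) within ?L)"
        unfolding prod.sel by (rule A[OF that(3)])
    qed
    from has_derivative_inner[OF bounded_linear.has_derivative[OF bounded_linear_fst D] this]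
    have "((\<lambda>c. fst (?T c) \<bullet> deriv_on ?L ?\<tau> (snd c) w) has_derivative
        (\<lambda>c. fst (?T (p i, ?y)) \<bullet> deriv_on ?L (\<lambda>y. deriv_on ?L ?\<tau> y w) ?y (snd c) + fst (?D c) \<bullet> deriv_on ?L ?\<tau> (snd (p i, ?y)) w))
        (at (p i, ?y) within ?L \<times> ?L)" .
    then have 1: "((\<lambda>c. fst c \<bullet> w) has_derivative
        (\<lambda>c. fst (?T (p i, ?y)) \<bullet> deriv_on ?L (\<lambda>y. deriv_on ?L ?\<tau> y w) ?y (snd c) + fst (?D c) \<bullet> deriv_on ?L ?\<tau> (snd (p i, ?y)) w))
        (at (p i, ?y) within ?L \<times> ?L)"
      by (rule has_derivative_cong_openin[OF _ S c0]) (rule rel[OF _ that(3)])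
    have 2: "((\<lambda>c. fst c \<bullet> w) has_derivative (\<lambda>c. fst c \<bullet> w)) (at (p i, ?y) within ?L \<times> ?L)"
      by (intro bounded_linear_imp_has_derivative bounded_linear_compose[OF bounded_linear_inner_left bounded_linear_fst])
    from deriv_on_unique[OF 1 2 LL c0L, of "(a, b)"] show ?thesis using that by (simp add: inv)
  qed
  have uv: "u i \<in> ?L \<times> ?L" "v i \<in> ?L \<times> ?L" "u j = ?D (u i)" "v j = ?D (v i)"
    using tangent_space_in_model[OF u i] tangent_space_in_model[OF v i]
      tangent_space_transition[OF u i j] tangent_space_transition[OF v i j] by simp_all
  obtain a b a' b' where ab: "u i = (a, b)" "v i = (a', b')" "a \<in> ?L" "b \<in> ?L" "a' \<in> ?L" "b' \<in> ?L"
    using uv(1,2) by auto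
  have sym: "deriv_on ?L (\<lambda>y. deriv_on ?L ?\<tau> y b) ?y b' = deriv_on ?L (\<lambda>y. deriv_on ?L ?\<tau> y b') ?y b"
    by (rule second_deriv_on_symmetric[OF smooth_transition[OF idx(1,2)] open_overlap[OF idx(1,2)] subspace_model ab(4,6) ov(2)])
  have "fst (u j) \<bullet> snd (v j) - fst (v j) \<bullet> snd (u j) = a \<bullet> b' - a' \<bullet> b"
    using fst_D[OF ab(3,4,6)] fst_D[OF ab(5,6,4)] sym
    unfolding uv(3,4) ab(1,2) snd_D[OF ab(3,4)] snd_D[OF ab(5,6)] by simp
  then show ?thesis
    unfolding canonical_form_def j_def[symmetric] Let_def by (simp add: ab)
qed

end

lemma charts_at_prod_iff: "k \<in> charts_at (prod_manifold M N) z \<longleftrightarrow> fst k \<in> charts_at M (fst z) \<and> snd k \<in> charts_at N (snd z)"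
  by (cases k; cases z) simp

context two_atlases
begin

section \<open>Differentials of the product projections\<close>

lemma differential_fst:
  assumes v: "v \<in> tangent_space (prod_manifold M N) z" and ij: "(i, j) \<in> charts_at (prod_manifold M N) z"
  shows "differential (prod_manifold M N) M fst z v i = fst (v (i, j))"
proof -
  have idx: "i \<in> midx M" "j \<in> midx N" "i \<in> charts_at M (fst z)" "z \<in> mdom M i \<times> mdom N j"
    using ij by (auto simp: charts_at_iff charts_at_prod_iff mem_Times_iff)
  have "{y \<in> points (prod_manifold M N). fst y \<in> mdom M i} = mdom M i \<times> points N"
    using idx by (auto simp: points_prod points_def)
  then have opn: "openin (mtop (prod_manifold M N)) {y \<in> points (prod_manifold M N). fst y \<in> mdom M i}"
    using openin_prod_rect[OF M.openin_mdom[OF idx(1)] N.openin_points] by simp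
  show ?thesis
  proof (rule prod.differential_eq[OF v ij idx(3) opn])
    show "((\<lambda>y. mchart M i (fst (chart_inv (prod_manifold M N) (i, j) y))) has_derivative fst)
      (at (mchart (prod_manifold M N) (i, j) z) within mmodel (prod_manifold M N))"
    proof (rule has_derivative_cong_openin[OF bounded_linear_imp_has_derivative[OF bounded_linear_fst] prod.openin_image[of "(i, j)"]])
      fix y assume "y \<in> mchart (prod_manifold M N) (i, j) ` mdom (prod_manifold M N) (i, j)"
      then obtain a b where "y = (mchart M i a, mchart N j b)" "a \<in> mdom M i" "b \<in> mdom N j" by auto
      then show "fst y = mchart M i (fst (chart_inv (prod_manifold M N) (i, j) y))"
        using prod.chart_inv_chart[of "(i, j)" "(a, b)"] idx by simp
    qed (use idx in auto)
  qed
qed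

lemma differential_snd:
  assumes v: "v \<in> tangent_space (prod_manifold M N) z" and ij: "(i, j) \<in> charts_at (prod_manifold M N) z"
  shows "differential (prod_manifold M N) N snd z v j = snd (v (i, j))"
proof -
  have idx: "i \<in> midx M" "j \<in> midx N" "j \<in> charts_at N (snd z)" "z \<in> mdom M i \<times> mdom N j"
    using ij by (auto simp: charts_at_iff charts_at_prod_iff mem_Times_iff)
  have "{y \<in> points (prod_manifold M N). snd y \<in> mdom N j} = points M \<times> mdom N j"
    using idx by (auto simp: points_prod points_def)
  then have opn: "openin (mtop (prod_manifold M N)) {y \<in> points (prod_manifold M N). snd y \<in> mdom N j}"
    using openin_prod_rect[OF M.openin_points N.openin_mdom[OF idx(2)]] by simp
  show ?thesis
  proof (rule prod.differential_eq[OF v ij idx(3) opn])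
    show "((\<lambda>y. mchart N j (snd (chart_inv (prod_manifold M N) (i, j) y))) has_derivative snd)
      (at (mchart (prod_manifold M N) (i, j) z) within mmodel (prod_manifold M N))"
    proof (rule has_derivative_cong_openin[OF bounded_linear_imp_has_derivative[OF bounded_linear_snd] prod.openin_image[of "(i, j)"]])
      fix y assume "y \<in> mchart (prod_manifold M N) (i, j) ` mdom (prod_manifold M N) (i, j)"
      then obtain a b where "y = (mchart M i a, mchart N j b)" "a \<in> mdom M i" "b \<in> mdom N j" by auto
      then show "snd y = mchart N j (snd (chart_inv (prod_manifold M N) (i, j) y))"
        using prod.chart_inv_chart[of "(i, j)" "(a, b)"] idx by simp
    qed (use idx in auto)
  qed
qed

lemma differential_fst_tangent:
  assumes v: "v \<in> tangent_space (prod_manifold M N) z" and ij: "(i, j) \<in> charts_at (prod_manifold M N) z"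
  shows "differential (prod_manifold M N) M fst z v \<in> tangent_space M (fst z)"
  unfolding tangent_space_iff
proof (intro conjI allI impI ballI)
  fix k l assume kl: "k \<in> charts_at M (fst z)" "l \<in> charts_at M (fst z)"
  have j: "j \<in> charts_at N (snd z)" using ij by (simp add: charts_at_prod_iff)
  have c: "(k, j) \<in> charts_at (prod_manifold M N) z" "(l, j) \<in> charts_at (prod_manifold M N) z"
    using kl j by (simp_all add: charts_at_prod_iff)
  have m: "fst (v (k, j)) \<in> mmodel M" "snd (v (k, j)) \<in> mmodel N"
    using tangent_space_in_model[OF v c(1)] by (simp_all add: mem_Times_iff)
  show "differential (prod_manifold M N) M fst z v l = transition_deriv M (fst z) k l (differential (prod_manifold M N) M fst z v k)"
    using prod_transition_deriv[OF kl j j m] tangent_space_transition[OF v c]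
    unfolding differential_fst[OF v c(1)] differential_fst[OF v c(2)] by simp
next
  fix k assume k: "k \<in> charts_at M (fst z)"
  have c: "(k, j) \<in> charts_at (prod_manifold M N) z" using k ij by (simp add: charts_at_prod_iff)
  show "differential (prod_manifold M N) M fst z v k \<in> mmodel M"
    using tangent_space_in_model[OF v c] differential_fst[OF v c] by (simp add: mem_Times_iff)
qed (simp add: differential_def)

lemma differential_snd_tangent:
  assumes v: "v \<in> tangent_space (prod_manifold M N) z" and ij: "(i, j) \<in> charts_at (prod_manifold M N) z"
  shows "differential (prod_manifold M N) N snd z v \<in> tangent_space N (snd z)"
  unfolding tangent_space_iff
proof (intro conjI allI impI ballI)
  fix k l assume kl: "k \<in> charts_at N (snd z)" "l \<in> charts_at N (snd z)"
  have i: "i \<in> charts_at M (fst z)" using ij by (simp add: charts_at_prod_iff)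
  have c: "(i, k) \<in> charts_at (prod_manifold M N) z" "(i, l) \<in> charts_at (prod_manifold M N) z"
    using kl i by (simp_all add: charts_at_prod_iff)
  have m: "fst (v (i, k)) \<in> mmodel M" "snd (v (i, k)) \<in> mmodel N"
    using tangent_space_in_model[OF v c(1)] by (simp_all add: mem_Times_iff)
  show "differential (prod_manifold M N) N snd z v l = transition_deriv N (snd z) k l (differential (prod_manifold M N) N snd z v k)"
    using prod_transition_deriv[OF i i kl m] tangent_space_transition[OF v c]
    unfolding differential_snd[OF v c(1)] differential_snd[OF v c(2)] by simp
next
  fix k assume k: "k \<in> charts_at N (snd z)"
  have c: "(i, k) \<in> charts_at (prod_manifold M N) z" using k ij by (simp add: charts_at_prod_iff)
  show "differential (prod_manifold M N) N snd z v k \<in> mmodel N"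
    using tangent_space_in_model[OF v c] differential_snd[OF v c] by (simp add: mem_Times_iff)
qed (simp add: differential_def)

end

section \<open>Submanifolds that are graphs in a chart\<close>

text \<open>In the chart \<open>i\<close> the set \<open>S\<close> is, within \<open>N\<close>, the
  graph of \<open>G\<close> over the range of the projection \<open>\<pi>\<close>: \<open>G\<close>
  takes values in the kernel of \<open>\<pi>\<close> and is constant along its fibres.
  \<open>N0\<close> is a union of whole fibres, whereas \<open>N\<close> also has to lie in the
  chart image; the shear below moves points along fibres and may leave \<open>N\<close>, but not
  \<open>N0\<close>.\<close>

locale graph_chart = smooth_atlas M for M :: "('i, 'a, 'e::euclidean_space) manifold" +
  fixes S :: "'a set" and i :: 'i and N N0 :: "'e set" and \<pi> G :: "'e \<Rightarrow> 'e"
  assumes idx: "i \<in> midx M"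
    and N: "openin (top_of_set (mmodel M)) N" "N \<subseteq> N0" "N \<subseteq> mchart M i ` mdom M i"
    and N0: "openin (top_of_set (mmodel M)) N0"
    and \<pi>: "bounded_linear \<pi>" "\<And>x. x \<in> mmodel M \<Longrightarrow> \<pi> x \<in> mmodel M" "\<And>x. x \<in> mmodel M \<Longrightarrow> \<pi> (\<pi> x) = \<pi> x"
    and G: "smooth_on (mmodel M) N0 G" "\<And>\<xi>. \<xi> \<in> N0 \<Longrightarrow> G \<xi> \<in> mmodel M" "\<And>\<xi>. \<xi> \<in> N0 \<Longrightarrow> \<pi> (G \<xi>) = 0"
    and fibre: "\<And>\<xi> \<eta>. \<xi> \<in> N0 \<Longrightarrow> \<eta> \<in> mmodel M \<Longrightarrow> \<pi> \<eta> = \<pi> \<xi> \<Longrightarrow> \<eta> \<in> N0 \<and> G \<eta> = G \<xi>"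
    and graph: "\<And>\<xi>. \<xi> \<in> N \<Longrightarrow> chart_inv M i \<xi> \<in> S \<longleftrightarrow> \<xi> = \<pi> \<xi> + G \<xi>"
begin

interpretation \<pi>: bounded_linear \<pi> by (rule \<pi>(1))

text \<open>Straightens the graph onto the range of \<open>\<pi>\<close>. As \<open>G\<close> does
  not change along fibres, the inverse is \<open>\<eta> + G \<eta>\<close>.\<close>

abbreviation \<psi> :: "'e \<Rightarrow> 'e" where "\<psi> \<xi> \<equiv> \<xi> - G \<xi>"

lemma N0_sub: "N0 \<subseteq> mmodel M" by (rule openin_imp_subset[OF N0])

lemma \<psi>_fibre:
  assumes "\<xi> \<in> N0"
  shows "\<psi> \<xi> \<in> N0" "G (\<psi> \<xi>) = G \<xi>" "\<pi> (\<psi> \<xi>) = \<pi> \<xi>"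
proof -
  have "\<psi> \<xi> \<in> mmodel M" using assms N0_sub G(2) by (intro subspace_diff[OF subspace_model]) auto
  moreover show "\<pi> (\<psi> \<xi>) = \<pi> \<xi>" using G(3)[OF assms] by (simp add: \<pi>.diff)
  ultimately show "\<psi> \<xi> \<in> N0" "G (\<psi> \<xi>) = G \<xi>" using fibre[OF assms] by auto
qed

lemma plus_fibre:
  assumes "\<xi> \<in> N0"
  shows "G (\<xi> + G \<xi>) = G \<xi>" "\<pi> (\<xi> + G \<xi>) = \<pi> \<xi>"
proof -
  have "\<xi> + G \<xi> \<in> mmodel M" using assms N0_sub G(2) by (intro subspace_add[OF subspace_model]) auto
  moreover show "\<pi> (\<xi> + G \<xi>) = \<pi> \<xi>" using G(3)[OF assms] by (simp add: \<pi>.add)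
  ultimately show "G (\<xi> + G \<xi>) = G \<xi>" using fibre[OF assms] by auto
qed

text \<open>As a preimage under the inverse shear the image is open by continuity alone.\<close>

lemma \<psi>_image: "\<psi> ` N = N0 \<inter> (\<lambda>\<eta>. \<eta> + G \<eta>) -` N"
proof (intro subset_antisym subsetI)
  fix \<eta> assume "\<eta> \<in> \<psi> ` N"
  then obtain \<xi> where "\<xi> \<in> N" "\<eta> = \<psi> \<xi>" by blast
  then show "\<eta> \<in> N0 \<inter> (\<lambda>\<eta>. \<eta> + G \<eta>) -` N" using \<psi>_fibre[of \<xi>] N(2) by auto
next
  fix \<eta> assume "\<eta> \<in> N0 \<inter> (\<lambda>\<eta>. \<eta> + G \<eta>) -` N"
  then have "\<eta> \<in> N0" "\<eta> + G \<eta> \<in> N" by auto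
  then show "\<eta> \<in> \<psi> ` N" using plus_fibre(1)[of \<eta>] by (intro image_eqI[of _ _ "\<eta> + G \<eta>"]) auto
qed

lemma smooth_plus: "smooth_on (mmodel M) N0 (\<lambda>\<eta>. \<eta> + G \<eta>)"
  by (intro smooth_on_add G(1) smooth_on_bounded_linear bounded_linear_ident)

lemma \<psi>_inv: "\<xi> \<in> N \<Longrightarrow> inv_into N \<psi> (\<psi> \<xi>) = \<psi> \<xi> + G (\<psi> \<xi>)"
  and inj_\<psi>: "inj_on \<psi> N"
proof -
  show inj: "inj_on \<psi> N"
  proof (rule inj_onI)
    fix \<xi> \<eta> assume *: "\<xi> \<in> N" "\<eta> \<in> N" "\<psi> \<xi> = \<psi> \<eta>"
    then have "\<xi> \<in> N0" "\<eta> \<in> N0" using N(2) by blast+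
    then have "G \<xi> = G \<eta>" using \<psi>_fibre(2)[of \<xi>] \<psi>_fibre(2)[of \<eta>] *(3) by simp
    then show "\<xi> = \<eta>" using *(3) by simp
  qed
  assume \<xi>: "\<xi> \<in> N"
  then show "inv_into N \<psi> (\<psi> \<xi>) = \<psi> \<xi> + G (\<psi> \<xi>)"
    using inv_into_f_f[OF inj \<xi>] \<psi>_fibre(2)[of \<xi>] N(2) by auto
qed

lemma diffeo_\<psi>: "diffeo_on (mmodel M) N \<psi>"
  unfolding diffeo_on_def
proof (intro conjI)
  show "openin (top_of_set (mmodel M)) N" "inj_on \<psi> N" by (rule N(1), rule inj_\<psi>)
  show "smooth_on (mmodel M) N \<psi>"
    by (intro smooth_on_diff smooth_on_mono[OF G(1) N(2) order_refl] smooth_on_bounded_linear bounded_linear_ident)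
  have "openin (top_of_set N0) (N0 \<inter> (\<lambda>\<eta>. \<eta> + G \<eta>) -` N)"
  proof (rule continuous_openin_preimage[OF smooth_on_continuous[OF smooth_plus] _ N(1)])
    show "(\<lambda>\<eta>. \<eta> + G \<eta>) \<in> N0 \<rightarrow> mmodel M"
      using N0_sub G(2) by (auto intro: subspace_add[OF subspace_model])
  qed
  then show "openin (top_of_set (mmodel M)) (\<psi> ` N)" unfolding \<psi>_image using N0 by (rule openin_trans)
  have "smooth_on (mmodel M) (\<psi> ` N) (\<lambda>\<eta>. \<eta> + G \<eta>)"
    by (rule smooth_on_mono[OF smooth_plus]) (auto simp: \<psi>_image)
  then show "smooth_on (mmodel M) (\<psi> ` N) (inv_into N \<psi>)"
    by (rule smooth_on_cong) (use \<psi>_inv in auto)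
qed

lemma slice: "\<psi> ` (N \<inter> mchart M i ` (S \<inter> mdom M i)) = \<psi> ` N \<inter> \<pi> ` mmodel M"
proof -
  have "\<xi> \<in> mchart M i ` (S \<inter> mdom M i) \<longleftrightarrow> \<psi> \<xi> \<in> \<pi> ` mmodel M" if \<xi>: "\<xi> \<in> N" for \<xi>
  proof -
    have "\<xi> \<in> mchart M i ` (S \<inter> mdom M i) \<longleftrightarrow> chart_inv M i \<xi> \<in> S"
    proof
      assume "chart_inv M i \<xi> \<in> S"
      then show "\<xi> \<in> mchart M i ` (S \<inter> mdom M i)"
        using \<xi> N(3) chart_chart_inv[of \<xi> M i] chart_inv_in_mdom[of \<xi> M i]
        by (intro image_eqI[of _ _ "chart_inv M i \<xi>"]) auto
    qed (use chart_inv_chart[OF idx] in auto)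
    also have "\<dots> \<longleftrightarrow> \<psi> \<xi> = \<pi> \<xi>" unfolding graph[OF \<xi>] by (metis add_diff_cancel diff_add_cancel)
    also have "\<dots> \<longleftrightarrow> \<psi> \<xi> \<in> \<pi> ` mmodel M"
    proof
      assume "\<psi> \<xi> = \<pi> \<xi>"
      then show "\<psi> \<xi> \<in> \<pi> ` mmodel M" using \<xi> N(2) N0_sub by auto
    next
      assume "\<psi> \<xi> \<in> \<pi> ` mmodel M"
      then have "\<pi> (\<psi> \<xi>) = \<psi> \<xi>" using \<pi>(3) by auto
      then show "\<psi> \<xi> = \<pi> \<xi>" using \<psi>_fibre(3)[of \<xi>] \<xi> N(2) by auto
    qed
    finally show ?thesis .
  qed
  then show ?thesis by blast
qed

lemma subspace_image: "subspace (\<pi> ` mmodel M)"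
  using bounded_linear.linear[OF \<pi>(1)] subspace_model by (rule linear_subspace_image)

text \<open>In one direction the graph equation is differentiated along a curve in \<open>S\<close>.
  In the other a straight line in the direction \<open>v i\<close> is pushed along the fibres onto
  the graph, and the linearised equation says that its velocity is still \<open>v i\<close>.\<close>

lemma tangent_sub_iff:
  assumes x: "x \<in> mdom M i" "mchart M i x \<in> N" "x \<in> S" and v: "v \<in> tangent_space M x"
  shows "v \<in> tangent_sub M S x \<longleftrightarrow> v i = \<pi> (v i) + deriv_on (mmodel M) G (mchart M i x) (v i)"
proof -
  let ?L = "mmodel M"
  have i: "i \<in> charts_at M x" using x idx by (simp add: charts_at_iff)
  have vi: "v i \<in> ?L" by (rule tangent_space_in_model[OF v i])
  have x0: "mchart M i x \<in> N0" "mchart M i x \<in> ?L" using x N(2) N0_sub by auto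
  have DG: "(G has_derivative deriv_on ?L G (mchart M i x)) (at (mchart M i x) within ?L)"
    by (rule smooth_on_has_derivative[OF G(1) N0 x0(1)])
  show ?thesis
  proof
    assume "v \<in> tangent_sub M S x"
    then obtain c d where c: "(d::real) > 0" "c 0 = x" "\<And>s. \<bar>s\<bar> < d \<Longrightarrow> c s \<in> S" "\<And>s. \<bar>s\<bar> < d \<Longrightarrow> c s \<in> mdom M i"
      "((\<lambda>s. mchart M i (c s)) has_vector_derivative v i) (at 0)"
      using tangent_sub_curve[OF _ i] by metis
    let ?\<xi> = "\<lambda>s. mchart M i (c s)"
    have \<xi>L: "?\<xi> s \<in> ?L" if "\<bar>s\<bar> < d" for s using chart_in_model[OF idx c(4)[OF that]] .
    obtain T where T: "open T" "N = ?L \<inter> T" using N(1) by (auto simp: openin_open)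
    have "continuous (at 0) ?\<xi>" using c(5) has_vector_derivative_continuous by blast
    moreover have xT: "?\<xi> 0 \<in> T" using x(2) c(2) T(2) by simp
    ultimately have "eventually (\<lambda>s. ?\<xi> s \<in> T) (at 0)"
      unfolding continuous_at using topological_tendstoD[OF _ T(1) xT] by blast
    then obtain d' where d': "d' > 0" "\<And>s. s \<noteq> 0 \<Longrightarrow> dist s 0 < d' \<Longrightarrow> ?\<xi> s \<in> T"
      unfolding eventually_at by auto
    define e where "e = min d d'"
    have e: "e > 0" using c(1) d'(1) by (simp add: e_def)
    have \<xi>N: "?\<xi> s \<in> N" if "s \<in> {-e<..<e}" for s
    proof -
      have s: "\<bar>s\<bar> < d" "dist s 0 < d'" using that by (auto simp: e_def)
      have "?\<xi> s \<in> T" using d'(2)[OF _ s(2)] xT by (cases "s = 0") auto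
      then show ?thesis using \<xi>L[OF s(1)] T(2) by blast
    qed
    have eq: "?\<xi> s = \<pi> (?\<xi> s) + G (?\<xi> s)" if s: "s \<in> {-e<..<e}" for s
    proof -
      have sd: "\<bar>s\<bar> < d" using s by (auto simp: e_def)
      have "chart_inv M i (?\<xi> s) \<in> S" using chart_inv_chart[OF idx c(4)[OF sd]] c(3)[OF sd] by simp
      then show ?thesis using graph[OF \<xi>N[OF s]] by blast
    qed
    have "((\<lambda>s. G (?\<xi> s)) has_vector_derivative deriv_on ?L G (mchart M i x) (v i)) (at 0)"
    proof (rule has_vector_derivative_compose_deriv[OF c(5)])
      show "?\<xi> ` {-e<..<e} \<subseteq> ?L" using \<xi>L by (auto simp: e_def)
      show "(G has_derivative deriv_on ?L G (mchart M i x)) (at (?\<xi> 0) within ?L)" using DG c(2) by simp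
    qed (use e in auto)
    from has_vector_derivative_add[OF \<pi>.has_vector_derivative[OF c(5)] this]
    have "(?\<xi> has_vector_derivative \<pi> (v i) + deriv_on ?L G (mchart M i x) (v i)) (at 0)"
      by (rule has_vector_derivative_transform_within_open[where S = "{-e<..<e}"]) (use e eq in auto)
    with c(5) show "v i = \<pi> (v i) + deriv_on ?L G (mchart M i x) (v i)" by (rule vector_derivative_unique_at)
  next
    assume vG: "v i = \<pi> (v i) + deriv_on ?L G (mchart M i x) (v i)"
    let ?x = "mchart M i x"
    define l where "l s = ?x + s *\<^sub>R v i" for s :: real
    \<comment> \<open>The point of the graph in the fibre of \<open>l s\<close>.\<close>
    define \<xi> where "\<xi> s = \<pi> (l s) + G (l s)" for s
    have lL: "l s \<in> ?L" for s unfolding l_def using x0(2) vi subspace_model by (intro subspace_add subspace_mul)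
    have lsm: "smooth_on UNIV S l" for S
      unfolding l_def by (intro smooth_on_add smooth_on_const smooth_on_bounded_linear bounded_linear_scaleR_left)
    have l': "(l has_vector_derivative v i) (at s)" for s
      unfolding l_def by (auto intro!: derivative_eq_intros)
    define I1 where "I1 = l -` N0"
    have "openin (top_of_set UNIV) (UNIV \<inter> l -` N0)"
      by (rule continuous_openin_preimage[OF smooth_on_continuous[OF lsm] _ N0]) (use lL in auto)
    then have I1: "open I1" "0 \<in> I1" using x0(1) by (auto simp: I1_def l_def)
    have lN0: "l s \<in> N0" if "s \<in> I1" for s using that by (simp add: I1_def)
    have \<xi>sm: "smooth_on UNIV I1 \<xi>"
      unfolding \<xi>_def
      by (intro smooth_on_add smooth_on_linear_compose[OF \<pi>(1)] lsm
          smooth_on_compose[OF lsm G(1) _ N0_sub subspace_model]) (use lN0 in auto)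
    have \<xi>L: "\<xi> s \<in> ?L" if "s \<in> I1" for s
      unfolding \<xi>_def using \<pi>(2)[OF lL] G(2)[OF lN0[OF that]] by (rule subspace_add[OF subspace_model])
    have \<xi>0: "\<xi> 0 = ?x"
    proof -
      have "chart_inv M i ?x \<in> S" using chart_inv_chart[OF idx x(1)] x(3) by simp
      then show ?thesis using graph[OF x(2)] by (simp add: \<xi>_def l_def)
    qed
    have "openin (top_of_set I1) (I1 \<inter> \<xi> -` N)"
      by (rule continuous_openin_preimage[OF smooth_on_continuous[OF \<xi>sm] _ N(1)]) (use \<xi>L in auto)
    then have "open (I1 \<inter> \<xi> -` N)" using I1(1) by (rule openin_open_trans)
    moreover have "0 \<in> I1 \<inter> \<xi> -` N" using I1(2) \<xi>0 x(2) by simp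
    ultimately obtain e where e: "e > 0" "ball 0 e \<subseteq> I1 \<inter> \<xi> -` N" using open_contains_ball by metis
    have es: "s \<in> I1" "\<xi> s \<in> N" if "s \<in> {-e<..<e}" for s
    proof -
      have "s \<in> ball 0 e" using that by auto
      then show "s \<in> I1" "\<xi> s \<in> N" using e(2) by auto
    qed
    show "v \<in> tangent_sub M S x"
    proof (rule tangent_subI[where \<xi> = \<xi>, OF v i e(1) \<xi>0])
      fix s assume s: "s \<in> {-e<..<e}"
      show "\<xi> s \<in> mchart M i ` mdom M i" using es(2)[OF s] N(3) by blast
      have "\<pi> (\<xi> s) = \<pi> (l s)"
        using \<pi>(3)[OF lL] G(3)[OF lN0[OF es(1)[OF s]]] by (simp add: \<xi>_def \<pi>.add)
      moreover from this have "G (\<xi> s) = G (l s)" using fibre[OF lN0[OF es(1)[OF s]] \<xi>L[OF es(1)[OF s]]] by blast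
      ultimately have "\<xi> s = \<pi> (\<xi> s) + G (\<xi> s)" by (simp add: \<xi>_def)
      then show "chart_inv M i (\<xi> s) \<in> S" using graph[OF es(2)[OF s]] by blast
    next
      show "smooth_on UNIV {-e<..<e} \<xi>" by (rule smooth_on_mono[OF \<xi>sm]) (use es in auto)
      have "((\<lambda>s. G (l s)) has_vector_derivative deriv_on ?L G ?x (v i)) (at 0)"
        by (rule has_vector_derivative_compose_deriv[OF l' I1, where T = ?L]) (use lL DG in \<open>auto simp: l_def\<close>)
      from has_vector_derivative_add[OF \<pi>.has_vector_derivative[OF l'] this]
      show "(\<xi> has_vector_derivative v i) (at 0)" using vG unfolding \<xi>_def by simp
    qed
  qed
qed

end

lemma submanifold_graph_chart:
  fixes M :: "('i, 'a, 'e::euclidean_space) manifold"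
  assumes "S \<subseteq> points M"
    and "\<And>x. x \<in> S \<Longrightarrow> \<exists>i N N0 \<pi> G. graph_chart M S i N N0 \<pi> G \<and> x \<in> mdom M i \<and> mchart M i x \<in> N \<and> dim (\<pi> ` mmodel M) = k"
  shows "submanifold M k S"
  unfolding submanifold_def
proof (intro conjI ballI)
  fix x assume "x \<in> S"
  then obtain i N N0 \<pi> G where *: "graph_chart M S i N N0 \<pi> G" "x \<in> mdom M i" "mchart M i x \<in> N" "dim (\<pi> ` mmodel M) = k"
    using assms(2) by blast
  interpret graph_chart M S i N N0 \<pi> G by (rule *(1))
  show "\<exists>i\<in>charts_at M x. \<exists>U \<psi> K. mchart M i x \<in> U \<and> U \<subseteq> mchart M i ` mdom M i \<and> diffeo_on (mmodel M) U \<psi> \<and>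
        subspace K \<and> K \<subseteq> mmodel M \<and> dim K = k \<and> \<psi> ` (U \<inter> mchart M i ` (S \<inter> mdom M i)) = \<psi> ` U \<inter> K"
  proof (intro bexI exI conjI)
    show "i \<in> charts_at M x" using idx *(2) by (simp add: charts_at_iff)
    show "\<pi> ` mmodel M \<subseteq> mmodel M" using \<pi>(2) by auto
  qed (use *(3,4) N(3) diffeo_\<psi> subspace_image slice in auto)
qed (fact assms(1))

section \<open>Hamiltonian flows in charts\<close>

text \<open>The coordinate expression of \<open>dp \<and> dq\<close> in a cotangent chart, the
  covector being the first component.\<close>

definition symp :: "'e::euclidean_space \<times> 'e \<Rightarrow> 'e \<times> 'e \<Rightarrow> real" where
  "symp u v = fst u \<bullet> snd v - fst v \<bullet> snd u"

lemma symp_simps [simp]: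
  "symp (u + u') v = symp u v + symp u' v" "symp u (v + v') = symp u v + symp u v'"
  "symp (r *\<^sub>R u) v = r * symp u v" "symp u (r *\<^sub>R v) = r * symp u v" "symp u u = 0"
  by (simp_all add: symp_def inner_add_left inner_add_right algebra_simps)

lemma symp_commute: "symp v u = - symp u v"
  by (simp add: symp_def)

lemma symp_has_derivative:
  assumes "(f has_vector_derivative f') (at t)" "(g has_vector_derivative g') (at t)"
  shows "((\<lambda>s. symp (f s) (g s)) has_vector_derivative (symp f' (g t) + symp (f t) g')) (at t)"
proof -
  have 1: "((\<lambda>s. fst (f s)) has_vector_derivative fst f') (at t)" "((\<lambda>s. snd (f s)) has_vector_derivative snd f') (at t)"
    by (intro bounded_linear.has_vector_derivative[OF bounded_linear_fst] bounded_linear.has_vector_derivative[OF bounded_linear_snd] assms(1))+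
  have 2: "((\<lambda>s. fst (g s)) has_vector_derivative fst g') (at t)" "((\<lambda>s. snd (g s)) has_vector_derivative snd g') (at t)"
    by (intro bounded_linear.has_vector_derivative[OF bounded_linear_fst] bounded_linear.has_vector_derivative[OF bounded_linear_snd] assms(2))+
  have "((\<lambda>s. fst (f s) \<bullet> snd (g s) - fst (g s) \<bullet> snd (f s)) has_vector_derivative
     (fst (f t) \<bullet> snd g' + fst f' \<bullet> snd (g t)) - (fst (g t) \<bullet> snd f' + fst g' \<bullet> snd (f t))) (at t)"
    by (intro has_vector_derivative_diff bounded_bilinear.has_vector_derivative[OF bounded_bilinear_inner] 1 2)
  then show ?thesis unfolding symp_def by (simp add: algebra_simps)
qed

lemma symp_nondegenerate:
  assumes "subspace L" "u \<in> L \<times> L" "u' \<in> L \<times> L" "\<And>w. w \<in> L \<times> L \<Longrightarrow> symp u w = symp u' w"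
  shows "u = u'"
proof (rule prod_eqI)
  show "fst u = fst u'"
    by (rule inner_eq_on_subspace[OF assms(1)])
      (use assms(2,3) assms(4)[of "(0, _)"] subspace_0[OF assms(1)] in \<open>auto simp: symp_def\<close>)
  show "snd u = snd u'"
  proof (rule inner_eq_on_subspace[OF assms(1)])
    fix v assume "v \<in> L"
    then show "snd u \<bullet> v = snd u' \<bullet> v"
      using assms(4)[of "(v, 0)"] subspace_0[OF assms(1)] by (auto simp: symp_def inner_commute)
  qed (use assms(2,3) in auto)
qed

locale hamiltonian = smooth_atlas Q for Q :: "('i, 'q, 'e::euclidean_space) manifold" +
  fixes H :: "('i \<Rightarrow> 'e) \<times> 'q \<Rightarrow> real"
  assumes Hausdorff: "Hausdorff_space (mtop Q)"
    and H_smooth: "smooth_map (cotangent Q) real_manifold H"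
begin

sublocale C: smooth_atlas "cotangent Q" by (rule smooth_atlas_cotangent)

abbreviation LL :: "('e \<times> 'e) set" where "LL \<equiv> mmodel Q \<times> mmodel Q"

abbreviation img :: "'i \<Rightarrow> ('e \<times> 'e) set" where "img i \<equiv> mmodel Q \<times> mchart Q i ` mdom Q i"

abbreviation Hc :: "'i \<Rightarrow> 'e \<times> 'e \<Rightarrow> real" where "Hc i \<zeta> \<equiv> H (chart_inv (cotangent Q) i \<zeta>)"

lemma subspace_LL: "subspace LL"
  by (rule subspace_Times[OF subspace_model subspace_model])

lemma chart_image: "i \<in> midx Q \<Longrightarrow> mchart (cotangent Q) i ` mdom (cotangent Q) i = img i"
  using cotangent_chart_image[of i i] by simp

lemma openin_img: "i \<in> midx Q \<Longrightarrow> openin (top_of_set LL) (img i)"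
  using C.openin_image[of i] chart_image[of i] by simp

lemma img_sub: "i \<in> midx Q \<Longrightarrow> img i \<subseteq> LL"
  using openin_imp_subset[OF openin_img] .

lemma chart_inv_cot:
  assumes "i \<in> midx Q" "\<zeta> \<in> img i"
  shows "chart_inv (cotangent Q) i \<zeta> \<in> mdom (cotangent Q) i" "mchart (cotangent Q) i (chart_inv (cotangent Q) i \<zeta>) = \<zeta>"
  using chart_inv_in_mdom[of \<zeta> "cotangent Q" i] chart_chart_inv[of \<zeta> "cotangent Q" i] assms chart_image by blast+

lemma Hc_smooth:
  assumes "i \<in> midx Q" shows "smooth_on LL (img i) (Hc i)"
proof -
  have "smooth_on (mmodel (cotangent Q)) (mchart (cotangent Q) i ` (mdom (cotangent Q) i \<inter> H -` mdom real_manifold ()))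
     (mchart real_manifold () \<circ> H \<circ> chart_inv (cotangent Q) i)"
    using H_smooth assms unfolding smooth_map_def by simp
  then show ?thesis using chart_image[OF assms] by (simp add: o_def)
qed

lemma charts_at_cot:
  "i \<in> charts_at (cotangent Q) z \<Longrightarrow> i \<in> midx Q \<and> z \<in> mdom (cotangent Q) i \<and> mchart (cotangent Q) i z \<in> img i"
  using chart_image[of i] by (auto simp: charts_at_iff simp del: cotangent_simps(2,3))

lemma differential_H:
  assumes i: "i \<in> charts_at (cotangent Q) z" and w: "w \<in> tangent_space (cotangent Q) z"
  shows "differential (cotangent Q) real_manifold H z w () = deriv_on LL (Hc i) (mchart (cotangent Q) i z) (w i)"
proof (rule C.differential_eq[OF w i])
  have "{y \<in> points (cotangent Q). H y \<in> mdom real_manifold ()} = points (cotangent Q)" by simp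
  then show "openin (mtop (cotangent Q)) {y \<in> points (cotangent Q). H y \<in> mdom real_manifold ()}"
    using C.openin_points by simp
  have "(Hc i has_derivative deriv_on LL (Hc i) (mchart (cotangent Q) i z)) (at (mchart (cotangent Q) i z) within LL)"
    using charts_at_cot[OF i] by (intro smooth_on_has_derivative[OF Hc_smooth openin_img]) auto
  then show "((\<lambda>y. mchart real_manifold () (Hc i y)) has_derivative deriv_on LL (Hc i) (mchart (cotangent Q) i z))
     (at (mchart (cotangent Q) i z) within mmodel (cotangent Q))" by simp
qed simp

definition grad :: "'i \<Rightarrow> 'e \<times> 'e \<Rightarrow> 'e \<times> 'e" where "grad i \<zeta> = riesz LL (deriv_on LL (Hc i) \<zeta>)"

text \<open>Hamilton's equations \<open>p' = dH/dq\<close>, \<open>q' = - dH/dp\<close>: the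
  gradient turned by a quarter, with the sign fixed by
  \<open>symp (Xc i \<zeta>) w = dH w\<close>.\<close>

definition Xc :: "'i \<Rightarrow> 'e \<times> 'e \<Rightarrow> 'e \<times> 'e" where "Xc i \<zeta> = (snd (grad i \<zeta>), - fst (grad i \<zeta>))"

lemma Hc_deriv: "i \<in> midx Q \<Longrightarrow> \<zeta> \<in> img i \<Longrightarrow> (Hc i has_derivative deriv_on LL (Hc i) \<zeta>) (at \<zeta> within LL)"
  by (rule smooth_on_has_derivative[OF Hc_smooth openin_img])

lemma grad_inner:
  "i \<in> midx Q \<Longrightarrow> \<zeta> \<in> img i \<Longrightarrow> w \<in> LL \<Longrightarrow> grad i \<zeta> \<bullet> w = deriv_on LL (Hc i) \<zeta> w"
  unfolding grad_def by (rule riesz_inner[OF subspace_LL has_derivative_bounded_linear[OF Hc_deriv]])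

lemma symp_rotate: "symp (snd g, - fst g) w = g \<bullet> w"
  by (simp add: symp_def inner_prod_def inner_commute)

lemma symp_Xc:
  "i \<in> midx Q \<Longrightarrow> \<zeta> \<in> img i \<Longrightarrow> w \<in> LL \<Longrightarrow> symp (Xc i \<zeta>) w = deriv_on LL (Hc i) \<zeta> w"
  unfolding Xc_def symp_rotate by (rule grad_inner)

lemma Xc_in: "Xc i \<zeta> \<in> LL"
  using riesz_in[OF subspace_LL, of "deriv_on LL (Hc i) \<zeta>"] subspace_neg[OF subspace_model]
  by (auto simp: Xc_def grad_def mem_Times_iff)

lemma grad_smooth: "i \<in> midx Q \<Longrightarrow> smooth_on LL (img i) (grad i)"
  unfolding grad_def
  by (intro smooth_on_riesz subspace_LL smooth_on_deriv_on Hc_smooth openin_img)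

lemma bounded_linear_rotate: "bounded_linear (\<lambda>g :: 'e \<times> 'e. (snd g, - fst g))"
  by (intro bounded_linear_Pair bounded_linear_snd bounded_linear_minus bounded_linear_fst)

lemma Xc_smooth: "i \<in> midx Q \<Longrightarrow> smooth_on LL (img i) (Xc i)"
  unfolding Xc_def by (rule smooth_on_linear_compose[OF bounded_linear_rotate grad_smooth])

text \<open>The linearised field is hamiltonian for the second derivative of \<open>H\<close>, which is symmetric.\<close>

lemma symp_deriv_Xc:
  assumes i: "i \<in> midx Q" and \<zeta>: "\<zeta> \<in> img i" and u: "u \<in> LL" and v: "v \<in> LL"
  shows "symp (deriv_on LL (Xc i) \<zeta> u) v + symp u (deriv_on LL (Xc i) \<zeta> v) = 0"
proof -
  have \<zeta>L: "\<zeta> \<in> LL" using img_sub[OF i] \<zeta> by blast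
  have g: "(grad i has_derivative deriv_on LL (grad i) \<zeta>) (at \<zeta> within LL)"
    by (rule smooth_on_has_derivative[OF grad_smooth[OF i] openin_img[OF i] \<zeta>])
  have X: "deriv_on LL (Xc i) \<zeta> w = (snd (deriv_on LL (grad i) \<zeta> w), - fst (deriv_on LL (grad i) \<zeta> w))" if "w \<in> LL" for w
    using deriv_on_linear_compose[OF bounded_linear_rotate g subspace_LL \<zeta>L that] unfolding Xc_def[abs_def] by simp
  have *: "symp (deriv_on LL (Xc i) \<zeta> a) b = deriv_on LL (\<lambda>y. deriv_on LL (Hc i) y b) \<zeta> a" if "a \<in> LL" "b \<in> LL" for a b
  proof -
    have "((\<lambda>y. grad i y \<bullet> b) has_derivative (\<lambda>a. deriv_on LL (grad i) \<zeta> a \<bullet> b)) (at \<zeta> within LL)"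
      by (rule bounded_linear.has_derivative[OF bounded_linear_inner_left g])
    then have "((\<lambda>y. deriv_on LL (Hc i) y b) has_derivative (\<lambda>a. deriv_on LL (grad i) \<zeta> a \<bullet> b)) (at \<zeta> within LL)"
      by (rule has_derivative_cong_openin[OF _ openin_img[OF i] \<zeta>]) (rule grad_inner[OF i _ that(2)])
    from deriv_on_eq[OF this subspace_LL \<zeta>L that(1)] show ?thesis unfolding X[OF that(1)] symp_rotate by simp
  qed
  have "deriv_on LL (\<lambda>y. deriv_on LL (Hc i) y v) \<zeta> u = deriv_on LL (\<lambda>y. deriv_on LL (Hc i) y u) \<zeta> v"
    by (rule second_deriv_on_symmetric[OF Hc_smooth[OF i] openin_img[OF i] subspace_LL v u \<zeta>])
  then show ?thesis
    using *[OF u v] *[OF v u] symp_commute[of u "deriv_on LL (Xc i) \<zeta> v"] by simp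
qed

abbreviation X :: "('i \<Rightarrow> 'e) \<times> 'q \<Rightarrow> 'i \<Rightarrow> 'e \<times> 'e" where "X \<equiv> ham_field Q H"

text \<open>Existence comes from prescribing the coordinates \<open>Xc\<close> in one chart,
  uniqueness from nondegeneracy of the form; only both together give the description by
  \<open>THE\<close> a meaning.\<close>

lemma ham_field:
  assumes i: "i \<in> charts_at (cotangent Q) z"
  shows "X z \<in> tangent_space (cotangent Q) z" "X z i = Xc i (mchart (cotangent Q) i z)"
proof -
  let ?\<zeta> = "mchart (cotangent Q) i z"
  let ?P = "\<lambda>v. v \<in> tangent_space (cotangent Q) z \<and>
        (\<forall>w\<in>tangent_space (cotangent Q) z. canonical_form Q z v w = differential (cotangent Q) real_manifold H z w ())"
  have i': "i \<in> midx Q" "?\<zeta> \<in> img i" using charts_at_cot[OF i] by auto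
  have form: "canonical_form Q z v w = symp (v i) (w i)"
    if "v \<in> tangent_space (cotangent Q) z" "w \<in> tangent_space (cotangent Q) z" for v w
    using canonical_form_chart[OF i that] by (simp add: symp_def)
  have dH: "differential (cotangent Q) real_manifold H z w () = symp (Xc i ?\<zeta>) (w i)"
    if w: "w \<in> tangent_space (cotangent Q) z" for w
    using differential_H[OF i w] symp_Xc[OF i', of "w i"] tangent_space_in_model[OF w i] by simp
  obtain v where v: "v \<in> tangent_space (cotangent Q) z" "v i = Xc i ?\<zeta>"
    using C.tangent_vector_exists[OF i, of "Xc i ?\<zeta>"] Xc_in[of i ?\<zeta>] by auto
  have Pv: "?P v" using v form dH by simp
  have "v' = v" if Pv': "?P v'" for v'
  proof (rule C.tangent_space_eqI[OF _ v(1) i])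
    show "v' \<in> tangent_space (cotangent Q) z" using Pv' by blast
    show "v' i = v i"
    proof (rule symp_nondegenerate[OF subspace_model])
      show "v' i \<in> LL" "v i \<in> LL"
        using tangent_space_in_model[OF _ i, of v'] tangent_space_in_model[OF v(1) i] Pv' by auto
      fix w :: "'e \<times> 'e" assume "w \<in> LL"
      then obtain w' where w': "w' \<in> tangent_space (cotangent Q) z" "w' i = w"
        using C.tangent_vector_exists[OF i, of w] by auto
      show "symp (v' i) w = symp (v i) w"
        using Pv' Pv w' form[OF _ w'(1)] by metis
    qed
  qed
  with Pv have "X z = v" unfolding hamiltonian_field_def by (rule the_equality[of ?P v])
  then show "X z \<in> tangent_space (cotangent Q) z" "X z i = Xc i ?\<zeta>" using v by auto
qed

section \<open>Integral curves and the flow\<close>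

lemma integral_curve_chart_nbhd:
  assumes c: "integral_curve (cotangent Q) X I c" and t: "t \<in> I" and U: "openin (mtop (cotangent Q)) U" "c t \<in> U"
  obtains J where "open J" "t \<in> J" "J \<subseteq> I" "c ` J \<subseteq> U"
proof -
  have "openin (top_of_set I) {s \<in> topspace (top_of_set I). c s \<in> U}"
    using c U(1) unfolding integral_curve_def by (intro openin_continuous_map_preimage) auto
  then have "open {s \<in> I. c s \<in> U}"
    using c openin_open_trans unfolding integral_curve_def by auto
  then show thesis using that[of "{s \<in> I. c s \<in> U}"] t U(2) by auto
qed

lemma integral_curve_in_points:
  assumes "integral_curve (cotangent Q) X I c" "t \<in> I"
  shows "c t \<in> points (cotangent Q)"
  using assms continuous_map_image_subset_topspace[of "top_of_set I" "mtop (cotangent Q)" c]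
  unfolding integral_curve_def C.topspace_mtop by auto

lemma integral_curve_deriv:
  assumes "integral_curve (cotangent Q) X I c" "t \<in> I" "i \<in> charts_at (cotangent Q) (c t)"
  shows "((\<lambda>s. mchart (cotangent Q) i (c s)) has_vector_derivative Xc i (mchart (cotangent Q) i (c t))) (at t)"
  using assms unfolding integral_curve_def o_def ham_field(2)[OF assms(3), symmetric] by blast

text \<open>The set of times of agreement is open by uniqueness for the equation in a chart, its
  complement is open because the cotangent bundle is Hausdorff, and an interval is
  connected.\<close>

lemma integral_curve_unique:
  assumes c1: "integral_curve (cotangent Q) X I1 c1" and c2: "integral_curve (cotangent Q) X I2 c2"
    and 0: "0 \<in> I1" "0 \<in> I2" "c1 0 = c2 0" and t: "t \<in> I1" "t \<in> I2"
  shows "c1 t = c2 t"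
proof -
  define I where "I = I1 \<inter> I2"
  have I: "open I" "is_interval I" using c1 c2 unfolding integral_curve_def I_def
    by (auto intro: is_interval_Int)
  define E where "E = {s \<in> I. c1 s = c2 s}"
  have "open E"
    unfolding open_subopen[of E]
  proof
    fix s assume s: "s \<in> E"
    then have sI: "s \<in> I1" "s \<in> I2" "c1 s = c2 s" by (auto simp: E_def I_def)
    obtain i where i: "i \<in> charts_at (cotangent Q) (c1 s)"
      using integral_curve_in_points[OF c1 sI(1)] unfolding points_iff by blast
    have iQ: "i \<in> midx Q" "c1 s \<in> mdom (cotangent Q) i" using charts_at_cot[OF i] by auto
    have opn: "openin (mtop (cotangent Q)) (mdom (cotangent Q) i)" by (rule C.openin_mdom) (simp add: iQ)
    obtain J1 where J1: "open J1" "s \<in> J1" "J1 \<subseteq> I1" "c1 ` J1 \<subseteq> mdom (cotangent Q) i"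
      using integral_curve_chart_nbhd[OF c1 sI(1) opn iQ(2)] by metis
    obtain J2 where J2: "open J2" "s \<in> J2" "J2 \<subseteq> I2" "c2 ` J2 \<subseteq> mdom (cotangent Q) i"
      using integral_curve_chart_nbhd[OF c2 sI(2) opn] iQ(2) sI(3) by metis
    have J: "open (J1 \<inter> J2)" "s \<in> J1 \<inter> J2" using J1 J2 by auto
    have ch1: "i \<in> charts_at (cotangent Q) (c1 r)" and ch2: "i \<in> charts_at (cotangent Q) (c2 r)" if "r \<in> J1 \<inter> J2" for r
      using that J1(4) J2(4) iQ(1) by (auto simp: charts_at_iff simp del: cotangent_simps(2))
    have m1: "mchart (cotangent Q) i (c1 r) \<in> img i" and m2: "mchart (cotangent Q) i (c2 r) \<in> img i" if "r \<in> J1 \<inter> J2" for r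
      using charts_at_cot[OF ch1[OF that]] charts_at_cot[OF ch2[OF that]] by auto
    have d1: "((\<lambda>s. mchart (cotangent Q) i (c1 s)) has_vector_derivative Xc i (mchart (cotangent Q) i (c1 r))) (at r)"
      and d2: "((\<lambda>s. mchart (cotangent Q) i (c2 s)) has_vector_derivative Xc i (mchart (cotangent Q) i (c2 r))) (at r)"
      if "r \<in> J1 \<inter> J2" for r
      using that J1(3) J2(3) integral_curve_deriv[OF c1 _ ch1[OF that]] integral_curve_deriv[OF c2 _ ch2[OF that]] by auto
    have "mchart (cotangent Q) i (c1 s) = mchart (cotangent Q) i (c2 s)" using sI(3) by simp
    from ode_locally_unique[OF subspace_LL openin_img[OF iQ(1)] Xc_smooth[OF iQ(1)] J m1 d1 m2 d2 this]
    obtain d where d: "d > 0" "\<And>r. \<bar>r - s\<bar> < d \<Longrightarrow> mchart (cotangent Q) i (c1 r) = mchart (cotangent Q) i (c2 r)"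
      by metis
    have "c1 r = c2 r" if "r \<in> ball s d \<inter> (J1 \<inter> J2)" for r
      using inj_onD[OF C.inj_chart[of i] d(2)[of r]] that J1(4) J2(4) iQ(1) by (auto simp: dist_real_def abs_minus_commute simp del: cotangent_simps(2))
    then have "ball s d \<inter> (J1 \<inter> J2) \<subseteq> E" using J1(3) J2(3) by (auto simp: E_def I_def)
    moreover have "open (ball s d \<inter> (J1 \<inter> J2))" "s \<in> ball s d \<inter> (J1 \<inter> J2)" using J d(1) by auto
    ultimately show "\<exists>T. open T \<and> s \<in> T \<and> T \<subseteq> E" by blast
  qed
  moreover have "open (I - E)"
    unfolding open_subopen[of "I - E"]
  proof
    fix s assume s: "s \<in> I - E"
    then have sI: "s \<in> I1" "s \<in> I2" "c1 s \<noteq> c2 s" by (auto simp: E_def I_def)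
    obtain U V where UV: "openin (mtop (cotangent Q)) U" "openin (mtop (cotangent Q)) V" "c1 s \<in> U" "c2 s \<in> V" "disjnt U V"
      using Hausdorff_cotangent[OF Hausdorff] sI(3) integral_curve_in_points[OF c1 sI(1)] integral_curve_in_points[OF c2 sI(2)]
      unfolding Hausdorff_space_def C.topspace_mtop by blast
    obtain J1 where J1: "open J1" "s \<in> J1" "J1 \<subseteq> I1" "c1 ` J1 \<subseteq> U"
      using integral_curve_chart_nbhd[OF c1 sI(1) UV(1,3)] by metis
    obtain J2 where J2: "open J2" "s \<in> J2" "J2 \<subseteq> I2" "c2 ` J2 \<subseteq> V"
      using integral_curve_chart_nbhd[OF c2 sI(2) UV(2,4)] by metis
    have "c1 r \<noteq> c2 r" if "r \<in> J1" "r \<in> J2" for r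
    proof -
      have "c1 r \<in> U" "c2 r \<in> V" using that J1(4) J2(4) by auto
      then show ?thesis using UV(5) unfolding disjnt_iff by metis
    qed
    then have "J1 \<inter> J2 \<subseteq> I - E" using J1(3) J2(3) by (auto simp: E_def I_def)
    moreover have "open (J1 \<inter> J2)" "s \<in> J1 \<inter> J2" using J1 J2 by auto
    ultimately show "\<exists>T. open T \<and> s \<in> T \<and> T \<subseteq> I - E" by blast
  qed
  moreover have "connected I" using I(2) by (rule is_interval_connected)
  moreover have "E \<inter> (I - E) \<inter> I = {}" "I \<subseteq> E \<union> (I - E)" "E \<inter> I \<noteq> {}" using 0 by (auto simp: E_def I_def)
  ultimately have "(I - E) \<inter> I = {}" using connectedD[of I E "I - E"] by blast
  then show ?thesis using t by (auto simp: E_def I_def)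
qed

lemma flow_eq:
  assumes "integral_curve (cotangent Q) X I c" "0 \<in> I" "t \<in> I"
  shows "flow (cotangent Q) X t (c 0) = c t"
  unfolding flow_def
proof (rule the_equality)
  show "\<exists>J d. integral_curve (cotangent Q) X J d \<and> 0 \<in> J \<and> t \<in> J \<and> d 0 = c 0 \<and> d t = c t" using assms by blast
  fix y assume "\<exists>J d. integral_curve (cotangent Q) X J d \<and> 0 \<in> J \<and> t \<in> J \<and> d 0 = c 0 \<and> d t = y"
  then show "y = c t" using integral_curve_unique[OF _ assms(1)] assms(2,3) by metis
qed

lemma flow_interval_iff:
  "t \<in> flow_interval (cotangent Q) X z \<longleftrightarrow> (\<exists>I c. integral_curve (cotangent Q) X I c \<and> c 0 = z \<and> 0 \<in> I \<and> t \<in> I)"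
  unfolding flow_interval_def by blast

text \<open>The time bound is uniform on \<open>D\<close> and the images stay in the chart, so a
  single chart of the morphism space describes the evolution relation over the whole box.\<close>

definition flow_box :: "'i \<Rightarrow> real \<Rightarrow> ('e \<times> 'e) set \<Rightarrow> (('e \<times> 'e) \<times> real \<Rightarrow> 'e \<times> 'e) \<Rightarrow> bool" where
  "flow_box i e D \<Phi> \<longleftrightarrow> i \<in> midx Q \<and> e > 0 \<and> openin (top_of_set LL) D \<and> D \<subseteq> img i \<and>
     (\<forall>\<zeta>\<in>D. \<Phi> (\<zeta>, 0) = \<zeta>) \<and>
     (\<forall>\<zeta>\<in>D. \<forall>t\<in>{-e<..<e}. \<Phi> (\<zeta>, t) \<in> img i) \<and>
     (\<forall>\<zeta>\<in>D. \<forall>t\<in>{-e<..<e}. ((\<lambda>t. \<Phi> (\<zeta>, t)) has_vector_derivative Xc i (\<Phi> (\<zeta>, t))) (at t)) \<and>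
     smooth_on (LL \<times> UNIV) (D \<times> {-e<..<e}) \<Phi>"

lemma flow_box_exists:
  assumes "i \<in> midx Q" "\<zeta> \<in> img i"
  obtains e D \<Phi> where "flow_box i e D \<Phi>" "\<zeta> \<in> D"
proof -
  have X: "Xc i ` img i \<subseteq> LL" using Xc_in by blast
  show thesis
  proof (rule local_flow[OF subspace_LL openin_img[OF assms(1)] Xc_smooth[OF assms(1)] X assms(2)])
    fix e r :: real and \<Phi>
    assume *: "e > 0" "r > 0" "LL \<inter> ball \<zeta> r \<subseteq> img i"
      "\<And>x. x \<in> LL \<inter> ball \<zeta> r \<Longrightarrow> \<Phi> (x, 0) = x"
      "\<And>x t. x \<in> LL \<inter> ball \<zeta> r \<Longrightarrow> t \<in> {-e<..<e} \<Longrightarrow> \<Phi> (x, t) \<in> img i"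
      "\<And>x t. x \<in> LL \<inter> ball \<zeta> r \<Longrightarrow> t \<in> {-e<..<e} \<Longrightarrow>
         ((\<lambda>t. \<Phi> (x, t)) has_vector_derivative Xc i (\<Phi> (x, t))) (at t)"
      "smooth_on (LL \<times> UNIV) ((LL \<inter> ball \<zeta> r) \<times> {-e<..<e}) \<Phi>"
    have "openin (top_of_set LL) (LL \<inter> ball \<zeta> r)" by (rule openin_open_Int[OF open_ball])
    then have "flow_box i e (LL \<inter> ball \<zeta> r) \<Phi>"
      unfolding flow_box_def by (intro conjI ballI *(1,3,4,5,6,7) assms(1))
    moreover have "\<zeta> \<in> LL \<inter> ball \<zeta> r" using assms(2) img_sub[OF assms(1)] *(2) by auto
    ultimately show thesis by (rule that)
  qed
qed

text \<open>The curve \<open>t \<mapsto> \<Phi> (\<zeta>, t)\<close>, read back through the chart,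
  is an integral curve on the manifold, so uniqueness identifies it with the flow.\<close>

lemma flow_box_flow:
  assumes b: "flow_box i e D \<Phi>" and z: "z \<in> mdom (cotangent Q) i" "mchart (cotangent Q) i z \<in> D" and t: "t \<in> {-e<..<e}"
  shows "t \<in> flow_interval (cotangent Q) X z"
    "flow (cotangent Q) X t z = chart_inv (cotangent Q) i (\<Phi> (mchart (cotangent Q) i z, t))"
proof -
  let ?\<zeta> = "mchart (cotangent Q) i z" and ?I = "{-e<..<e}"
  have i: "i \<in> midx Q" and e: "e > 0" using b by (auto simp: flow_box_def)
  have im: "\<Phi> (?\<zeta>, s) \<in> img i" and d: "((\<lambda>t. \<Phi> (?\<zeta>, t)) has_vector_derivative Xc i (\<Phi> (?\<zeta>, s))) (at s)" if "s \<in> ?I" for s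
    using b z(2) that unfolding flow_box_def by blast+
  have imL: "\<Phi> (?\<zeta>, s) \<in> mmodel (cotangent Q)" if "s \<in> ?I" for s
    unfolding cotangent_simps(4) by (rule subsetD[OF img_sub[OF i] im[OF that]])
  define c where "c s = chart_inv (cotangent Q) i (\<Phi> (?\<zeta>, s))" for s
  have cd: "c s \<in> mdom (cotangent Q) i" "mchart (cotangent Q) i (c s) = \<Phi> (?\<zeta>, s)" if "s \<in> ?I" for s
    unfolding c_def using chart_inv_cot[OF i im[OF that]] .
  have ci: "i \<in> charts_at (cotangent Q) (c s)" if "s \<in> ?I" for s
    using cd(1)[OF that] i by (auto simp: charts_at_iff simp del: cotangent_simps(2))
  have c0: "c 0 = z"
  proof -
    have "\<Phi> (?\<zeta>, 0) = ?\<zeta>" using b z(2) by (simp add: flow_box_def)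
    then show ?thesis unfolding c_def using C.chart_inv_chart[of i z] i z(1) by simp
  qed
  have "integral_curve (cotangent Q) X ?I c"
    unfolding integral_curve_def
  proof (intro conjI ballI)
    show "open ?I" "is_interval ?I" by (auto simp: is_interval_oo)
    have cont: "continuous_on ?I (\<lambda>s. \<Phi> (?\<zeta>, s))"
      using d has_vector_derivative_continuous by (intro continuous_at_imp_continuous_on) blast
    show "continuous_map (top_of_set ?I) (mtop (cotangent Q)) c"
      unfolding continuous_map_def
    proof (intro conjI allI impI)
      show "c \<in> topspace (top_of_set ?I) \<rightarrow> topspace (mtop (cotangent Q))"
      proof
        fix s assume "s \<in> topspace (top_of_set ?I)"
        then show "c s \<in> topspace (mtop (cotangent Q))" unfolding C.topspace_mtop points_iff using ci[of s] by auto
      qed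
      fix U assume U: "openin (mtop (cotangent Q)) U"
      have "{s \<in> ?I. c s \<in> U} = ?I \<inter> (\<lambda>s. \<Phi> (?\<zeta>, s)) -` (mchart (cotangent Q) i ` (U \<inter> mdom (cotangent Q) i))"
      proof (intro subset_antisym subsetI)
        fix s assume "s \<in> {s \<in> ?I. c s \<in> U}"
        then have s: "s \<in> ?I" "c s \<in> U" by auto
        then have "mchart (cotangent Q) i (c s) \<in> mchart (cotangent Q) i ` (U \<inter> mdom (cotangent Q) i)"
          using cd(1) by blast
        then show "s \<in> ?I \<inter> (\<lambda>s. \<Phi> (?\<zeta>, s)) -` (mchart (cotangent Q) i ` (U \<inter> mdom (cotangent Q) i))"
          using s cd(2) by simp
      next
        fix s assume "s \<in> ?I \<inter> (\<lambda>s. \<Phi> (?\<zeta>, s)) -` (mchart (cotangent Q) i ` (U \<inter> mdom (cotangent Q) i))"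
        then obtain y where s: "s \<in> ?I" and y: "y \<in> U" "y \<in> mdom (cotangent Q) i" "\<Phi> (?\<zeta>, s) = mchart (cotangent Q) i y" by blast
        then have "c s = y" unfolding c_def using C.chart_inv_chart[of i y] i by simp
        then show "s \<in> {s \<in> ?I. c s \<in> U}" using s y by simp
      qed
      moreover have "openin (top_of_set ?I) (?I \<inter> (\<lambda>s. \<Phi> (?\<zeta>, s)) -` (mchart (cotangent Q) i ` (U \<inter> mdom (cotangent Q) i)))"
      proof (rule continuous_openin_preimage[OF cont])
        show "(\<lambda>s. \<Phi> (?\<zeta>, s)) \<in> ?I \<rightarrow> mmodel (cotangent Q)" using imL by blast
        show "openin (top_of_set (mmodel (cotangent Q))) (mchart (cotangent Q) i ` (U \<inter> mdom (cotangent Q) i))"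
          using U i unfolding C.openin_mtop by (simp del: cotangent_simps(2))
      qed
      ultimately show "openin (top_of_set ?I) {s \<in> topspace (top_of_set ?I). c s \<in> U}" by simp
    qed
    \<comment> \<open>An integral curve must have the right velocity in every chart at the point and
      not only in \<open>i\<close>; the transition derivative carries the coordinates of
      \<open>X\<close> along.\<close>
    fix s j assume s: "s \<in> ?I" and j: "j \<in> charts_at (cotangent Q) (c s)"
    have "((\<lambda>r. (mchart (cotangent Q) j \<circ> chart_inv (cotangent Q) i) (\<Phi> (?\<zeta>, r))) has_vector_derivative
       transition_deriv (cotangent Q) (c s) i j (Xc i (\<Phi> (?\<zeta>, s)))) (at s)"
    proof (rule has_vector_derivative_compose_deriv[OF d[OF s]])
      show "(\<lambda>r. \<Phi> (?\<zeta>, r)) ` ?I \<subseteq> mmodel (cotangent Q)" using imL by blast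
      show "((mchart (cotangent Q) j \<circ> chart_inv (cotangent Q) i) has_derivative transition_deriv (cotangent Q) (c s) i j)
         (at (\<Phi> (?\<zeta>, s)) within mmodel (cotangent Q))"
        using C.transition_has_derivative[OF ci[OF s] j] cd(2)[OF s] by simp
    qed (use s in auto)
    moreover have "Xc i (\<Phi> (?\<zeta>, s)) = X (c s) i" using ham_field(2)[OF ci[OF s]] cd(2)[OF s] by simp
    moreover have "transition_deriv (cotangent Q) (c s) i j (X (c s) i) = X (c s) j"
      by (rule tangent_space_transition[OF ham_field(1)[OF j] ci[OF s] j])
    ultimately show "((mchart (cotangent Q) j \<circ> c) has_vector_derivative X (c s) j) (at s)"
      unfolding c_def by (simp add: o_def)
  qed
  moreover have "0 \<in> ?I" using e by simp
  ultimately show "t \<in> flow_interval (cotangent Q) X z"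
    "flow (cotangent Q) X t z = chart_inv (cotangent Q) i (\<Phi> (?\<zeta>, t))"
    using flow_eq[of ?I c t] c0 t unfolding flow_interval_iff c_def[of t, symmetric] by blast+
qed

section \<open>The derivative of the local flow\<close>

context
  fixes i e D \<Phi> assumes b: "flow_box i e D \<Phi>"
begin

lemma flow_box_open: "openin (top_of_set (LL \<times> UNIV)) (D \<times> {-e<..<e})"
  using b by (intro openin_Times) (auto simp: flow_box_def)

lemma flow_box_image: "\<Phi> ` (D \<times> {-e<..<e}) \<subseteq> LL"
proof (rule image_subsetI)
  fix p assume "p \<in> D \<times> {-e<..<e}"
  then have "\<Phi> (fst p, snd p) \<in> img i" using b unfolding flow_box_def by (metis mem_Times_iff)
  then show "\<Phi> p \<in> LL" using img_sub[of i] b unfolding flow_box_def by auto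
qed

lemma flow_box_subspace: "subspace (LL \<times> (UNIV :: real set))"
  by (rule subspace_Times[OF subspace_LL subspace_UNIV])

lemma flow_box_has_derivative:
  assumes "\<zeta> \<in> D" "t \<in> {-e<..<e}"
  shows "(\<Phi> has_derivative deriv_on (LL \<times> UNIV) \<Phi> (\<zeta>, t)) (at (\<zeta>, t) within LL \<times> UNIV)"
  using b assms by (intro smooth_on_has_derivative[OF _ flow_box_open]) (auto simp: flow_box_def)

lemma flow_box_deriv_in:
  assumes "\<zeta> \<in> D" "t \<in> {-e<..<e}" "w \<in> LL \<times> UNIV"
  shows "deriv_on (LL \<times> UNIV) \<Phi> (\<zeta>, t) w \<in> LL"
proof (rule deriv_on_in_subspace[OF flow_box_has_derivative[OF assms(1,2)] flow_box_open _ _ subspace_LL flow_box_subspace assms(3)])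
  show "\<Phi> ` (D \<times> {-e<..<e}) \<subseteq> LL" by (rule flow_box_image)
qed (use assms in auto)

lemma flow_box_time_deriv:
  assumes "\<zeta> \<in> D" "t \<in> {-e<..<e}"
  shows "deriv_on (LL \<times> UNIV) \<Phi> (\<zeta>, t) (0, \<tau>) = \<tau> *\<^sub>R Xc i (\<Phi> (\<zeta>, t))"
proof -
  interpret bounded_linear "deriv_on (LL \<times> UNIV) \<Phi> (\<zeta>, t)"
    by (rule has_derivative_bounded_linear[OF flow_box_has_derivative[OF assms]])
  have \<zeta>: "\<zeta> \<in> LL" "0 \<in> LL" using b assms(1) openin_imp_subset subspace_0[OF subspace_LL] unfolding flow_box_def by blast+
  have "((\<lambda>s. \<Phi> (\<zeta>, s)) has_vector_derivative deriv_on (LL \<times> UNIV) \<Phi> (\<zeta>, t) (0, 1)) (at t)"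
    by (rule has_vector_derivative_compose_deriv[where I = UNIV and T = "LL \<times> UNIV"])
      (use \<zeta>(1) flow_box_has_derivative[OF assms] in \<open>auto intro!: derivative_eq_intros has_vector_derivative_Pair\<close>)
  moreover have "((\<lambda>s. \<Phi> (\<zeta>, s)) has_vector_derivative Xc i (\<Phi> (\<zeta>, t))) (at t)"
    using b assms unfolding flow_box_def by blast
  ultimately have "deriv_on (LL \<times> UNIV) \<Phi> (\<zeta>, t) (0, 1) = Xc i (\<Phi> (\<zeta>, t))" by (rule vector_derivative_unique_at)
  then show ?thesis using scaleR[of \<tau> "(0, 1)"] by simp
qed

lemma flow_box_initial_deriv:
  assumes "\<zeta> \<in> D" "w \<in> LL"
  shows "deriv_on (LL \<times> UNIV) \<Phi> (\<zeta>, 0) (w, 0) = w"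
proof -
  have e: "0 \<in> {-e<..<e}" using b by (auto simp: flow_box_def)
  have D: "openin (top_of_set LL) D" and id: "\<And>x. x \<in> D \<Longrightarrow> \<Phi> (x, 0) = x" using b by (auto simp: flow_box_def)
  have 1: "((\<lambda>x. \<Phi> (x, 0)) has_derivative (\<lambda>w. deriv_on (LL \<times> UNIV) \<Phi> (\<zeta>, 0) (w, 0))) (at \<zeta> within LL)"
    by (rule has_derivative_compose_openin[OF _ D assms(1), where f = "\<lambda>x. (x, 0)" and T = "LL \<times> UNIV"])
      (use flow_box_has_derivative[OF assms(1) e] openin_imp_subset[OF D] in \<open>auto intro!: derivative_eq_intros\<close>)
  have 2: "((\<lambda>x. \<Phi> (x, 0)) has_derivative (\<lambda>w. w)) (at \<zeta> within LL)"
    by (rule has_derivative_cong_openin[OF has_derivative_ident D assms(1)]) (simp add: id)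
  show ?thesis
    using deriv_on_unique[OF 1 2 subspace_LL _ assms(2)] assms(1) openin_imp_subset[OF D] by blast
qed

lemma flow_box_symplectic:
  assumes \<zeta>: "\<zeta> \<in> D" and t: "t \<in> {-e<..<e}" and w: "w \<in> LL" "w' \<in> LL"
  shows "symp (deriv_on (LL \<times> UNIV) \<Phi> (\<zeta>, t) (w, 0)) (deriv_on (LL \<times> UNIV) \<Phi> (\<zeta>, t) (w', 0)) = symp w w'"
proof -
  let ?K = "LL \<times> (UNIV :: real set)" and ?I = "{-e<..<e}"
  let ?W = "\<lambda>w s. deriv_on ?K \<Phi> (\<zeta>, s) (w, 0)"
  have i: "i \<in> midx Q" and e: "e > 0" and sm: "smooth_on ?K (D \<times> ?I) \<Phi>"
    and im: "\<And>\<zeta> s. \<zeta> \<in> D \<Longrightarrow> s \<in> ?I \<Longrightarrow> \<Phi> (\<zeta>, s) \<in> img i" using b unfolding flow_box_def by blast+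
  have DL: "D \<subseteq> LL" using b openin_imp_subset unfolding flow_box_def by blast
  \<comment> \<open>Exchanging the time derivative with the derivative in direction \<open>w\<close>
    turns the equation for \<open>\<Phi>\<close> into the linearised equation for its
    derivative.\<close>
  have variational: "(?W w has_vector_derivative deriv_on LL (Xc i) (\<Phi> (\<zeta>, s)) (?W w s)) (at s)" if s: "s \<in> ?I" and w: "w \<in> LL" for s w
  proof -
    have wK: "(w, 0) \<in> ?K" "(0, 1) \<in> ?K" using w subspace_0[OF subspace_LL] by auto
    have p: "(\<zeta>, s) \<in> D \<times> ?I" "(\<zeta>, s) \<in> ?K" using \<zeta> s DL by auto
    have dW: "((\<lambda>p. deriv_on ?K \<Phi> p (w, 0)) has_derivative deriv_on ?K (\<lambda>p. deriv_on ?K \<Phi> p (w, 0)) (\<zeta>, s)) (at (\<zeta>, s) within ?K)"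
      by (rule smooth_on_has_derivative[OF smooth_on_deriv_on[OF sm flow_box_open flow_box_subspace wK(1)] flow_box_open p(1)])
    have "((\<lambda>s. (\<lambda>p. deriv_on ?K \<Phi> p (w, 0)) (\<zeta>, s)) has_vector_derivative deriv_on ?K (\<lambda>p. deriv_on ?K \<Phi> p (w, 0)) (\<zeta>, s) (0, 1)) (at s)"
      by (rule has_vector_derivative_compose_deriv[where I = UNIV and T = ?K])
        (use p(2) dW in \<open>auto intro!: derivative_eq_intros has_vector_derivative_Pair\<close>)
    moreover have "deriv_on ?K (\<lambda>p. deriv_on ?K \<Phi> p (w, 0)) (\<zeta>, s) (0, 1) = deriv_on ?K (\<lambda>p. deriv_on ?K \<Phi> p (0, 1)) (\<zeta>, s) (w, 0)"
      by (rule second_deriv_on_symmetric[OF sm flow_box_open flow_box_subspace wK p(1)])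
    moreover have "deriv_on ?K (\<lambda>p. deriv_on ?K \<Phi> p (0, 1)) (\<zeta>, s) (w, 0) = deriv_on LL (Xc i) (\<Phi> (\<zeta>, s)) (?W w s)"
    proof -
      have "((\<lambda>p. Xc i (\<Phi> p)) has_derivative (\<lambda>v. deriv_on LL (Xc i) (\<Phi> (\<zeta>, s)) (deriv_on ?K \<Phi> (\<zeta>, s) v))) (at (\<zeta>, s) within ?K)"
      proof (rule has_derivative_compose_openin[OF flow_box_has_derivative[OF \<zeta> s] flow_box_open p(1)])
        show "\<Phi> ` (D \<times> ?I) \<subseteq> LL" by (rule flow_box_image)
        show "(Xc i has_derivative deriv_on LL (Xc i) (\<Phi> (\<zeta>, s))) (at (\<Phi> (\<zeta>, s)) within LL)"
          by (rule smooth_on_has_derivative[OF Xc_smooth[OF i] openin_img[OF i] im[OF \<zeta> s]])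
      qed
      then have "((\<lambda>p. deriv_on ?K \<Phi> p (0, 1)) has_derivative (\<lambda>v. deriv_on LL (Xc i) (\<Phi> (\<zeta>, s)) (deriv_on ?K \<Phi> (\<zeta>, s) v))) (at (\<zeta>, s) within ?K)"
      proof (rule has_derivative_cong_openin[OF _ flow_box_open p(1)])
        fix p assume "p \<in> D \<times> ?I"
        then show "Xc i (\<Phi> p) = deriv_on ?K \<Phi> p (0, 1)" using flow_box_time_deriv[of "fst p" "snd p" 1] by auto
      qed
      from deriv_on_eq[OF this flow_box_subspace p(2) wK(1)] show ?thesis .
    qed
    ultimately show ?thesis by simp
  qed
  have d: "((\<lambda>s. symp (?W w s) (?W w' s)) has_vector_derivative 0) (at s)" if s: "s \<in> ?I" for s
  proof -
    have "?W w s \<in> LL" "?W w' s \<in> LL" using flow_box_deriv_in[OF \<zeta> s] w by auto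
    from symp_has_derivative[OF variational[OF s w(1)] variational[OF s w(2)]] symp_deriv_Xc[OF i im[OF \<zeta> s] this]
    show ?thesis by simp
  qed
  have "symp (?W w t) (?W w' t) = symp (?W w 0) (?W w' 0)"
    by (rule has_derivative_zero_unique[of ?I "\<lambda>s. symp (?W w s) (?W w' s)"])
      (use d t e in \<open>auto simp: has_vector_derivative_def intro: has_derivative_at_withinI\<close>)
  then show ?thesis using flow_box_initial_deriv[OF \<zeta>] w by simp
qed

end

end

section \<open>Zero sections\<close>

context smooth_atlas
begin

text \<open>The charts of the bundle and of the base may differ here, so a base component that
  vanishes in one chart is seen to vanish in all.\<close>

lemma differential_cotangent_snd_transition:
  assumes v: "v \<in> tangent_space (cotangent M) z" and i: "i \<in> charts_at (cotangent M) z" and j: "j \<in> charts_at M (snd z)"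
  shows "differential (cotangent M) M snd z v j = transition_deriv M (snd z) i j (snd (v i))"
proof -
  interpret C: smooth_atlas "cotangent M" by (rule smooth_atlas_cotangent)
  obtain p q where z: "z = (p, q)" by fastforce
  have i': "i \<in> charts_at M q" "j \<in> charts_at M q" using i j z by auto
  have idx: "i \<in> midx M" "j \<in> midx M" "q \<in> mdom M i" "q \<in> mdom M j" using i' by (auto simp: charts_at_iff)
  let ?S = "mmodel M \<times> mchart M i ` (mdom M i \<inter> mdom M j)"
  have S: "openin (top_of_set (mmodel M \<times> mmodel M)) ?S"
    by (rule openin_Times[OF openin_subtopology_self open_overlap[OF idx(1,2)]])
  have zS: "mchart (cotangent M) i z \<in> ?S"
    using z idx cotangent_space_in_model[OF _ i'(1), of p] i by auto
  have "((\<lambda>c. (mchart M j \<circ> chart_inv M i) (snd c)) has_derivative (\<lambda>c. transition_deriv M q i j (snd c)))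
      (at (mchart (cotangent M) i z) within mmodel M \<times> mmodel M)"
  proof (rule has_derivative_compose_openin[OF bounded_linear_imp_has_derivative[OF bounded_linear_snd] S zS])
    show "snd ` ?S \<subseteq> mmodel M" using openin_imp_subset[OF open_overlap[OF idx(1,2)]] by auto
    show "((mchart M j \<circ> chart_inv M i) has_derivative transition_deriv M q i j) (at (snd (mchart (cotangent M) i z)) within mmodel M)"
      using transition_has_derivative[OF i'] by (simp add: z)
  qed
  then have D: "((\<lambda>c. mchart M j (snd (chart_inv (cotangent M) i c))) has_derivative (\<lambda>c. transition_deriv M q i j (snd c)))
      (at (mchart (cotangent M) i z) within mmodel (cotangent M))"
    unfolding cotangent_simps(4)
  proof (rule has_derivative_cong_openin[OF _ S zS])
    fix c assume "c \<in> ?S"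
    then have "fst c \<in> mmodel M" "snd c \<in> mchart M i ` mdom M i" by auto
    from cotangent_chart_inv[OF idx(1) this]
    show "(mchart M j \<circ> chart_inv M i) (snd c) = mchart M j (snd (chart_inv (cotangent M) i c))" by simp
  qed
  show ?thesis
    using C.differential_eq[OF v i j openin_cotangent_snd_vimage[OF openin_mdom[OF idx(2)]] D] z by simp
qed

lemma zero_covector_mdom: "q \<in> mdom M i \<Longrightarrow> zero_covector q \<in> mdom (cotangent M) i"
  using zero_in_cotangent_space by (simp add: zero_covector_def)

lemma zero_section_iff:
  assumes i: "i \<in> midx M" and z: "z \<in> mdom (cotangent M) i"
  shows "z \<in> zero_section M \<longleftrightarrow> fst (mchart (cotangent M) i z) = 0"
proof -
  obtain p q where pq: "z = (p, q)" by fastforce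
  have q: "q \<in> points M" "i \<in> charts_at M q" "p \<in> cotangent_space M q" using i z pq by (auto simp: points_def charts_at_iff)
  have "p = (\<lambda>_. 0) \<longleftrightarrow> p i = 0"
    using cotangent_space_eqI[OF q(3) zero_in_cotangent_space q(2)] by auto
  then show ?thesis using q(1) by (auto simp: zero_section_def zero_covector_def pq)
qed

text \<open>The degenerate graph \<open>G = 0\<close> over the base coordinate;
  \<open>tangent_sub_iff\<close> then describes the tangent vectors of the zero section.\<close>

lemma graph_chart_zero_section:
  assumes i: "i \<in> midx M"
  shows "graph_chart (cotangent M) (zero_section M) i (mchart (cotangent M) i ` mdom (cotangent M) i)
    (mmodel (cotangent M)) (\<lambda>c. (0, snd c)) (\<lambda>_. 0)"
proof -
  interpret C: smooth_atlas "cotangent M" by (rule smooth_atlas_cotangent)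
  have i': "i \<in> midx (cotangent M)" using i by simp
  show ?thesis
  proof (intro graph_chart.intro graph_chart_axioms.intro smooth_atlas_cotangent)
    show "bounded_linear (\<lambda>c :: 'e \<times> 'e. (0 :: 'e, snd c))"
      by (intro bounded_linear_Pair bounded_linear_zero bounded_linear_snd)
    show "(chart_inv (cotangent M) i \<xi> \<in> zero_section M) = (\<xi> = (0, snd \<xi>) + 0)"
      if "\<xi> \<in> mchart (cotangent M) i ` mdom (cotangent M) i" for \<xi>
      using zero_section_iff[OF i chart_inv_in_mdom[OF that]] chart_chart_inv[OF that] by (simp add: prod_eq_iff)
    show "mchart (cotangent M) i ` mdom (cotangent M) i \<subseteq> mmodel (cotangent M)"
      using C.openin_image[OF i'] by (rule openin_imp_subset)
    show "(0 :: 'e \<times> 'e) \<in> mmodel (cotangent M)" using C.subspace_model by (rule subspace_0)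
  qed (use C.openin_image[OF i'] i' subspace_0[OF subspace_model] in \<open>auto simp: smooth_on_const zero_prod_def simp del: cotangent_simps(2,3)\<close>)
qed

lemma tangent_zero_sectionI:
  assumes v: "v \<in> tangent_space (cotangent M) (zero_covector q)" and i: "i \<in> charts_at M q" and 0: "fst (v i) = 0"
  shows "v \<in> tangent_sub (cotangent M) (zero_section M) (zero_covector q)"
proof -
  interpret C: smooth_atlas "cotangent M" by (rule smooth_atlas_cotangent)
  have i': "i \<in> midx M" "q \<in> mdom M i" "q \<in> points M" using i by (auto simp: charts_at_iff points_def)
  interpret Z: graph_chart "cotangent M" "zero_section M" i "mchart (cotangent M) i ` mdom (cotangent M) i"
    "mmodel (cotangent M)" "\<lambda>c. (0, snd c)" "\<lambda>_. 0" by (rule graph_chart_zero_section[OF i'(1)])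
  have dom: "zero_covector q \<in> mdom (cotangent M) i" by (rule zero_covector_mdom[OF i'(2)])
  have vi: "v i \<in> mmodel (cotangent M)"
    by (rule tangent_space_in_model[OF v]) (use dom i' in \<open>simp add: charts_at_iff del: cotangent_simps(2)\<close>)
  have m: "mchart (cotangent M) i (zero_covector q) \<in> mmodel (cotangent M)"
    using C.chart_in_model[of i] i'(1) dom by simp
  have "deriv_on (mmodel (cotangent M)) (\<lambda>_. 0 :: 'e \<times> 'e) (mchart (cotangent M) i (zero_covector q)) (v i) = 0"
    by (rule deriv_on_eq[OF has_derivative_const C.subspace_model m vi])
  then have "v i = (0, snd (v i)) + deriv_on (mmodel (cotangent M)) (\<lambda>_. 0) (mchart (cotangent M) i (zero_covector q)) (v i)"
    using 0 by (simp add: prod_eq_iff)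
  then show ?thesis
    using Z.tangent_sub_iff[OF dom imageI[OF dom] _ v] i'(3) by (simp add: zero_section_def)
qed

lemma closedin_zero_section: "closedin (mtop (cotangent M)) (zero_section M)"
proof -
  interpret C: smooth_atlas "cotangent M" by (rule smooth_atlas_cotangent)
  have sub: "zero_section M \<subseteq> points (cotangent M)"
    using zero_in_cotangent_space by (auto simp: zero_section_def zero_covector_def points_cotangent)
  have "openin (mtop (cotangent M)) (points (cotangent M) - zero_section M)"
    unfolding C.openin_mtop
  proof (intro conjI ballI)
    fix i assume "i \<in> midx (cotangent M)"
    then have i: "i \<in> midx M" "i \<in> midx (cotangent M)" by simp_all
    have "mdom (cotangent M) i \<subseteq> points (cotangent M)" using i(2) unfolding points_def by blast
    then have "mchart (cotangent M) i ` ((points (cotangent M) - zero_section M) \<inter> mdom (cotangent M) i) =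
      mchart (cotangent M) i ` mdom (cotangent M) i \<inter> (- {0}) \<times> UNIV"
      (is "?A = ?B")
    proof (intro subset_antisym subsetI)
      fix c assume "c \<in> ?A"
      then obtain z where "z \<in> mdom (cotangent M) i" "z \<notin> zero_section M" "c = mchart (cotangent M) i z" by blast
      then show "c \<in> ?B" using zero_section_iff[OF i(1), of z] by (simp add: mem_Times_iff del: cotangent_simps)
    next
      fix c assume "c \<in> ?B"
      then have "c \<in> mchart (cotangent M) i ` mdom (cotangent M) i" "fst c \<noteq> 0"
        by (auto simp: mem_Times_iff simp del: cotangent_simps)
      then obtain z where z: "z \<in> mdom (cotangent M) i" "c = mchart (cotangent M) i z" "fst c \<noteq> 0" by blast
      then have "z \<notin> zero_section M" using zero_section_iff[OF i(1), of z] by simp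
      then show "c \<in> ?A" using z \<open>mdom (cotangent M) i \<subseteq> points (cotangent M)\<close> by blast
    qed
    moreover have "openin (top_of_set (mmodel (cotangent M))) (mchart (cotangent M) i ` mdom (cotangent M) i \<inter> (- {0}) \<times> UNIV)"
      by (intro openin_Int_open C.openin_image i(2) open_Times) auto
    ultimately show "openin (top_of_set (mmodel (cotangent M))) (mchart (cotangent M) i ` ((points (cotangent M) - zero_section M) \<inter> mdom (cotangent M) i))"
      by simp
  qed auto
  then show ?thesis unfolding closedin_def C.topspace_mtop using sub by blast
qed

text \<open>Supplies the continuity of \<open>H\<close> along the zero section, which is the first
  component of the core map.\<close>

lemma continuous_zero_covector: "continuous_map (mtop M) (mtop (cotangent M)) zero_covector"
proof -
  interpret C: smooth_atlas "cotangent M" by (rule smooth_atlas_cotangent)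
  show ?thesis
    unfolding continuous_map_def topspace_mtop C.topspace_mtop
  proof (intro conjI allI impI)
    show "zero_covector \<in> points M \<rightarrow> points (cotangent M)"
      using zero_in_cotangent_space by (auto simp: zero_covector_def points_cotangent)
    fix U assume U: "openin (mtop (cotangent M)) U"
    show "openin (mtop M) {q \<in> points M. zero_covector q \<in> U}"
      unfolding openin_mtop
    proof (intro conjI ballI)
      fix i assume i: "i \<in> midx M"
      let ?S = "mchart M i ` mdom M i" and ?U = "mchart (cotangent M) i ` (U \<inter> mdom (cotangent M) i)"
      have "openin (top_of_set ?S) (?S \<inter> (\<lambda>y. (0, y)) -` ?U)"
      proof (rule continuous_openin_preimage)
        show "continuous_on ?S (\<lambda>y. (0 :: 'e, y))" by (intro continuous_intros)
        show "(\<lambda>y. (0, y)) \<in> ?S \<rightarrow> mmodel (cotangent M)"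
          using openin_imp_subset[OF openin_image[OF i]] subspace_0[OF subspace_model] by auto
        show "openin (top_of_set (mmodel (cotangent M))) ?U"
          using U i unfolding C.openin_mtop by (simp del: cotangent_simps(2))
      qed
      then have "openin (top_of_set (mmodel M)) (?S \<inter> (\<lambda>y. (0, y)) -` ?U)"
        using openin_image[OF i] by (rule openin_trans)
      moreover have "mchart M i ` ({q \<in> points M. zero_covector q \<in> U} \<inter> mdom M i) = ?S \<inter> (\<lambda>y. (0, y)) -` ?U"
      proof (intro subset_antisym subsetI)
        fix y assume "y \<in> mchart M i ` ({q \<in> points M. zero_covector q \<in> U} \<inter> mdom M i)"
        then obtain q where q: "q \<in> mdom M i" "zero_covector q \<in> U" "y = mchart M i q" by blast
        have "mchart (cotangent M) i (zero_covector q) \<in> ?U" using q(2) zero_covector_mdom[OF q(1)] by blast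
        then show "y \<in> ?S \<inter> (\<lambda>y. (0, y)) -` ?U" using q by (simp add: zero_covector_def)
      next
        fix y assume "y \<in> ?S \<inter> (\<lambda>y. (0, y)) -` ?U"
        then obtain q z where q: "q \<in> mdom M i" "y = mchart M i q" and z: "z \<in> U" "z \<in> mdom (cotangent M) i" "(0, y) = mchart (cotangent M) i z"
          by blast
        have "mchart (cotangent M) i (zero_covector q) = mchart (cotangent M) i z" using q z(3) by (simp add: zero_covector_def)
        then have "zero_covector q = z"
          using inj_onD[OF C.inj_chart[of i] _ zero_covector_mdom[OF q(1)] z(2)] i by simp
        then show "y \<in> mchart M i ` ({q \<in> points M. zero_covector q \<in> U} \<inter> mdom M i)"
          using q z(1) i by (auto simp: points_def)
      qed
      ultimately show "openin (top_of_set (mmodel M)) (mchart M i ` ({q \<in> points M. zero_covector q \<in> U} \<inter> mdom M i))" by simp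
    qed auto
  qed
qed

end

section \<open>The germ of the evolution relation\<close>

context hamiltonian
begin

sublocale RQ: two_atlases real_manifold Q
  by (intro two_atlases.intro smooth_atlas_real smooth_atlas_axioms)

section \<open>Coordinates on the morphism space\<close>

abbreviation A :: "(unit \<times> 'i, real \<times> 'q, real \<times> 'e) manifold" where "A \<equiv> prod_manifold real_manifold Q"

sublocale CA: smooth_atlas "cotangent A"
  by (rule RQ.prod.smooth_atlas_cotangent)

sublocale MS: two_atlases "cotangent A" "cotangent Q"
  by (intro two_atlases.intro CA.smooth_atlas_axioms C.smooth_atlas_axioms)

abbreviation MM where "MM \<equiv> morphism_space A Q"

text \<open>The same chart \<open>i\<close> serves for the starting point and for the image point,
  which suffices near the core because the flow starts at the identity.\<close>

abbreviation K :: "'i \<Rightarrow> (unit \<times> 'i) \<times> 'i" where "K i \<equiv> (((), i), i)"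

lemma real_transition_deriv: "transition_deriv real_manifold x i j s = s"
  using RQ.M.transition_deriv_self[of j x s] by simp

lemma cotangent_pair_chart:
  assumes "i \<in> midx Q" "z \<in> mdom (cotangent Q) i"
  shows "cotangent_pair real_manifold Q (real_covector t E) z \<in> mdom (cotangent A) ((), i)"
    "mchart (cotangent A) ((), i) (cotangent_pair real_manifold Q (real_covector t E) z) =
       ((t, fst (mchart (cotangent Q) i z)), (E, snd (mchart (cotangent Q) i z)))"
proof -
  obtain p q where z: "z = (p, q)" by fastforce
  have pq: "q \<in> mdom Q i" "p \<in> cotangent_space Q q" "i \<in> charts_at Q q" using assms z by (auto simp: charts_at_iff)
  let ?P = "\<lambda>(u :: unit, j). if u \<in> charts_at real_manifold E \<and> j \<in> charts_at Q q then (t, p j) else 0"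
  have "?P \<in> cotangent_space A (E, q)"
    unfolding cotangent_space_def mem_Collect_eq
  proof (intro conjI allI impI ballI)
    fix k assume "k \<notin> charts_at A (E, q)"
    then show "?P k = 0" by (cases k) auto
  next
    fix k assume "k \<in> charts_at A (E, q)"
    then show "?P k \<in> mmodel A" using pq(2) by (cases k) (auto intro: cotangent_space_in_model)
  next
    fix k l v assume kl: "k \<in> charts_at A (E, q)" "l \<in> charts_at A (E, q)" "v \<in> mmodel A"
    obtain a b s w where eq: "k = ((), a)" "l = ((), b)" "v = (s, w)" by (metis (full_types) old.unit.exhaust surj_pair)
    have ab: "a \<in> charts_at Q q" "b \<in> charts_at Q q" "w \<in> mmodel Q" using kl eq by auto
    have "transition_deriv A (E, q) ((), a) ((), b) (s, w) = (s, transition_deriv Q q a b w)"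
      using RQ.prod_transition_deriv[of "()" E "()" a q b s w] ab by (simp add: real_transition_deriv)
    then show "?P k \<bullet> v = ?P l \<bullet> transition_deriv A (E, q) k l v"
      using ab cotangent_space_transition[OF pq(2) ab] by (simp add: eq)
  qed
  then show "cotangent_pair real_manifold Q (real_covector t E) z \<in> mdom (cotangent A) ((), i)"
    "mchart (cotangent A) ((), i) (cotangent_pair real_manifold Q (real_covector t E) z) =
       ((t, fst (mchart (cotangent Q) i z)), (E, snd (mchart (cotangent Q) i z)))"
    using pq by (simp_all add: cotangent_pair_def real_covector_def z)
qed

lemma MM_image:
  assumes i: "i \<in> midx Q"
  shows "mchart MM (K i) ` mdom MM (K i) = ((UNIV \<times> mmodel Q) \<times> (UNIV \<times> mchart Q i ` mdom Q i)) \<times> img i"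
proof -
  have "mchart (cotangent A) ((), i) ` mdom (cotangent A) ((), i) = (UNIV \<times> mmodel Q) \<times> (UNIV \<times> mchart Q i ` mdom Q i)"
    using RQ.prod.cotangent_chart_image[of "((), i)" "((), i)"] i
    unfolding prod_manifold_simps RQ.prod_chart_image Int_absorb by simp
  then show ?thesis
    unfolding prod_manifold_simps(2) MS.prod_chart_image chart_image[OF i] by simp
qed

text \<open>
  In the chart \<open>K i\<close> a point of the morphism space has coordinates \<open>(((t, p), (E, y)), \<eta>)\<close>, where
  \<open>(t, p)\<close> is the covector at \<open>(E, y)\<close> and \<open>\<eta>\<close> is the image point. Over \<open>(t, p, y)\<close> in a flow box
  \<open>\<Phi>\<close>, the evolution relation is the graph \<open>E = H (\<Phi> ((p, y), t))\<close>, \<open>\<eta> = \<Phi> ((p, y), t)\<close>.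
\<close>

abbreviation flow_coords :: "((real \<times> 'e) \<times> (real \<times> 'e)) \<times> ('e \<times> 'e) \<Rightarrow> ('e \<times> 'e) \<times> real" where
  "flow_coords \<xi> \<equiv> ((snd (fst (fst \<xi>)), snd (snd (fst \<xi>))), fst (fst (fst \<xi>)))"

abbreviation graph_proj :: "((real \<times> 'e) \<times> (real \<times> 'e)) \<times> ('e \<times> 'e) \<Rightarrow> ((real \<times> 'e) \<times> (real \<times> 'e)) \<times> ('e \<times> 'e)" where
  "graph_proj \<xi> \<equiv> ((fst (fst \<xi>), (0, snd (snd (fst \<xi>)))), 0)"

text \<open>Restricts only the independent coordinates \<open>t\<close>, \<open>p\<close>,
  \<open>y\<close>, so it is a union of fibres of \<open>graph_proj\<close>, as
  \<open>graph_chart\<close> requires of its larger domain; \<open>chart_box\<close> adds the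
  condition that puts the image point into the chart.\<close>

definition cylinder :: "real \<Rightarrow> ('e \<times> 'e) set \<Rightarrow> (((real \<times> 'e) \<times> (real \<times> 'e)) \<times> ('e \<times> 'e)) set" where
  "cylinder e D = mmodel MM \<inter> flow_coords -` (D \<times> {-e<..<e})"

definition chart_box :: "'i \<Rightarrow> real \<Rightarrow> ('e \<times> 'e) set \<Rightarrow> (((real \<times> 'e) \<times> (real \<times> 'e)) \<times> ('e \<times> 'e)) set" where
  "chart_box i e D = cylinder e D \<inter> snd -` img i"

definition flow_graph :: "'i \<Rightarrow> (('e \<times> 'e) \<times> real \<Rightarrow> 'e \<times> 'e) \<Rightarrow>
    ((real \<times> 'e) \<times> (real \<times> 'e)) \<times> ('e \<times> 'e) \<Rightarrow> ((real \<times> 'e) \<times> (real \<times> 'e)) \<times> ('e \<times> 'e)" where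
  "flow_graph i \<Phi> \<xi> = (((0, 0), (Hc i (\<Phi> (flow_coords \<xi>)), 0)), \<Phi> (flow_coords \<xi>))"

definition flow_boxes :: "(((unit \<times> 'i \<Rightarrow> real \<times> 'e) \<times> (real \<times> 'q)) \<times> (('i \<Rightarrow> 'e) \<times> 'q)) set" where
  "flow_boxes = \<Union>{{m \<in> mdom MM (K i). mchart MM (K i) m \<in> chart_box i e D} | i e D. \<exists>\<Phi>. flow_box i e D \<Phi>}"

text \<open>A representative of the germ with the chart description available at each of its points;
  outside the boxes nothing is claimed about \<open>W_ham\<close>.\<close>

definition W_near :: "(((unit \<times> 'i \<Rightarrow> real \<times> 'e) \<times> (real \<times> 'q)) \<times> (('i \<Rightarrow> 'e) \<times> 'q)) set" where
  "W_near = W_ham Q H \<inter> flow_boxes"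

lemma bounded_linear_flow_coords: "bounded_linear flow_coords"
  by (intro bounded_linear_Pair bounded_linear_compose[OF bounded_linear_snd] bounded_linear_compose[OF bounded_linear_fst]
      bounded_linear_fst bounded_linear_snd)

lemma bounded_linear_graph_proj: "bounded_linear graph_proj"
  by (intro bounded_linear_Pair bounded_linear_compose[OF bounded_linear_snd] bounded_linear_compose[OF bounded_linear_fst]
      bounded_linear_fst bounded_linear_snd bounded_linear_zero)

lemma MM_model: "mmodel MM = ((UNIV \<times> mmodel Q) \<times> (UNIV \<times> mmodel Q)) \<times> LL"
  by simp

lemma flow_coords_model: "\<xi> \<in> mmodel MM \<Longrightarrow> flow_coords \<xi> \<in> LL \<times> UNIV"
  by (auto simp: MM_model simp del: prod_manifold_simps cotangent_simps)

lemma openin_cylinder: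
  assumes "flow_box i e D \<Phi>"
  shows "openin (top_of_set (mmodel MM)) (cylinder e D)"
  unfolding cylinder_def
proof (rule continuous_openin_preimage[OF linear_continuous_on[OF bounded_linear_flow_coords] _ flow_box_open[OF assms]])
  show "flow_coords \<in> mmodel MM \<rightarrow> LL \<times> UNIV" using flow_coords_model by blast
qed

lemma openin_chart_box:
  assumes "flow_box i e D \<Phi>"
  shows "openin (top_of_set (mmodel MM)) (chart_box i e D)"
proof -
  have i: "i \<in> midx Q" using assms by (simp add: flow_box_def)
  have "openin (top_of_set (cylinder e D)) (cylinder e D \<inter> snd -` img i)"
    by (rule continuous_openin_preimage[OF continuous_on_snd[OF continuous_on_id] _ openin_img[OF i]])
      (auto simp: cylinder_def)
  then show ?thesis unfolding chart_box_def using openin_cylinder[OF assms] by (rule openin_trans)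
qed

lemma chart_box_image:
  assumes "flow_box i e D \<Phi>"
  shows "chart_box i e D \<subseteq> mchart MM (K i) ` mdom MM (K i)"
proof -
  have i: "i \<in> midx Q" "D \<subseteq> img i" using assms by (auto simp: flow_box_def)
  show ?thesis
    unfolding MM_image[OF i(1)] chart_box_def cylinder_def MM_model using i(2) by auto
qed

lemma K_idx: "flow_box i e D \<Phi> \<Longrightarrow> K i \<in> midx MM"
  by (simp add: flow_box_def)

text \<open>\<open>cotangent_pair\<close> retains \<open>t\<close> and the starting point as
  coordinates, so a point of \<open>W_ham\<close> in the box has its time and its start in the flow
  box as well, and \<open>flow_box_flow\<close> determines the rest. Late returns of trajectories
  therefore contribute nothing to the box.\<close>

lemma W_chart:
  assumes b: "flow_box i e D \<Phi>" and \<xi>: "\<xi> \<in> chart_box i e D"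
  shows "chart_inv MM (K i) \<xi> \<in> W_ham Q H \<longleftrightarrow> \<xi> = graph_proj \<xi> + flow_graph i \<Phi> \<xi>"
proof -
  have i: "i \<in> midx Q" using b by (simp add: flow_box_def)
  let ?m = "chart_inv MM (K i) \<xi>"
  obtain t p E y \<eta> where xi: "\<xi> = (((t, p), (E, y)), \<eta>)" by (metis surj_pair)
  have D: "(p, y) \<in> D" and t: "t \<in> {-e<..<e}" using \<xi> by (auto simp: chart_box_def cylinder_def xi)
  have im: "(p, y) \<in> img i" "\<Phi> ((p, y), t) \<in> img i" using b D t unfolding flow_box_def by blast+
  have \<xi>i: "\<xi> \<in> mchart MM (K i) ` mdom MM (K i)" using chart_box_image[OF b] \<xi> by blast
  have m: "?m \<in> mdom MM (K i)" "mchart MM (K i) ?m = \<xi>"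
    using chart_inv_in_mdom[OF \<xi>i] chart_chart_inv[OF \<xi>i] by auto
  have rhs: "\<xi> = graph_proj \<xi> + flow_graph i \<Phi> \<xi> \<longleftrightarrow> E = Hc i (\<Phi> ((p, y), t)) \<and> \<eta> = \<Phi> ((p, y), t)"
    by (auto simp: xi flow_graph_def)
  let ?pt = "\<lambda>t z. (cotangent_pair real_manifold Q (real_covector t (H (flow (cotangent Q) X t z))) z, flow (cotangent Q) X t z)"
  have W: "?m \<in> W_ham Q H \<longleftrightarrow> (\<exists>t z. ?m = ?pt t z \<and> z \<in> points (cotangent Q) \<and> t \<in> flow_interval (cotangent Q) X z)"
    unfolding W_ham_def Let_def by blast
  have pt: "?pt t z \<in> mdom MM (K i)" "mchart MM (K i) (?pt t z) =
       (((t, fst (mchart (cotangent Q) i z)), (H (flow (cotangent Q) X t z), snd (mchart (cotangent Q) i z))), mchart (cotangent Q) i (flow (cotangent Q) X t z))"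
    if "z \<in> mdom (cotangent Q) i" "flow (cotangent Q) X t z \<in> mdom (cotangent Q) i" for t z
    using cotangent_pair_chart[OF i that(1), of t "H (flow (cotangent Q) X t z)"] that(2)
    unfolding prod_manifold_simps(2,3) by simp_all
  show ?thesis
    unfolding rhs W
  proof
    assume "\<exists>t z. ?m = ?pt t z \<and> z \<in> points (cotangent Q) \<and> t \<in> flow_interval (cotangent Q) X z"
    then obtain t' z where z: "?m = ?pt t' z" and zp: "z \<in> points (cotangent Q)" by blast
    obtain p' q where pq: "z = (p', q)" by fastforce
    have fz: "flow (cotangent Q) X t' z \<in> mdom (cotangent Q) i"
      and cp: "cotangent_pair real_manifold Q (real_covector t' (H (flow (cotangent Q) X t' z))) z \<in> mdom (cotangent A) ((), i)"
      using m(1) unfolding z prod_manifold_simps(2) by blast+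
    have "q \<in> mdom Q i" using cp by (simp add: pq cotangent_pair_def real_covector_def)
    then have zi: "z \<in> mdom (cotangent Q) i" using zp by (simp add: pq points_cotangent)
    have \<xi>: "(((t', fst (mchart (cotangent Q) i z)), (H (flow (cotangent Q) X t' z), snd (mchart (cotangent Q) i z))),
        mchart (cotangent Q) i (flow (cotangent Q) X t' z)) = (((t, p), (E, y)), \<eta>)"
      using m(2)[unfolded z] unfolding pt(2)[OF zi fz] by (rule trans[OF _ xi])
    then have eqs: "t' = t" "mchart (cotangent Q) i z = (p, y)" by (auto simp: prod_eq_iff)
    have zD: "mchart (cotangent Q) i z \<in> D" using D eqs(2) by simp
    have fl: "flow (cotangent Q) X t z = chart_inv (cotangent Q) i (\<Phi> ((p, y), t))"
      using flow_box_flow(2)[OF b zi zD t] eqs(2) by simp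
    then have "mchart (cotangent Q) i (flow (cotangent Q) X t z) = \<Phi> ((p, y), t)"
      using chart_inv_cot(2)[OF i im(2)] by simp
    moreover have "E = H (flow (cotangent Q) X t' z)" "\<eta> = mchart (cotangent Q) i (flow (cotangent Q) X t' z)"
      using \<xi> by auto
    ultimately show "E = Hc i (\<Phi> ((p, y), t)) \<and> \<eta> = \<Phi> ((p, y), t)" using eqs(1) fl by simp
  next
    assume eq: "E = Hc i (\<Phi> ((p, y), t)) \<and> \<eta> = \<Phi> ((p, y), t)"
    define z where "z = chart_inv (cotangent Q) i (p, y)"
    have z: "z \<in> mdom (cotangent Q) i" "mchart (cotangent Q) i z = (p, y)"
      unfolding z_def using chart_inv_cot[OF i im(1)] by auto
    have zD: "mchart (cotangent Q) i z \<in> D" using z D by simp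
    have fl: "flow (cotangent Q) X t z = chart_inv (cotangent Q) i (\<Phi> ((p, y), t))"
      and ti: "t \<in> flow_interval (cotangent Q) X z"
      using flow_box_flow[OF b z(1) zD t] z(2) by simp_all
    have fz: "flow (cotangent Q) X t z \<in> mdom (cotangent Q) i" "mchart (cotangent Q) i (flow (cotangent Q) X t z) = \<Phi> ((p, y), t)"
      unfolding fl using chart_inv_cot[OF i im(2)] by auto
    have "mchart MM (K i) (?pt t z) = \<xi>" using pt(2)[OF z(1) fz(1)] fz(2) z(2) eq fl by (simp add: xi)
    then have "?m = ?pt t z"
      using MS.prod.chart_inv_chart[OF K_idx[OF b] pt(1)[OF z(1) fz(1)]] by simp
    moreover have "z \<in> points (cotangent Q)" using z(1) i unfolding points_def by auto
    ultimately show "\<exists>t z. ?m = ?pt t z \<and> z \<in> points (cotangent Q) \<and> t \<in> flow_interval (cotangent Q) X z"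
      using ti by blast
  qed
qed

section \<open>The evolution relation as a lagrangian graph\<close>

lemma flow_graph_maps:
  assumes b: "flow_box i e D \<Phi>" and \<xi>: "\<xi> \<in> cylinder e D"
  shows "\<Phi> (flow_coords \<xi>) \<in> img i" "\<Phi> (flow_coords \<xi>) \<in> LL" "flow_graph i \<Phi> \<xi> \<in> mmodel MM"
proof -
  have i: "i \<in> midx Q" using b by (simp add: flow_box_def)
  have "(snd (fst (fst \<xi>)), snd (snd (fst \<xi>))) \<in> D" "fst (fst (fst \<xi>)) \<in> {-e<..<e}" using \<xi> by (auto simp: cylinder_def)
  then show im: "\<Phi> (flow_coords \<xi>) \<in> img i" using b unfolding flow_box_def by blast
  show LL: "\<Phi> (flow_coords \<xi>) \<in> LL" by (rule subsetD[OF img_sub[OF i] im])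
  show "flow_graph i \<Phi> \<xi> \<in> mmodel MM"
    using LL subspace_0[OF subspace_model] unfolding flow_graph_def MM_model by (simp add: mem_Times_iff)
qed

lemma smooth_flow_graph:
  assumes b: "flow_box i e D \<Phi>"
  shows "smooth_on (mmodel MM) (cylinder e D) (flow_graph i \<Phi>)"
proof -
  have i: "i \<in> midx Q" and sm: "smooth_on (LL \<times> UNIV) (D \<times> {-e<..<e}) \<Phi>" using b by (auto simp: flow_box_def)
  have sub: "D \<times> {-e<..<e} \<subseteq> LL \<times> UNIV" using flow_box_open[OF b] by (rule openin_imp_subset)
  have \<Phi>: "smooth_on (mmodel MM) (cylinder e D) (\<lambda>\<xi>. \<Phi> (flow_coords \<xi>))"
    by (rule smooth_on_compose[OF smooth_on_bounded_linear[OF bounded_linear_flow_coords] sm _ sub flow_box_subspace[OF b]])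
      (auto simp: cylinder_def)
  have "smooth_on (mmodel MM) (cylinder e D) (\<lambda>\<xi>. Hc i (\<Phi> (flow_coords \<xi>)))"
    by (rule smooth_on_compose[OF \<Phi> Hc_smooth[OF i] _ img_sub[OF i] subspace_LL]) (rule image_subsetI, rule flow_graph_maps(1)[OF b])
  then show ?thesis unfolding flow_graph_def by (intro smooth_on_Pair smooth_on_const \<Phi>)
qed

lemma graph_chart_W_near:
  assumes b: "flow_box i e D \<Phi>"
  shows "graph_chart MM W_near (K i) (chart_box i e D) (cylinder e D) graph_proj (flow_graph i \<Phi>)"
proof (intro graph_chart.intro graph_chart_axioms.intro MS.prod.smooth_atlas_axioms
    K_idx[OF b] openin_chart_box[OF b] chart_box_image[OF b] openin_cylinder[OF b] bounded_linear_graph_proj smooth_flow_graph[OF b] flow_graph_maps(3)[OF b])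
  show "chart_box i e D \<subseteq> cylinder e D" by (auto simp: chart_box_def)
  show "graph_proj \<xi> \<in> mmodel MM" if "\<xi> \<in> mmodel MM" for \<xi>
    using that subspace_0[OF subspace_model] unfolding MM_model by (auto simp: zero_prod_def)
  show "graph_proj (flow_graph i \<Phi> \<xi>) = 0" for \<xi> by (simp add: flow_graph_def zero_prod_def)
  show "\<eta> \<in> cylinder e D \<and> flow_graph i \<Phi> \<eta> = flow_graph i \<Phi> \<xi>"
    if "\<xi> \<in> cylinder e D" "\<eta> \<in> mmodel MM" "graph_proj \<eta> = graph_proj \<xi>" for \<xi> \<eta>
  proof -
    have "flow_coords \<eta> = flow_coords \<xi>" using that(3) by (simp add: prod_eq_iff)
    then show ?thesis using that(1,2) unfolding cylinder_def flow_graph_def by simp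
  qed
  show "chart_inv MM (K i) \<xi> \<in> W_near \<longleftrightarrow> \<xi> = graph_proj \<xi> + flow_graph i \<Phi> \<xi>" if \<xi>: "\<xi> \<in> chart_box i e D" for \<xi>
  proof -
    have "\<xi> \<in> mchart MM (K i) ` mdom MM (K i)" using chart_box_image[OF b] \<xi> by blast
    then have "chart_inv MM (K i) \<xi> \<in> {m \<in> mdom MM (K i). mchart MM (K i) m \<in> chart_box i e D}"
      using chart_inv_in_mdom[of \<xi> MM "K i"] chart_chart_inv[of \<xi> MM "K i"] \<xi> by simp
    then have "chart_inv MM (K i) \<xi> \<in> flow_boxes" unfolding flow_boxes_def using b by blast
    then show ?thesis unfolding W_near_def using W_chart[OF b \<xi>] by blast
  qed
qed simp

text \<open>With \<open>n\<close> the dimension of the model space of \<open>Q\<close>, the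
  coordinates \<open>t\<close>, \<open>p\<close>, \<open>y\<close> account for
  \<open>1 + 2 * n\<close> of the \<open>2 * (1 + n) + 2 * n\<close> dimensions.\<close>

lemma dim_graph_proj: "2 * dim (graph_proj ` mmodel MM) = dim (mmodel MM)"
proof -
  have eq: "graph_proj ` mmodel MM = (((UNIV :: real set) \<times> mmodel Q) \<times> ({0} \<times> mmodel Q)) \<times> {0}"
  proof (intro subset_antisym subsetI)
    fix \<xi> assume "\<xi> \<in> (((UNIV :: real set) \<times> mmodel Q) \<times> ({0 :: real} \<times> mmodel Q)) \<times> {0 :: 'e \<times> 'e}"
    then have "\<xi> = graph_proj \<xi>" "\<xi> \<in> mmodel MM"
      unfolding MM_model using subspace_0[OF subspace_model] by (auto simp: zero_prod_def)
    then show "\<xi> \<in> graph_proj ` mmodel MM" by (rule image_eqI)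
  qed (auto simp: MM_model simp del: prod_manifold_simps cotangent_simps)
  have s: "subspace (mmodel Q)" "subspace (UNIV :: real set)" "subspace {0 :: real}" "subspace {0 :: 'e \<times> 'e}"
    using subspace_model by (auto simp: subspace_def)
  show ?thesis
    unfolding eq unfolding MM_model by (simp add: dim_Times subspace_Times s)
qed

lemma W_near_box:
  assumes "x \<in> W_near"
  obtains i e D \<Phi> where "flow_box i e D \<Phi>" "x \<in> mdom MM (K i)" "mchart MM (K i) x \<in> chart_box i e D"
  using assms unfolding W_near_def flow_boxes_def by blast

lemma openin_flow_boxes: "openin (mtop MM) flow_boxes"
  unfolding flow_boxes_def
proof (rule openin_Union)
  fix S assume "S \<in> {{m \<in> mdom MM (K i). mchart MM (K i) m \<in> chart_box i e D} | i e D. \<exists>\<Phi>. flow_box i e D \<Phi>}"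
  then obtain i e D \<Phi> where S: "S = {m \<in> mdom MM (K i). mchart MM (K i) m \<in> chart_box i e D}" and b: "flow_box i e D \<Phi>" by blast
  show "openin (mtop MM) S" unfolding S by (rule MS.prod.openin_chart_vimage[OF K_idx[OF b] openin_chart_box[OF b]])
qed

lemma W_near_points: "W_near \<subseteq> points MM"
  using openin_flow_boxes unfolding W_near_def MS.prod.openin_mtop by blast

lemma submanifold_W_near: "submanifold MM (dim (graph_proj ` mmodel MM)) W_near"
proof (rule submanifold_graph_chart[OF W_near_points])
  fix x assume "x \<in> W_near"
  then obtain i e D \<Phi> where "flow_box i e D \<Phi>" "x \<in> mdom MM (K i)" "mchart MM (K i) x \<in> chart_box i e D" by (rule W_near_box)
  then show "\<exists>i N N' \<pi> G. graph_chart MM W_near i N N' \<pi> G \<and> x \<in> mdom MM i \<and> mchart MM i x \<in> N \<and>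
    dim (\<pi> ` mmodel MM) = dim (graph_proj ` mmodel MM)"
    by (intro exI conjI) (rule graph_chart_W_near, simp_all del: prod_manifold_simps cotangent_simps)
qed

lemma flow_graph_deriv:
  assumes b: "flow_box i e D \<Phi>" and \<xi>: "\<xi> \<in> cylinder e D" and u: "u \<in> mmodel MM"
  defines "c \<equiv> deriv_on (LL \<times> UNIV) \<Phi> (flow_coords \<xi>) (flow_coords u)"
  shows "deriv_on (mmodel MM) (flow_graph i \<Phi>) \<xi> u = (((0, 0), (deriv_on LL (Hc i) (\<Phi> (flow_coords \<xi>)) c, 0)), c)"
proof -
  have i: "i \<in> midx Q" using b by (simp add: flow_box_def)
  have cylinder: "openin (top_of_set (mmodel MM)) (cylinder e D)" by (rule openin_cylinder[OF b])
  have \<xi>M: "\<xi> \<in> mmodel MM" using \<xi> by (simp add: cylinder_def)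
  have dom: "(snd (fst (fst \<xi>)), snd (snd (fst \<xi>))) \<in> D" "fst (fst (fst \<xi>)) \<in> {-e<..<e}" using \<xi> by (auto simp: cylinder_def)
  have 1: "((\<lambda>\<xi>. \<Phi> (flow_coords \<xi>)) has_derivative (\<lambda>u. deriv_on (LL \<times> UNIV) \<Phi> (flow_coords \<xi>) (flow_coords u))) (at \<xi> within mmodel MM)"
  proof (rule has_derivative_compose_openin[OF bounded_linear_imp_has_derivative[OF bounded_linear_flow_coords] cylinder \<xi>])
    show "flow_coords ` cylinder e D \<subseteq> LL \<times> UNIV" by (rule image_subsetI, rule flow_coords_model) (simp add: cylinder_def)
    show "(\<Phi> has_derivative deriv_on (LL \<times> UNIV) \<Phi> (flow_coords \<xi>)) (at (flow_coords \<xi>) within LL \<times> UNIV)"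
      by (rule flow_box_has_derivative[OF b dom])
  qed
  have 2: "((\<lambda>\<xi>. Hc i (\<Phi> (flow_coords \<xi>))) has_derivative (\<lambda>u. deriv_on LL (Hc i) (\<Phi> (flow_coords \<xi>)) (deriv_on (LL \<times> UNIV) \<Phi> (flow_coords \<xi>) (flow_coords u)))) (at \<xi> within mmodel MM)"
  proof (rule has_derivative_compose_openin[OF 1 cylinder \<xi>])
    show "(\<lambda>\<xi>. \<Phi> (flow_coords \<xi>)) ` cylinder e D \<subseteq> LL" by (rule image_subsetI, rule flow_graph_maps(2)[OF b])
    show "(Hc i has_derivative deriv_on LL (Hc i) (\<Phi> (flow_coords \<xi>))) (at (\<Phi> (flow_coords \<xi>)) within LL)"
      by (rule Hc_deriv[OF i flow_graph_maps(1)[OF b \<xi>]])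
  qed
  have "(flow_graph i \<Phi> has_derivative (\<lambda>u. (((0, 0), (deriv_on LL (Hc i) (\<Phi> (flow_coords \<xi>)) (deriv_on (LL \<times> UNIV) \<Phi> (flow_coords \<xi>) (flow_coords u)), 0)),
      deriv_on (LL \<times> UNIV) \<Phi> (flow_coords \<xi>) (flow_coords u)))) (at \<xi> within mmodel MM)"
    unfolding flow_graph_def by (intro has_derivative_Pair has_derivative_const 1 2)
  from deriv_on_eq[OF this MS.prod.subspace_model \<xi>M u] show ?thesis unfolding c_def .
qed

text \<open>The linearised graph equation, in which the time part of the derivative of
  \<open>\<Phi>\<close> is \<open>\<tau>\<close> times the hamiltonian vector at the image point,
  and \<open>dH c\<close> is rewritten by the defining property of that vector.\<close>

lemma tangent_W_near:
  assumes b: "flow_box i e D \<Phi>" and x: "x \<in> W_near" "x \<in> mdom MM (K i)" "mchart MM (K i) x = \<xi>" "\<xi> \<in> chart_box i e D"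
    and v: "v \<in> tangent_space MM x"
    and vK: "v (K i) = (((\<tau>, a), (\<epsilon>, \<beta>)), c)"
  shows "v \<in> tangent_sub MM W_near x \<longleftrightarrow>
    c = deriv_on (LL \<times> UNIV) \<Phi> (flow_coords \<xi>) ((a, \<beta>), 0) + \<tau> *\<^sub>R Xc i (\<Phi> (flow_coords \<xi>)) \<and>
    \<epsilon> = symp (Xc i (\<Phi> (flow_coords \<xi>))) c"
proof -
  interpret W_near: graph_chart MM W_near "K i" "chart_box i e D" "cylinder e D" graph_proj "flow_graph i \<Phi>" by (rule graph_chart_W_near[OF b])
  have i: "i \<in> midx Q" using b by (simp add: flow_box_def)
  have \<xi>: "\<xi> \<in> cylinder e D" using x(4) by (simp add: chart_box_def)
  have K: "K i \<in> charts_at MM x" using K_idx[OF b] x(2) unfolding charts_at_iff by blast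
  have vM: "v (K i) \<in> mmodel MM" by (rule tangent_space_in_model[OF v K])
  have dom: "(snd (fst (fst \<xi>)), snd (snd (fst \<xi>))) \<in> D" "fst (fst (fst \<xi>)) \<in> {-e<..<e}" using \<xi> by (auto simp: cylinder_def)
  let ?c = "deriv_on (LL \<times> UNIV) \<Phi> (flow_coords \<xi>) (flow_coords (v (K i)))"
  have lv: "flow_coords (v (K i)) \<in> LL \<times> UNIV" by (rule flow_coords_model[OF vM])
  have c: "?c = deriv_on (LL \<times> UNIV) \<Phi> (flow_coords \<xi>) ((a, \<beta>), 0) + \<tau> *\<^sub>R Xc i (\<Phi> (flow_coords \<xi>))"
  proof -
    interpret D: bounded_linear "deriv_on (LL \<times> UNIV) \<Phi> (flow_coords \<xi>)"
      by (rule has_derivative_bounded_linear[OF flow_box_has_derivative[OF b dom]])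
    have "flow_coords (v (K i)) = ((a, \<beta>), 0) + (0, \<tau>)" by (simp add: vK)
    then have "?c = deriv_on (LL \<times> UNIV) \<Phi> (flow_coords \<xi>) ((a, \<beta>), 0) + deriv_on (LL \<times> UNIV) \<Phi> (flow_coords \<xi>) (0, \<tau>)"
      by (simp only: D.add)
    then show ?thesis using flow_box_time_deriv[OF b dom, of \<tau>] by simp
  qed
  have cL: "?c \<in> LL" by (rule flow_box_deriv_in[OF b dom lv])
  have s: "deriv_on LL (Hc i) (\<Phi> (flow_coords \<xi>)) ?c = symp (Xc i (\<Phi> (flow_coords \<xi>))) ?c"
    using symp_Xc[OF i flow_graph_maps(1)[OF b \<xi>] cL] by simp
  have "v \<in> tangent_sub MM W_near x \<longleftrightarrow> v (K i) = graph_proj (v (K i)) + deriv_on (mmodel MM) (flow_graph i \<Phi>) \<xi> (v (K i))"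
    using W_near.tangent_sub_iff[OF x(2) _ x(1) v] x(3,4) by simp
  also have "\<dots> \<longleftrightarrow> c = ?c \<and> \<epsilon> = symp (Xc i (\<Phi> (flow_coords \<xi>))) ?c"
    unfolding flow_graph_deriv[OF b \<xi> vM] s by (auto simp: vK)
  finally show ?thesis unfolding c by auto
qed

lemma isotropic_W_near:
  assumes x: "x \<in> W_near" and u: "u \<in> tangent_sub MM W_near x" and v: "v \<in> tangent_sub MM W_near x"
  shows "morphism_form A Q x u v = 0"
proof -
  obtain i e D \<Phi> where b: "flow_box i e D \<Phi>" and xi: "x \<in> mdom MM (K i)" "mchart MM (K i) x \<in> chart_box i e D"
    using x by (rule W_near_box)
  define \<xi> where "\<xi> = mchart MM (K i) x"
  have i: "i \<in> midx Q" using b by (simp add: flow_box_def)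
  have K: "K i \<in> charts_at MM x" using K_idx[OF b] xi(1) unfolding charts_at_iff by blast
  have uT: "u \<in> tangent_space MM x" and vT: "v \<in> tangent_space MM x" using u v by (auto simp: tangent_sub_def)
  obtain \<tau> a \<epsilon> \<beta> c where uK: "u (K i) = (((\<tau>, a), (\<epsilon>, \<beta>)), c)" by (metis surj_pair)
  obtain \<tau>' a' \<epsilon>' \<beta>' c' where vK: "v (K i) = (((\<tau>', a'), (\<epsilon>', \<beta>')), c')" by (metis surj_pair)
  have uM: "u (K i) \<in> mmodel MM" and vM: "v (K i) \<in> mmodel MM"
    by (rule tangent_space_in_model[OF uT K], rule tangent_space_in_model[OF vT K])
  have ab: "(a, \<beta>) \<in> LL" "(a', \<beta>') \<in> LL" using uM vM by (auto simp: uK vK)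
  have \<xi>: "\<xi> \<in> cylinder e D" using xi(2) by (simp add: chart_box_def \<xi>_def)
  have dom: "(snd (fst (fst \<xi>)), snd (snd (fst \<xi>))) \<in> D" "fst (fst (fst \<xi>)) \<in> {-e<..<e}" using \<xi> by (auto simp: cylinder_def)
  let ?X = "Xc i (\<Phi> (flow_coords \<xi>))"
  define w where "w = deriv_on (LL \<times> UNIV) \<Phi> (flow_coords \<xi>) ((a, \<beta>), 0)"
  define w' where "w' = deriv_on (LL \<times> UNIV) \<Phi> (flow_coords \<xi>) ((a', \<beta>'), 0)"
  have cu: "c = w + \<tau> *\<^sub>R ?X" "\<epsilon> = symp ?X c" and cv: "c' = w' + \<tau>' *\<^sub>R ?X" "\<epsilon>' = symp ?X c'"
    using tangent_W_near[OF b x xi(1) \<xi>_def[symmetric] _ uT uK] tangent_W_near[OF b x xi(1) \<xi>_def[symmetric] _ vT vK] u v xi(2)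
    unfolding w_def w'_def \<xi>_def by simp_all
  have ww: "symp w w' = symp (a, \<beta>) (a', \<beta>')"
    unfolding w_def w'_def by (rule flow_box_symplectic[OF b dom ab])
  have Ki: "((), i) \<in> charts_at (cotangent A) (fst x)" "i \<in> charts_at (cotangent Q) (snd x)"
    using K by (simp_all only: charts_at_prod_iff fst_conv snd_conv)
  have f: "canonical_form A (fst x) (differential MM (cotangent A) fst x u) (differential MM (cotangent A) fst x v) =
      \<tau> * \<epsilon>' + a \<bullet> \<beta>' - (\<tau>' * \<epsilon> + a' \<bullet> \<beta>)"
    using RQ.prod.canonical_form_chart[OF Ki(1) MS.differential_fst_tangent[OF uT K] MS.differential_fst_tangent[OF vT K]]
    unfolding MS.differential_fst[OF uT K] MS.differential_fst[OF vT K] uK vK by (simp add: inner_prod_def)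
  have g: "canonical_form Q (snd x) (differential MM (cotangent Q) snd x u) (differential MM (cotangent Q) snd x v) = symp c c'"
    using canonical_form_chart[OF Ki(2) MS.differential_snd_tangent[OF uT K] MS.differential_snd_tangent[OF vT K]]
    unfolding MS.differential_snd[OF uT K] MS.differential_snd[OF vT K] uK vK by (simp add: symp_def)
  have "morphism_form A Q x u v = - (\<tau> * \<epsilon>' + a \<bullet> \<beta>' - (\<tau>' * \<epsilon> + a' \<bullet> \<beta>)) + symp c c'"
    unfolding morphism_form_def prod_form_def pullback_def opposite_form_def f g ..
  \<comment> \<open>The term in \<open>\<tau> * \<tau>'\<close> vanishes and
    \<open>symp w w'\<close> is known. The mixed terms become
    \<open>\<tau> * \<epsilon>' - \<tau>' * \<epsilon>\<close>, which the time-energy part of the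
    opposite form cancels; its part on \<open>T*Q\<close> cancels the remainder.\<close>
  also have "symp c c' = symp (a, \<beta>) (a', \<beta>') + \<tau>' * symp w ?X + \<tau> * symp ?X w'"
    unfolding cu(1) cv(1) by (simp add: ww)
  also have "\<dots> = (a \<bullet> \<beta>' - a' \<bullet> \<beta>) - \<tau>' * \<epsilon> + \<tau> * \<epsilon>'"
    unfolding cu(2) cv(2) cu(1) cv(1) using symp_commute[of w ?X] by (simp add: symp_def[of "(a, \<beta>)"])
  finally show ?thesis by simp
qed

subsection \<open>The graph of the core map\<close>

abbreviation core :: "(((unit \<times> 'i \<Rightarrow> real \<times> 'e) \<times> (real \<times> 'q)) \<times> (('i \<Rightarrow> 'e) \<times> 'q)) set" where
  "core \<equiv> core_graph Q (J_ham H)"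

abbreviation core_proj :: "((real \<times> 'e) \<times> (real \<times> 'e)) \<times> ('e \<times> 'e) \<Rightarrow> ((real \<times> 'e) \<times> (real \<times> 'e)) \<times> ('e \<times> 'e)" where
  "core_proj \<xi> \<equiv> (((0, 0), (0, snd (snd (fst \<xi>)))), 0)"

text \<open>Another instance of the graph pattern: the core lies over \<open>y\<close> alone, with
  \<open>t\<close> and \<open>p\<close> zero and \<open>E\<close> the energy of the zero
  covector.\<close>

definition core_fun :: "'i \<Rightarrow> ((real \<times> 'e) \<times> (real \<times> 'e)) \<times> ('e \<times> 'e) \<Rightarrow> ((real \<times> 'e) \<times> (real \<times> 'e)) \<times> ('e \<times> 'e)" where
  "core_fun i \<xi> = (((0, 0), (Hc i (0, snd (snd (fst \<xi>))), 0)), (0, snd (snd (fst \<xi>))))"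

lemma chart_inv_zero_covector:
  assumes "i \<in> midx Q" "q \<in> mdom Q i"
  shows "chart_inv (cotangent Q) i (0, mchart Q i q) = zero_covector q"
  using C.chart_inv_chart[of i "zero_covector q"] zero_covector_mdom[OF assms(2)] assms(1)
  by (simp add: zero_covector_def)

lemma core_point_chart:
  assumes "q \<in> mdom Q i"
  shows "(zero_covector (J_ham H q), zero_covector q) \<in> mdom MM (K i)"
    "mchart MM (K i) (zero_covector (J_ham H q), zero_covector q) = (((0, 0), (H (zero_covector q), mchart Q i q)), (0, mchart Q i q))"
proof -
  have "zero_covector (J_ham H q) \<in> mdom (cotangent A) ((), i)"
    by (rule RQ.prod.zero_covector_mdom) (simp add: J_ham_def assms)
  then show "(zero_covector (J_ham H q), zero_covector q) \<in> mdom MM (K i)"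
    using zero_covector_mdom[OF assms] unfolding prod_manifold_simps(2) by blast
  show "mchart MM (K i) (zero_covector (J_ham H q), zero_covector q) = (((0, 0), (H (zero_covector q), mchart Q i q)), (0, mchart Q i q))"
    by (simp add: zero_covector_def J_ham_def zero_prod_def)
qed

lemma core_iff: "m \<in> core \<longleftrightarrow> (\<exists>q\<in>points Q. m = (zero_covector (J_ham H q), zero_covector q))"
  unfolding core_graph_def by blast

lemma core_chart:
  assumes i: "i \<in> midx Q" and \<xi>: "\<xi> \<in> mchart MM (K i) ` mdom MM (K i)"
  shows "chart_inv MM (K i) \<xi> \<in> core \<longleftrightarrow> \<xi> = core_proj \<xi> + core_fun i \<xi>"
proof -
  have K: "K i \<in> midx MM" using i by simp
  have m: "chart_inv MM (K i) \<xi> \<in> mdom MM (K i)" "mchart MM (K i) (chart_inv MM (K i) \<xi>) = \<xi>"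
    using chart_inv_in_mdom[OF \<xi>] chart_chart_inv[OF \<xi>] by auto
  show ?thesis
  proof
    assume "chart_inv MM (K i) \<xi> \<in> core"
    then obtain q where q: "chart_inv MM (K i) \<xi> = (zero_covector (J_ham H q), zero_covector q)" unfolding core_iff by blast
    have "zero_covector q \<in> mdom (cotangent Q) i" using m(1) unfolding q prod_manifold_simps(2) by blast
    then have qi: "q \<in> mdom Q i" by (simp add: zero_covector_def)
    have "\<xi> = (((0, 0), (H (zero_covector q), mchart Q i q)), (0, mchart Q i q))"
      using core_point_chart(2)[OF qi] m(2) unfolding q by simp
    then show "\<xi> = core_proj \<xi> + core_fun i \<xi>" by (simp add: core_fun_def chart_inv_zero_covector[OF i qi])
  next
    assume eq: "\<xi> = core_proj \<xi> + core_fun i \<xi>"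
    define y where "y = snd (snd (fst \<xi>))"
    have "y \<in> mchart Q i ` mdom Q i" using \<xi> unfolding MM_image[OF i] y_def by auto
    then obtain q where q: "q \<in> mdom Q i" "y = mchart Q i q" by blast
    have "\<xi> = (((0, 0), (Hc i (0, y), y)), (0, y))"
      using eq unfolding core_fun_def y_def[symmetric] by simp
    then have "mchart MM (K i) (zero_covector (J_ham H q), zero_covector q) = \<xi>"
      using core_point_chart(2)[OF q(1)] chart_inv_zero_covector[OF i q(1)] q(2) by simp
    then have "chart_inv MM (K i) \<xi> = (zero_covector (J_ham H q), zero_covector q)"
      using MS.prod.chart_inv_chart[OF K core_point_chart(1)[OF q(1)]] by simp
    then show "chart_inv MM (K i) \<xi> \<in> core" unfolding core_iff using q(1) i by (auto simp: points_def)
  qed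
qed

lemma graph_chart_core:
  assumes i: "i \<in> midx Q"
  shows "graph_chart MM core (K i) (mchart MM (K i) ` mdom MM (K i))
    (mmodel MM \<inter> (\<lambda>\<xi>. snd (snd (fst \<xi>))) -` (mchart Q i ` mdom Q i)) core_proj (core_fun i)"
proof -
  let ?y = "\<lambda>\<xi> :: ((real \<times> 'e) \<times> (real \<times> 'e)) \<times> ('e \<times> 'e). snd (snd (fst \<xi>))"
  let ?N = "mmodel MM \<inter> ?y -` (mchart Q i ` mdom Q i)"
  have K: "K i \<in> midx MM" using i by simp
  have y: "bounded_linear ?y"
    by (intro bounded_linear_compose[OF bounded_linear_snd] bounded_linear_snd bounded_linear_compose[OF _ bounded_linear_fst] bounded_linear_snd)
  have yL: "?y \<xi> \<in> mmodel Q" if "\<xi> \<in> mmodel MM" for \<xi>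
    using that unfolding MM_model by auto
  have N: "openin (top_of_set (mmodel MM)) ?N"
    by (rule continuous_openin_preimage[OF linear_continuous_on[OF y] _ openin_image[OF i]]) (use yL in blast)
  have 0: "0 \<in> mmodel Q" by (rule subspace_0[OF subspace_model])
  show ?thesis
  proof (intro graph_chart.intro graph_chart_axioms.intro MS.prod.smooth_atlas_axioms K MS.prod.openin_image[OF K] N)
    show "mchart MM (K i) ` mdom MM (K i) \<subseteq> ?N"
      using openin_imp_subset[OF MS.prod.openin_image[OF K]] unfolding MM_image[OF i] by auto
    show "bounded_linear core_proj"
      by (intro bounded_linear_Pair bounded_linear_zero y)
    show "core_proj \<xi> \<in> mmodel MM" if "\<xi> \<in> mmodel MM" for \<xi>
      using yL[OF that] 0 unfolding MM_model by (simp add: mem_Times_iff)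
    have 1: "smooth_on (mmodel MM) ?N (\<lambda>\<xi>. (0 :: 'e, ?y \<xi>))"
      by (intro smooth_on_Pair smooth_on_const smooth_on_bounded_linear y)
    have 2: "smooth_on (mmodel MM) ?N (\<lambda>\<xi>. Hc i (0, ?y \<xi>))"
      by (rule smooth_on_compose[OF 1 Hc_smooth[OF i] _ img_sub[OF i] subspace_LL]) (use 0 in auto)
    have 3: "smooth_on (mmodel MM) ?N ?y" by (rule smooth_on_bounded_linear[OF y])
    show "smooth_on (mmodel MM) ?N (core_fun i)"
      unfolding core_fun_def by (intro smooth_on_Pair smooth_on_const 2 3)
    show "core_fun i \<xi> \<in> mmodel MM" if "\<xi> \<in> ?N" for \<xi>
      using that yL[of \<xi>] 0 unfolding MM_model core_fun_def by (simp add: mem_Times_iff)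
    show "\<eta> \<in> ?N \<and> core_fun i \<eta> = core_fun i \<xi>" if "\<xi> \<in> ?N" "\<eta> \<in> mmodel MM" "core_proj \<eta> = core_proj \<xi>" for \<xi> \<eta>
      using that by (simp add: core_fun_def)
    show "chart_inv MM (K i) \<xi> \<in> core \<longleftrightarrow> \<xi> = core_proj \<xi> + core_fun i \<xi>" if "\<xi> \<in> mchart MM (K i) ` mdom MM (K i)" for \<xi>
      by (rule core_chart[OF i that])
  qed (simp_all add: core_fun_def zero_prod_def)
qed

lemma core_points: "core \<subseteq> points MM"
proof
  fix m assume "m \<in> core"
  then obtain q where q: "q \<in> points Q" "m = (zero_covector (J_ham H q), zero_covector q)" unfolding core_iff by blast
  then obtain i where i: "i \<in> midx Q" "q \<in> mdom Q i" by (auto simp: points_def)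
  have "K i \<in> midx MM" using i by simp
  then show "m \<in> points MM" using core_point_chart(1)[OF i(2)] unfolding q(2) points_def by blast
qed

lemma submanifold_core: "submanifold MM (dim (core_proj ` mmodel MM)) core"
proof (rule submanifold_graph_chart[OF core_points])
  fix m assume "m \<in> core"
  then obtain q where q: "q \<in> points Q" "m = (zero_covector (J_ham H q), zero_covector q)" unfolding core_iff by blast
  then obtain i where i: "i \<in> midx Q" "q \<in> mdom Q i" by (auto simp: points_def)
  have "m \<in> mdom MM (K i)" using core_point_chart(1)[OF i(2)] q(2) by blast
  then show "\<exists>i N N' \<pi> G. graph_chart MM core i N N' \<pi> G \<and> m \<in> mdom MM i \<and> mchart MM i m \<in> N \<and>
    dim (\<pi> ` mmodel MM) = dim (core_proj ` mmodel MM)"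
    using graph_chart_core[OF i(1)] by blast
qed

lemma core_point_box:
  assumes "q \<in> points Q"
  obtains i e D \<Phi> where "flow_box i e D \<Phi>" "q \<in> mdom Q i" "(0, mchart Q i q) \<in> D"
    "(((0, 0), (H (zero_covector q), mchart Q i q)), (0, mchart Q i q)) \<in> chart_box i e D"
    "(zero_covector (J_ham H q), zero_covector q) \<in> W_near"
proof -
  obtain i where i: "i \<in> midx Q" "q \<in> mdom Q i" using assms by (auto simp: points_def)
  have 0: "0 \<in> mmodel Q" by (rule subspace_0[OF subspace_model])
  have \<zeta>: "(0, mchart Q i q) \<in> img i" using i 0 by auto
  \<comment> \<open>Any flow box around the zero covector will do: at time 0 its map is the
    identity, which puts the core point on the graph.\<close>
  obtain e D \<Phi> where b: "flow_box i e D \<Phi>" and D: "(0, mchart Q i q) \<in> D" using flow_box_exists[OF i(1) \<zeta>] by blast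
  let ?\<xi> = "(((0 :: real, 0 :: 'e), (H (zero_covector q), mchart Q i q)), (0 :: 'e, mchart Q i q))"
  have e: "e > 0" and \<Phi>0: "\<Phi> ((0, mchart Q i q), 0) = (0, mchart Q i q)" using b D unfolding flow_box_def by auto
  have \<xi>: "?\<xi> \<in> chart_box i e D"
    using chart_in_model[OF i] 0 D e i unfolding chart_box_def cylinder_def MM_model by auto
  have "?\<xi> = graph_proj ?\<xi> + flow_graph i \<Phi> ?\<xi>"
    by (simp add: flow_graph_def \<Phi>0 chart_inv_zero_covector[OF i] zero_prod_def)
  then have "chart_inv MM (K i) ?\<xi> \<in> W_near" using graph_chart.graph[OF graph_chart_W_near[OF b] \<xi>] by blast
  moreover have "chart_inv MM (K i) ?\<xi> = (zero_covector (J_ham H q), zero_covector q)"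
    using MS.prod.chart_inv_chart[OF K_idx[OF b] core_point_chart(1)[OF i(2)]] unfolding core_point_chart(2)[OF i(2)] .
  ultimately show thesis using that[OF b i(2) D \<xi>] by simp
qed

lemma core_sub_W_near: "core \<subseteq> W_near"
proof
  fix m assume "m \<in> core"
  then obtain q where q: "q \<in> points Q" "m = (zero_covector (J_ham H q), zero_covector q)" unfolding core_iff by blast
  show "m \<in> W_near" using q(1) unfolding q(2) by (rule core_point_box)
qed

lemma core_sub_morphism_core: "core \<subseteq> morphism_core A Q"
proof
  fix m assume "m \<in> core"
  then obtain q where q: "q \<in> points Q" "m = (zero_covector (J_ham H q), zero_covector q)" unfolding core_iff by blast
  have "J_ham H q \<in> points A" using q(1) by (simp add: points_prod J_ham_def)
  then show "m \<in> morphism_core A Q" using q unfolding morphism_core_def zero_section_def by blast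
qed

text \<open>The zero section imposes \<open>t = 0\<close> and \<open>p = 0\<close>, and at time 0
  the local flow is the identity, so the graph equation forces the image point to be
  \<open>(0, y)\<close> and the energy to be the value of \<open>H\<close> there.\<close>

lemma W_near_Int_morphism_core: "W_near \<inter> morphism_core A Q = core"
proof (intro subset_antisym subsetI)
  fix x assume "x \<in> core"
  then show "x \<in> W_near \<inter> morphism_core A Q" using core_sub_W_near core_sub_morphism_core by blast
next
  fix x assume x: "x \<in> W_near \<inter> morphism_core A Q"
  then have xV: "x \<in> W_near" by blast
  obtain i e D \<Phi> where b: "flow_box i e D \<Phi>" and xi: "x \<in> mdom MM (K i)" "mchart MM (K i) x \<in> chart_box i e D"
    using xV by (rule W_near_box)
  have i: "i \<in> midx Q" using b by (simp add: flow_box_def)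
  obtain a c where ac: "x = (a, c)" by (rule prod.exhaust)
  obtain t p E y \<eta> where \<xi>: "mchart MM (K i) x = (((t, p), (E, y)), \<eta>)" by (metis surj_pair)
  have a: "a \<in> zero_section A" "a \<in> mdom (cotangent A) ((), i)"
    using x xi(1) unfolding ac morphism_core_def prod_manifold_simps(2) by blast+
  have "mchart (cotangent A) ((), i) a = ((t, p), (E, y))" using \<xi> unfolding ac prod_manifold_simps(3) by simp
  then have tp: "t = 0" "p = 0"
    using RQ.prod.zero_section_iff[OF _ a(2)] a(1) i by (simp_all add: prod_eq_iff)
  have inv: "chart_inv MM (K i) (((t, p), (E, y)), \<eta>) = x"
    using MS.prod.chart_inv_chart[OF K_idx[OF b] xi(1)] unfolding \<xi> .
  have chart_box: "(((t, p), (E, y)), \<eta>) \<in> chart_box i e D" using xi(2) unfolding \<xi> .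
  have D: "(0, y) \<in> D" using chart_box unfolding chart_box_def cylinder_def tp by simp
  then have \<Phi>0: "\<Phi> ((0, y), 0) = (0, y)" using b unfolding flow_box_def by blast
  have "(((t, p), (E, y)), \<eta>) = graph_proj (((t, p), (E, y)), \<eta>) + flow_graph i \<Phi> (((t, p), (E, y)), \<eta>)"
    using graph_chart.graph[OF graph_chart_W_near[OF b] chart_box] xV unfolding inv by blast
  then have "E = Hc i (0, y)" "\<eta> = (0, y)" unfolding flow_graph_def tp by (simp_all add: \<Phi>0)
  then have "(((t, p), (E, y)), \<eta>) = core_proj (((t, p), (E, y)), \<eta>) + core_fun i (((t, p), (E, y)), \<eta>)"
    by (simp add: tp core_fun_def)
  then show "x \<in> core"
    using core_chart[OF i, of "(((t, p), (E, y)), \<eta>)"] chart_box_image[OF b] chart_box unfolding inv by blast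
qed

lemma represents_W_near: "represents_submicrofold MM (morphism_core A Q) W_near core"
  unfolding represents_submicrofold_def
proof (intro conjI exI)
  show "submanifold MM (dim (graph_proj ` mmodel MM)) W_near" by (rule submanifold_W_near)
  show "submanifold MM (dim (core_proj ` mmodel MM)) core" by (rule submanifold_core)
  \<comment> \<open>The core is cut out of \<open>W_near\<close> by a product of two closed zero
    sections, hence closed in it.\<close>
  have "closedin (mtop MM) (morphism_core A Q)"
    unfolding MS.mtop_prod morphism_core_def
    using RQ.prod.closedin_zero_section closedin_zero_section by (simp add: closedin_prod_Times_iff)
  then show "closedin (subtopology (mtop MM) W_near) core"
    unfolding closedin_subtopology using W_near_Int_morphism_core by blast
qed (rule core_sub_morphism_core, rule W_near_Int_morphism_core)

lemma lagrangian_W_near: "lagrangian MM (morphism_form A Q) W_near"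
  unfolding lagrangian_def using submanifold_W_near dim_graph_proj isotropic_W_near by blast

section \<open>Transversality along the core\<close>

lemma vertical_vectorI:
  assumes v: "v \<in> tangent_space (cotangent Q) z" and i: "i \<in> charts_at (cotangent Q) z" and 0: "snd (v i) = 0"
  shows "v \<in> vertical_space Q z"
proof -
  have iz: "i \<in> charts_at Q (snd z)" using i by (cases z) simp
  have "differential (cotangent Q) Q snd z v j = 0" for j
  proof (cases "j \<in> charts_at Q (snd z)")
    case True
    interpret bounded_linear "transition_deriv Q (snd z) i j" by (rule transition_deriv_bounded_linear[OF iz True])
    show ?thesis using differential_cotangent_snd_transition[OF v i True] 0 zero by simp
  next
    case False
    then show ?thesis by (simp add: differential_def)
  qed
  then show ?thesis using v unfolding vertical_space_def by auto
qed

lemma transverse_W_near: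
  assumes "z \<in> core"
  shows "transverse_at MM z (tangent_sub MM W_near z) (zero_vertical_space A Q z)"
  unfolding transverse_at_def
proof (intro subset_antisym subsetI)
  fix w assume "w \<in> {\<lambda>i. u i + v i |u v. u \<in> tangent_sub MM W_near z \<and> v \<in> zero_vertical_space A Q z}"
  then obtain u v where w: "w = (\<lambda>i. u i + v i)" and "u \<in> tangent_sub MM W_near z" "v \<in> zero_vertical_space A Q z" by blast
  then have "u \<in> tangent_space MM z" "v \<in> tangent_space MM z" unfolding tangent_sub_def zero_vertical_space_def by blast+
  then show "w \<in> tangent_space MM z" unfolding w by (rule MS.prod.tangent_space_add)
next
  fix w assume w: "w \<in> tangent_space MM z"
  obtain q where q: "q \<in> points Q" and z: "z = (zero_covector (J_ham H q), zero_covector q)" using assms unfolding core_iff by blast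
  obtain i e D \<Phi> where b: "flow_box i e D \<Phi>" and qi: "q \<in> mdom Q i" and D: "(0, mchart Q i q) \<in> D"
    and chart_box: "(((0, 0), (H (zero_covector q), mchart Q i q)), (0, mchart Q i q)) \<in> chart_box i e D"
    and zV: "(zero_covector (J_ham H q), zero_covector q) \<in> W_near"
    using q by (rule core_point_box)
  have i: "i \<in> midx Q" using b by (simp add: flow_box_def)
  have zm: "z \<in> mdom MM (K i)" "mchart MM (K i) z = (((0, 0), (H (zero_covector q), mchart Q i q)), (0, mchart Q i q))"
    unfolding z by (rule core_point_chart[OF qi])+
  have K: "K i \<in> charts_at MM z" using K_idx[OF b] zm(1) unfolding charts_at_iff by blast
  have Ki: "((), i) \<in> charts_at (cotangent A) (fst z)" "i \<in> charts_at (cotangent Q) (snd z)"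
    using K by (simp_all only: charts_at_prod_iff fst_conv snd_conv)
  have iA: "((), i) \<in> charts_at A (J_ham H q)" using i qi by (simp add: J_ham_def charts_at_iff)
  obtain \<tau> a \<epsilon> \<beta> \<pi> \<kappa> where wK: "w (K i) = (((\<tau>, a), (\<epsilon>, \<beta>)), (\<pi>, \<kappa>))" by (metis surj_pair)
  have wM: "a \<in> mmodel Q" "\<beta> \<in> mmodel Q" "\<pi> \<in> mmodel Q" "\<kappa> \<in> mmodel Q"
    using tangent_space_in_model[OF w K] unfolding wK MM_model by auto
  let ?X = "Xc i (0, mchart Q i q)"
  have XL: "fst ?X \<in> mmodel Q" "snd ?X \<in> mmodel Q" using Xc_in[of i "(0, mchart Q i q)"] by (auto simp: mem_Times_iff)
  \<comment> \<open>The second summand \<open>v\<close> has no \<open>t\<close> and \<open>p\<close>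
    components and is vertical at the image point, so the first summand \<open>u\<close> must carry
    \<open>\<tau>\<close> and \<open>a\<close> and have image base component
    \<open>\<kappa>\<close>. As the flow at time 0 is the identity, that component is
    \<open>\<beta>' + \<tau> *\<^sub>R snd ?X\<close>, which is solved for \<open>\<beta>'\<close>;
    everything left over goes into \<open>v\<close>.\<close>
  define \<beta>' where "\<beta>' = \<kappa> - \<tau> *\<^sub>R snd ?X"
  define c where "c = (a, \<beta>') + \<tau> *\<^sub>R ?X"
  have \<beta>': "\<beta>' \<in> mmodel Q" unfolding \<beta>'_def by (intro subspace_diff subspace_mul subspace_model wM XL)
  have c: "c = (a + \<tau> *\<^sub>R fst ?X, \<kappa>)" by (simp add: c_def \<beta>'_def prod_eq_iff)
  have cL: "a + \<tau> *\<^sub>R fst ?X \<in> mmodel Q" by (intro subspace_add subspace_mul subspace_model wM XL)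
  have "(((\<tau>, a), (symp ?X c, \<beta>')), c) \<in> mmodel MM"
    unfolding MM_model c using wM \<beta>' cL by (simp add: mem_Times_iff)
  then obtain u where u: "u \<in> tangent_space MM z" "u (K i) = (((\<tau>, a), (symp ?X c, \<beta>')), c)"
    using MS.prod.tangent_vector_exists[OF K] by metis
  have "((((0, 0), (\<epsilon> - symp ?X c, \<beta> - \<beta>')), (\<pi> - fst c, 0)) :: ((real \<times> 'e) \<times> (real \<times> 'e)) \<times> ('e \<times> 'e)) \<in> mmodel MM"
    unfolding MM_model c using wM \<beta>' cL subspace_0[OF subspace_model]
    by (simp add: mem_Times_iff subspace_diff[OF subspace_model])
  then obtain v where v: "v \<in> tangent_space MM z"
    "v (K i) = (((0, 0), (\<epsilon> - symp ?X c, \<beta> - \<beta>')), (\<pi> - fst c, 0))"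
    using MS.prod.tangent_vector_exists[OF K] by metis
  have \<Phi>0: "\<Phi> ((0, mchart Q i q), 0) = (0, mchart Q i q)" using b D unfolding flow_box_def by blast
  have "u \<in> tangent_sub MM W_near z"
    using tangent_W_near[OF b zV[folded z] zm chart_box u] flow_box_initial_deriv[OF b D, of "(a, \<beta>')"] wM(1) \<beta>' \<Phi>0
    by (simp add: c_def)
  moreover have "v \<in> zero_vertical_space A Q z"
    unfolding zero_vertical_space_def mem_Collect_eq
  proof (intro conjI v(1))
    have "differential MM (cotangent A) fst z v \<in> tangent_space (cotangent A) (zero_covector (J_ham H q))"
      using MS.differential_fst_tangent[OF v(1) K] by (simp add: z)
    from RQ.prod.tangent_zero_sectionI[OF this iA]
    show "differential MM (cotangent A) fst z v \<in> tangent_sub (cotangent A) (zero_section A) (fst z)"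
      using MS.differential_fst[OF v(1) K] v(2) by (simp add: z zero_prod_def)
    show "differential MM (cotangent Q) snd z v \<in> vertical_space Q (snd z)"
      by (rule vertical_vectorI[OF MS.differential_snd_tangent[OF v(1) K] Ki(2)])
        (use MS.differential_snd[OF v(1) K] v(2) in simp)
  qed
  moreover have "w = (\<lambda>i. u i + v i)"
  proof (rule MS.prod.tangent_space_eqI[OF w MS.prod.tangent_space_add[OF u(1) v(1)] K])
    show "w (K i) = u (K i) + v (K i)" unfolding wK u(2) v(2) by (simp add: c)
  qed
  ultimately show "w \<in> {\<lambda>i. u i + v i |u v. u \<in> tangent_sub MM W_near z \<and> v \<in> zero_vertical_space A Q z}" by blast
qed

section \<open>The core map and the comparison of germs\<close>

lemma smooth_J: "smooth_map Q A (J_ham H)"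
  unfolding smooth_map_def
proof (intro conjI ballI)
  have "continuous_map (mtop (cotangent Q)) euclidean H" using H_smooth unfolding smooth_map_def mtop_real by blast
  then have "continuous_map (mtop Q) euclidean (H \<circ> zero_covector)"
    using continuous_zero_covector by (rule continuous_map_compose[rotated])
  then have "continuous_map (mtop Q) (prod_topology euclidean (mtop Q)) (\<lambda>q. ((H \<circ> zero_covector) q, q))"
    by (intro continuous_map_pairedI continuous_map_id[unfolded id_def])
  then show "continuous_map (mtop Q) (mtop A) (J_ham H)"
    unfolding RQ.mtop_prod mtop_real J_ham_def by (simp add: o_def)
  fix i k assume i: "i \<in> midx Q" and k: "k \<in> midx A"
  obtain j where j: "k = ((), j)" "j \<in> midx Q" using k by (cases k) auto
  let ?S = "mchart Q i ` (mdom Q i \<inter> mdom Q j)"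
  have 1: "smooth_on (mmodel Q) ?S (\<lambda>y. (0 :: 'e, y))"
    by (intro smooth_on_Pair smooth_on_const smooth_on_bounded_linear bounded_linear_ident)
  have "smooth_on (mmodel Q) ?S (\<lambda>y. Hc i (0, y))"
    by (rule smooth_on_compose[OF 1 Hc_smooth[OF i] _ img_sub[OF i] subspace_LL])
      (use subspace_0[OF subspace_model] in auto)
  then have "smooth_on (mmodel Q) ?S (\<lambda>y. (Hc i (0, y), (mchart Q j \<circ> chart_inv Q i) y))"
    by (intro smooth_on_Pair smooth_transition i j)
  then have "smooth_on (mmodel Q) ?S (mchart A k \<circ> J_ham H \<circ> chart_inv Q i)"
  proof (rule smooth_on_cong)
    fix y assume "y \<in> ?S"
    then obtain q where q: "q \<in> mdom Q i" "y = mchart Q i q" by blast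
    then show "(Hc i (0, y), (mchart Q j \<circ> chart_inv Q i) y) = (mchart A k \<circ> J_ham H \<circ> chart_inv Q i) y"
      by (simp add: j(1) J_ham_def chart_inv_zero_covector[OF i] chart_inv_chart[OF i])
  qed
  moreover have "mdom Q i \<inter> J_ham H -` mdom A k = mdom Q i \<inter> mdom Q j" by (auto simp: j(1) J_ham_def)
  ultimately show "smooth_on (mmodel Q) (mchart Q i ` (mdom Q i \<inter> J_ham H -` mdom A k)) (mchart A k \<circ> J_ham H \<circ> chart_inv Q i)"
    by simp
qed

text \<open>\<open>flow_boxes\<close> is an open set containing the core, so every neighbourhood of
  the core can be shrunk into it, and there the two sets coincide.\<close>

lemma germ_W_near: "germ_around MM core (W_ham Q H) = germ_around MM core W_near"
proof -
  have CU: "core \<subseteq> flow_boxes" using core_sub_W_near unfolding W_near_def by blast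
  show ?thesis
    unfolding germ_around_def
  proof (intro Collect_cong conj_cong refl iffI)
    fix V' assume "\<exists>T. openin (mtop MM) T \<and> core \<subseteq> T \<and> V' \<inter> T = W_ham Q H \<inter> T"
    then obtain T where T: "openin (mtop MM) T" "core \<subseteq> T" "V' \<inter> T = W_ham Q H \<inter> T" by blast
    then have "V' \<inter> (T \<inter> flow_boxes) = W_near \<inter> (T \<inter> flow_boxes)" unfolding W_near_def by blast
    then show "\<exists>T. openin (mtop MM) T \<and> core \<subseteq> T \<and> V' \<inter> T = W_near \<inter> T"
      using openin_Int[OF T(1) openin_flow_boxes] T(2) CU by (intro exI[of _ "T \<inter> flow_boxes"]) auto
  next
    fix V' assume "\<exists>T. openin (mtop MM) T \<and> core \<subseteq> T \<and> V' \<inter> T = W_near \<inter> T"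
    then obtain T where T: "openin (mtop MM) T" "core \<subseteq> T" "V' \<inter> T = W_near \<inter> T" by blast
    then have "V' \<inter> (T \<inter> flow_boxes) = W_ham Q H \<inter> (T \<inter> flow_boxes)" unfolding W_near_def by blast
    then show "\<exists>T. openin (mtop MM) T \<and> core \<subseteq> T \<and> V' \<inter> T = W_ham Q H \<inter> T"
      using openin_Int[OF T(1) openin_flow_boxes] T(2) CU by (intro exI[of _ "T \<inter> flow_boxes"]) auto
  qed
qed

end

theorem proposition35:
  fixes Q :: "('i, 'q, 'e::euclidean_space) manifold"
    and H :: "('i \<Rightarrow> 'e) \<times> 'q \<Rightarrow> real"
  assumes "smooth_manifold Q"
    and "smooth_map (cotangent Q) real_manifold H"
  shows "symplectic_micromorphism (prod_manifold real_manifold Q) Q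
           (germ_around (morphism_space (prod_manifold real_manifold Q) Q)
              (core_graph Q (J_ham H)) (W_ham Q H))
           (J_ham H)"
proof -
  interpret hamiltonian Q H
    using assms by (intro hamiltonian.intro hamiltonian_axioms.intro smooth_manifold_atlas) (auto simp: smooth_manifold_def)
  show ?thesis
    unfolding symplectic_micromorphism_def
    by (intro conjI exI[of _ W_near] ballI assms(1) smooth_manifold_prod smooth_manifold_real smooth_J germ_W_near
        represents_W_near lagrangian_W_near transverse_W_near)
qed

end
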